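(* For a virtual knot diagram $K$ let $J(K)=w(K)|_{Odd(K)}$ be the sum of the signs of the odd crossings of $K$. Then $J(K)$ is invariant under equivalence of virtual knots. If $K$ is a classical diagram, then $Odd(K)$ is empty, and hence $J$ is zero on classical knots.
   Context: A virtual knot diagram is a generic immersion of a circle in the plane whose double points are each marked either as a classical crossing (with over/under information) or as a virtual crossing (neither over nor under). A classical diagram is one with no virtual crossings. Equivalence of virtual knot diagrams is generated by planar isotopy, the classical Reidemeister moves I, II, III, and the detour move: an arc passing through a consecutive sequence of virtual crossings only may be replaced, keeping its endpoints fixed, by any other arc in the plane all of whose crossings (with the diagram and with itself) are virtual. The sign of a classical crossing is $\pm1$ by the usual right-handed convention with respect to an orientation of the knot; it does not depend on which orientation is chosen. A classical crossing $i$ of $K$ is odd if one encounters an odd number of classical crossings (counted with multiplicity, not counting $i$ itself) in walking along the diagram on one full path that starts at $i$ and returns to $i$. $Odd(K)$ denotes the set of odd crossings of $K$. *)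

theory Defs
  imports "HOL-Analysis.Analysis"
begin

text \<open>
  The plane is \<^typ>\<open>complex\<close> and the circle is the real line modulo 1, so that an immersed
  circle is a 1-periodic immersion of the real line; two times \<^term>\<open>s\<close>, \<^term>\<open>t\<close> are the same
  point of the circle iff \<^prop>\<open>s - t \<in> \<int>\<close>.  Everything is done in the class \<open>C\<^sup>1\<close>; smooth
  diagrams and smooth moves are particular cases.
\<close>

definition wedge :: "complex \<Rightarrow> complex \<Rightarrow> real" where
  "wedge u v = Re u * Im v - Im u * Re v"

definition immersed_circle :: "(real \<Rightarrow> complex) \<Rightarrow> bool" where
  "immersed_circle \<gamma> \<longleftrightarrow>
     (\<forall>t. \<gamma> (t + 1) = \<gamma> t) \<and>
     \<gamma> C1_differentiable_on UNIV \<and>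
     (\<forall>t. vector_derivative \<gamma> (at t) \<noteq> 0)"

definition crossing_pair :: "(real \<Rightarrow> complex) \<Rightarrow> real \<Rightarrow> real \<Rightarrow> bool" where
  "crossing_pair \<gamma> s t \<longleftrightarrow> s - t \<notin> \<int> \<and> \<gamma> s = \<gamma> t"

text \<open>Generic: finitely many multiple points, all of them transverse double points.\<close>

definition generic_immersion :: "(real \<Rightarrow> complex) \<Rightarrow> bool" where
  "generic_immersion \<gamma> \<longleftrightarrow>
     immersed_circle \<gamma> \<and>
     finite {\<gamma> s |s. \<exists>t. crossing_pair \<gamma> s t} \<and>
     (\<forall>r s t. crossing_pair \<gamma> r s \<and> crossing_pair \<gamma> s t \<longrightarrow> r - t \<in> \<int>) \<and>
     (\<forall>s t. crossing_pair \<gamma> s t \<longrightarrow>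
        wedge (vector_derivative \<gamma> (at s)) (vector_derivative \<gamma> (at t)) \<noteq> 0)"

text \<open>
  The marking of the double points is recorded by the sets of times at which the curve makes
  the over-passage, respectively the under-passage, of a classical crossing.  A double point
  whose two times lie in neither set is a virtual crossing.
\<close>

record diagram =
  curve :: "real \<Rightarrow> complex"
  overs :: "real set"
  unders :: "real set"

definition virtual_knot_diagram :: "diagram \<Rightarrow> bool" where
  "virtual_knot_diagram K \<longleftrightarrow>
     generic_immersion (curve K) \<and>
     (\<forall>t. t + 1 \<in> overs K \<longleftrightarrow> t \<in> overs K) \<and>
     (\<forall>t. t + 1 \<in> unders K \<longleftrightarrow> t \<in> unders K) \<and>
     overs K \<inter> unders K = {} \<and>
     (\<forall>s\<in>overs K. \<exists>t\<in>unders K. crossing_pair (curve K) s t) \<and>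
     (\<forall>t\<in>unders K. \<exists>s\<in>overs K. crossing_pair (curve K) s t)"

definition classical_diagram :: "diagram \<Rightarrow> bool" where
  "classical_diagram K \<longleftrightarrow>
     virtual_knot_diagram K \<and>
     (\<forall>s t. crossing_pair (curve K) s t \<longrightarrow> s \<in> overs K \<union> unders K)"

definition classical_crossings :: "diagram \<Rightarrow> complex set" where
  "classical_crossings K = curve K ` overs K"

definition over_time :: "diagram \<Rightarrow> complex \<Rightarrow> real" where
  "over_time K z = (THE t. 0 \<le> t \<and> t < 1 \<and> t \<in> overs K \<and> curve K t = z)"

definition under_time :: "diagram \<Rightarrow> complex \<Rightarrow> real" where
  "under_time K z = (THE t. 0 \<le> t \<and> t < 1 \<and> t \<in> unders K \<and> curve K t = z)"

text \<open>
  Right-handed convention: a crossing is positive iff the direction of the over-strand is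
  turned counterclockwise (by an angle less than \<open>\<pi>\<close>) into that of the under-strand.
\<close>

definition crossing_sign :: "diagram \<Rightarrow> complex \<Rightarrow> int" where
  "crossing_sign K z =
     (if wedge (vector_derivative (curve K) (at (over_time K z)))
               (vector_derivative (curve K) (at (under_time K z))) > 0
      then 1 else - 1)"

text \<open>
  A path from a crossing back to itself is a time interval \<open>s < t < s + 1\<close> whose ends are
  mapped to the crossing.  Counting passage times counts crossings with multiplicity.
\<close>

definition Odd :: "diagram \<Rightarrow> complex set" where
  "Odd K = {z \<in> classical_crossings K.
     \<exists>s t. s < t \<and> t < s + 1 \<and> curve K s = z \<and> curve K t = z \<and>
       odd (card ((overs K \<union> unders K) \<inter> {s<..<t}))}"

definition J :: "diagram \<Rightarrow> int" where
  "J K = (\<Sum>z\<in>Odd K. crossing_sign K z)"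


text \<open>
  A diagram does not come with a parametrization or an orientation: \<open>c = - 1\<close> reverses the
  direction of travel.
\<close>

definition reparametrization :: "diagram \<Rightarrow> diagram \<Rightarrow> bool" where
  "reparametrization K K' \<longleftrightarrow>
     (\<exists>(\<phi> :: real \<Rightarrow> real) c. (c = 1 \<or> c = - 1) \<and>
        \<phi> C1_differentiable_on UNIV \<and>
        (\<forall>t. vector_derivative \<phi> (at t) \<noteq> 0) \<and>
        (\<forall>t. \<phi> (t + 1) = \<phi> t + c) \<and>
        curve K' = curve K \<circ> \<phi> \<and>
        overs K' = \<phi> -` overs K \<and>
        unders K' = \<phi> -` unders K)"

definition ambient_isotopy :: "(real \<Rightarrow> complex \<Rightarrow> complex) \<Rightarrow> bool" where
  "ambient_isotopy H \<longleftrightarrow>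
     continuous_on ({0..1} \<times> UNIV) (\<lambda>(t, z). H t z) \<and>
     (\<forall>z. H 0 z = z) \<and>
     (\<forall>t\<in>{0..1}. bij (H t)) \<and>
     (\<exists>D :: real \<Rightarrow> complex \<Rightarrow> complex \<Rightarrow>\<^sub>L complex.
        continuous_on ({0..1} \<times> UNIV) (\<lambda>(t, z). D t z) \<and>
        (\<forall>t\<in>{0..1}. \<forall>z. (H t has_derivative blinfun_apply (D t z)) (at z) \<and>
                          bij (blinfun_apply (D t z))))"

definition planar_isotopy :: "diagram \<Rightarrow> diagram \<Rightarrow> bool" where
  "planar_isotopy K K' \<longleftrightarrow>
     (\<exists>H. ambient_isotopy H \<and>
        curve K' = H 1 \<circ> curve K \<and> overs K' = overs K \<and> unders K' = unders K)"

text \<open>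
  The replaced arc is the part of the curve with times between \<^term>\<open>a\<close> and \<^term>\<open>b\<close>.  No
  classical passage takes place on it before or after, so all crossings on it, with the rest of
  the diagram and with itself, are virtual.
\<close>

definition detour_move :: "diagram \<Rightarrow> diagram \<Rightarrow> bool" where
  "detour_move K K' \<longleftrightarrow>
     (\<exists>a b. a < b \<and> b < a + 1 \<and>
        (\<forall>t\<in>{b..a + 1}. curve K' t = curve K t) \<and>
        overs K' = overs K \<and> unders K' = unders K \<and>
        (overs K \<union> unders K) \<inter> {a..b} = {})"

text \<open>
  The Reidemeister moves replace one standard picture by another inside a closed disc, the
  image of a standard square under an orientation-preserving \<open>C\<^sup>1\<close> embedding.  A picture with
  \<^term>\<open>n\<close> strands is given by maps \<^term>\<open>M i\<close> (\<^prop>\<open>i < n\<close>) from the interval from -1 to 1 to the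
  square.  Strand \<^term>\<open>i\<close> is run through between the times \<^term>\<open>p i\<close> and \<^term>\<open>q i\<close>; the strand
  is traversed backwards if \<^prop>\<open>q i < p i\<close>.  Up to reparametrization and planar isotopy this
  is every occurrence of the picture in a diagram.
\<close>

definition square :: "complex set" where
  "square = {z. \<bar>Re z\<bar> \<le> 1 \<and> \<bar>Im z\<bar> \<le> 1}"

definition chart :: "(complex \<Rightarrow> complex) \<Rightarrow> bool" where
  "chart \<phi> \<longleftrightarrow>
     (\<exists>U (D :: complex \<Rightarrow> complex \<Rightarrow>\<^sub>L complex). open U \<and> square \<subseteq> U \<and> inj_on \<phi> U \<and>
        continuous_on U D \<and>
        (\<forall>z\<in>U. (\<phi> has_derivative blinfun_apply (D z)) (at z) \<and>
                wedge (blinfun_apply (D z) 1) (blinfun_apply (D z) \<i>) > 0))"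

definition strand_times :: "nat \<Rightarrow> (nat \<Rightarrow> real) \<Rightarrow> (nat \<Rightarrow> real) \<Rightarrow> real set" where
  "strand_times n p q = {t. \<exists>i<n. \<exists>k\<in>\<int>. t + k \<in> closed_segment (p i) (q i)}"

definition strands_disjoint :: "nat \<Rightarrow> (nat \<Rightarrow> real) \<Rightarrow> (nat \<Rightarrow> real) \<Rightarrow> bool" where
  "strands_disjoint n p q \<longleftrightarrow>
     (\<forall>i<n. p i \<noteq> q i) \<and>
     (\<forall>i<n. \<forall>j<n. \<forall>s\<in>closed_segment (p i) (q i). \<forall>t\<in>closed_segment (p j) (q j).
        s - t \<in> \<int> \<longrightarrow> i = j \<and> s = t)"

definition contains_picture ::
  "nat \<Rightarrow> (nat \<Rightarrow> real \<Rightarrow> complex) \<Rightarrow> (complex \<Rightarrow> complex) \<Rightarrow> (nat \<Rightarrow> real) \<Rightarrow> (nat \<Rightarrow> real)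
    \<Rightarrow> diagram \<Rightarrow> bool" where
  "contains_picture n M \<phi> p q K \<longleftrightarrow>
     (\<forall>t. curve K t \<in> \<phi> ` square \<longleftrightarrow> t \<in> strand_times n p q) \<and>
     (\<forall>i<n. \<forall>x\<in>{- 1..1}.
        curve K (((1 - x) * p i + (1 + x) * q i) / 2) = \<phi> (M i x))"

definition agree_off :: "real set \<Rightarrow> diagram \<Rightarrow> diagram \<Rightarrow> bool" where
  "agree_off T K K' \<longleftrightarrow>
     (\<forall>t. t \<notin> T \<longrightarrow> curve K' t = curve K t \<and>
        (t \<in> overs K' \<longleftrightarrow> t \<in> overs K) \<and> (t \<in> unders K' \<longleftrightarrow> t \<in> unders K))"

definition local_replacement ::
  "nat \<Rightarrow> (nat \<Rightarrow> real \<Rightarrow> complex) \<Rightarrow> (nat \<Rightarrow> real \<Rightarrow> complex) \<Rightarrow> (nat \<Rightarrow> real) \<Rightarrow> (nat \<Rightarrow> real)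
    \<Rightarrow> diagram \<Rightarrow> diagram \<Rightarrow> bool" where
  "local_replacement n M M' p q K K' \<longleftrightarrow>
     strands_disjoint n p q \<and>
     (\<exists>\<phi>. chart \<phi> \<and> contains_picture n M \<phi> p q K \<and> contains_picture n M' \<phi> p q K') \<and>
     agree_off (strand_times n p q) K K'"

text \<open>
  All crossings between different strands are classical, and the strand of greater height is
  the over-strand.
\<close>

definition layered ::
  "nat \<Rightarrow> (nat \<Rightarrow> nat) \<Rightarrow> (nat \<Rightarrow> real) \<Rightarrow> (nat \<Rightarrow> real) \<Rightarrow> diagram \<Rightarrow> bool" where
  "layered n h p q K \<longleftrightarrow>
     (\<forall>i<n. \<forall>j<n. \<forall>s\<in>closed_segment (p i) (q i). \<forall>t\<in>closed_segment (p j) (q j).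
        h j < h i \<and> curve K s = curve K t \<longrightarrow> s \<in> overs K \<and> t \<in> unders K)"

text \<open>
  The two pictures of each move have the same end points and the same velocities there.
  The curve of \<open>R1_after\<close> has exactly one double point.
\<close>

definition R1_before :: "nat \<Rightarrow> real \<Rightarrow> complex" where
  "R1_before i x = of_real x"

definition R1_after :: "nat \<Rightarrow> real \<Rightarrow> complex" where
  "R1_after i x = Complex (x * (1 - 2 * (1 - x\<^sup>2)\<^sup>2)) ((1 - x\<^sup>2)\<^sup>2 / 2)"

definition reidemeister_1 :: "diagram \<Rightarrow> diagram \<Rightarrow> bool" where
  "reidemeister_1 K K' \<longleftrightarrow>
     (\<exists>p q. local_replacement 1 R1_before R1_after p q K K' \<and>
        (\<forall>s\<in>closed_segment (p 0) (q 0). \<forall>t\<in>closed_segment (p 0) (q 0).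
           crossing_pair (curve K') s t \<longrightarrow> s \<in> overs K' \<union> unders K'))"

text \<open>Strand 0 is pushed across the straight strand 1, creating two crossings.\<close>

definition R2_before :: "nat \<Rightarrow> real \<Rightarrow> complex" where
  "R2_before i x = (if i = 0 then Complex x (1 / 2) else Complex x 0)"

definition R2_after :: "nat \<Rightarrow> real \<Rightarrow> complex" where
  "R2_after i x = (if i = 0 then Complex x (1 / 2 - (1 - x\<^sup>2)\<^sup>2) else Complex x 0)"

definition reidemeister_2 :: "diagram \<Rightarrow> diagram \<Rightarrow> bool" where
  "reidemeister_2 K K' \<longleftrightarrow>
     (\<exists>p q h. local_replacement 2 R2_before R2_after p q K K' \<and>
        inj_on h {..<2} \<and> layered 2 h p q K')"

text \<open>
  Strands 0 and 1 cross at the origin; strand 2 passes above the origin before the move and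
  below it afterwards.  The heights of the three strands are arbitrary.
\<close>

definition R3_picture :: "real \<Rightarrow> nat \<Rightarrow> real \<Rightarrow> complex" where
  "R3_picture c i x =
     (if i = 0 then Complex x (x / 2)
      else if i = 1 then Complex x (- x / 2)
      else Complex x (c * (1 - x\<^sup>2)\<^sup>2))"

definition reidemeister_3 :: "diagram \<Rightarrow> diagram \<Rightarrow> bool" where
  "reidemeister_3 K K' \<longleftrightarrow>
     (\<exists>p q h. local_replacement 3 (R3_picture (1 / 4)) (R3_picture (- 1 / 4)) p q K K' \<and>
        inj_on h {..<3} \<and> layered 3 h p q K \<and> layered 3 h p q K')"

definition elementary_move :: "diagram \<Rightarrow> diagram \<Rightarrow> bool" where
  "elementary_move K K' \<longleftrightarrow>
     virtual_knot_diagram K \<and> virtual_knot_diagram K' \<and>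
     (reparametrization K K' \<or> planar_isotopy K K' \<or>
      reidemeister_1 K K' \<or> reidemeister_2 K K' \<or> reidemeister_3 K K' \<or>
      detour_move K K')"

definition virtually_equivalent :: "diagram \<Rightarrow> diagram \<Rightarrow> bool" where
  "virtually_equivalent = equivclp elementary_move"

end

theory Submission
  imports Defs "HOL-Complex_Analysis.Complex_Analysis"
begin

text \<open>
  Every classical crossing is passed twice in a period, so the parity of the number of classical
  passages before time \<open>t\<close> is, up to a global flip, a 1-periodic function \<open>P\<close>, and a crossing
  with passage times \<open>s\<close>, \<open>t\<close> is odd iff \<open>P s = P t\<close>.  In the three Reidemeister pictures every
  strand carries an even number of passages before and after the move, so \<open>P\<close> does not change
  outside the picture.  Move I creates an even crossing and move II two crossings of equal parity
  and opposite signs; move III interchanges the two passages on each strand, which flips \<open>P\<close> at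
  both passages of each of the three crossings and so preserves their parities and signs.

  For a classical diagram let \<open>\<alpha>\<close> be one of the two loops at a crossing.  Along the other loop the
  winding number of \<open>\<alpha>\<close> jumps by an odd integer at each intersection with \<open>\<alpha>\<close> and takes the same
  value near both ends, hence the loops have an even number of further intersections.  Self-crossings
  of \<open>\<alpha>\<close> contribute two passages each, so the crossing is even.
\<close>

section \<open>Parities of passages\<close>

text \<open>Only equations \<open>P s = P t\<close> are ever used, so the global flip is harmless
  and an arbitrary parity function may be chosen for each diagram. The classical case cannot rest on
  the Jordan curve theorem, because the loop \<alpha> may cross itself; the winding number modulo 2
  takes its place. Its jump at an intersection is obtained from first derivatives alone, without a
  normal form for two transverse C1 arcs. The crossing itself needs a separate argument: there
  \<alpha> has a corner, and the other loop starts and ends on \<alpha>. Let v, w be the velocities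
  of \<alpha> at its start and end. Seen from the crossing, \<alpha> occupies the directions v and
  -w, the other loop the directions w and -v. In the cyclic order v, w, -v, -w (or its reverse) w
  and -v are neighbours, so both ends of the other loop lie in the same sector cut out by \<alpha>.
  This is why the winding numbers near the two ends coincide.\<close>

lemma Int_periodic:
  fixes P :: "real \<Rightarrow> 'a"
  assumes per: "\<And>t. P (t + 1) = P t" and "k \<in> \<int>"
  shows "P (t + k) = P t"
proof -
  have nat: "P (t + real n) = P t" for n t
  proof (induction n)
    case (Suc n)
    then show ?case using per[of "t + real n"] by (simp add: algebra_simps)
  qed simp
  obtain m where "k = of_int m" using \<open>k \<in> \<int>\<close> by (auto elim: Ints_cases)
  then show ?thesis
    using nat[of t "nat m"] nat[of "t + k" "nat (- m)"] by (cases "m \<ge> 0") auto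
qed

text \<open>The interval contains its left end but not its right one, so counts over adjacent
  intervals add up and the value at a passage is the one just before it. Prescribing only relations
  between values leaves \<open>P\<close> free up to negation.\<close>

definition parity_function :: "real set \<Rightarrow> (real \<Rightarrow> bool) \<Rightarrow> bool" where
  "parity_function C P \<longleftrightarrow>
     (\<forall>t. P (t + 1) = P t) \<and> (\<forall>s t. s \<le> t \<longrightarrow> (P s = P t) = even (card (C \<inter> {s..<t})))"

text \<open>Evenness over every full period lets the count from a base time descend to the
  circle.\<close>

lemma parity_function_exists:
  assumes fin: "\<And>a b. finite (C \<inter> {a..<b})" and ev: "\<And>t. even (card (C \<inter> {t..<t + 1}))"
  shows "\<exists>P. parity_function C P"
proof -
  \<comment> \<open>The base time is 0; \<open>min\<close> and \<open>max\<close> cover the times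
    before it.\<close>
  define P where "P t = even (card (C \<inter> {min 0 t..<max 0 t}))" for t
  have add: "card (C \<inter> {a..<c}) = card (C \<inter> {a..<b}) + card (C \<inter> {b..<c})"
    if "a \<le> b" "b \<le> c" for a b c
  proof -
    have "C \<inter> {a..<c} = (C \<inter> {a..<b}) \<union> (C \<inter> {b..<c})" using that by auto
    then show ?thesis using fin by (simp add: card_Un_disjoint disjoint_iff)
  qed
  have rel: "(P s = P t) = even (card (C \<inter> {s..<t}))" if "s \<le> t" for s t
  proof -
    consider "0 \<le> s" | "s \<le> 0" "0 \<le> t" | "t \<le> 0" using that by linarith
    then show ?thesis
    proof cases
      case 1
      then show ?thesis using add[of 0 s t] that by (auto simp: P_def min_def max_def)
    next
      case 2
      then show ?thesis using add[of s 0 t] by (auto simp: P_def min_def max_def)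
    next
      case 3
      then have "P s = even (card (C \<inter> {s..<0}))" "P t = even (card (C \<inter> {t..<0}))"
        using that by (simp_all add: P_def)
      then show ?thesis using add[of s t 0] that 3 by auto
    qed
  qed
  have "P (t + 1) = P t" for t
  proof -
    have "t \<le> t + 1" by simp
    from rel[OF this] ev[of t] show ?thesis by metis
  qed
  then show ?thesis using rel unfolding parity_function_def by blast
qed

lemma parity_function_shift:
  "parity_function C P \<Longrightarrow> k \<in> \<int> \<Longrightarrow> P (t + k) = P t"
  by (rule Int_periodic) (auto simp: parity_function_def)

lemma parity_function_congruent:
  "parity_function C P \<Longrightarrow> s - t \<in> \<int> \<Longrightarrow> P s = P t"
  using parity_function_shift[of C P "s - t" t] by simp

lemma parity_function_eq_iff:
  "parity_function C P \<Longrightarrow> s \<le> t \<Longrightarrow> (P s = P t) = even (card (C \<inter> {s..<t}))"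
  by (auto simp: parity_function_def)

section \<open>Oriented area and its change under linear maps\<close>

lemma wedge_scaleR: "wedge (a *\<^sub>R u) (b *\<^sub>R v) = a * b * wedge u v"
  by (simp add: wedge_def algebra_simps)

text \<open>\<open>wedge\<close> is the oriented area form, so the factor
  \<open>wedge (D 1) (D \<i>)\<close> is the determinant of \<open>D\<close>.\<close>

lemma wedge_linear:
  assumes "linear D"
  shows "wedge (D u) (D v) = wedge (D 1) (D \<i>) * wedge u v"
proof -
  have *: "D z = Re z *\<^sub>R D 1 + Im z *\<^sub>R D \<i>" for z
  proof -
    have "z = Re z *\<^sub>R 1 + Im z *\<^sub>R \<i>" by (simp add: complex_eq_iff)
    then show ?thesis using assms by (metis linear_add linear_scale)
  qed
  show ?thesis
    unfolding *[of u] *[of v] by (simp add: wedge_def algebra_simps)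
qed

section \<open>Passage times, signs and parities in a single diagram\<close>

locale knot_diagram =
  fixes K :: diagram
  assumes diagram: "virtual_knot_diagram K"
begin

abbreviation "\<gamma> \<equiv> curve K"
abbreviation "passages \<equiv> overs K \<union> unders K"
abbreviation "velocity t \<equiv> vector_derivative (curve K) (at t)"

lemma curve_shift: "k \<in> \<int> \<Longrightarrow> \<gamma> (t + k) = \<gamma> t"
  by (rule Int_periodic)
    (use diagram in \<open>auto simp: virtual_knot_diagram_def generic_immersion_def immersed_circle_def\<close>)

lemma overs_shift: "k \<in> \<int> \<Longrightarrow> t + k \<in> overs K \<longleftrightarrow> t \<in> overs K"
  using Int_periodic[of "\<lambda>t. t \<in> overs K" k t] diagram by (auto simp: virtual_knot_diagram_def)

lemma unders_shift: "k \<in> \<int> \<Longrightarrow> t + k \<in> unders K \<longleftrightarrow> t \<in> unders K"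
  using Int_periodic[of "\<lambda>t. t \<in> unders K" k t] diagram by (auto simp: virtual_knot_diagram_def)

lemma curve_congruent: "s - t \<in> \<int> \<Longrightarrow> \<gamma> s = \<gamma> t"
  using curve_shift[of "s - t" t] by simp

lemma overs_congruent: "s - t \<in> \<int> \<Longrightarrow> s \<in> overs K \<longleftrightarrow> t \<in> overs K"
  using overs_shift[of "s - t" t] by simp

lemma unders_congruent: "s - t \<in> \<int> \<Longrightarrow> s \<in> unders K \<longleftrightarrow> t \<in> unders K"
  using unders_shift[of "s - t" t] by simp

lemma overs_unders_disjoint: "t \<in> overs K \<Longrightarrow> t \<in> unders K \<Longrightarrow> False"
  using diagram by (auto simp: virtual_knot_diagram_def)

lemma curve_C1: "\<gamma> C1_differentiable_on UNIV"
  using diagram by (auto simp: virtual_knot_diagram_def generic_immersion_def immersed_circle_def)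

lemma has_velocity: "(\<gamma> has_vector_derivative velocity t) (at t)"
  using curve_C1 by (auto simp: C1_differentiable_on_eq vector_derivative_works)

lemma continuous_curve: "continuous_on A \<gamma>"
  using C1_differentiable_imp_continuous_on[OF curve_C1] continuous_on_subset by blast

lemma velocity_shift:
  assumes "k \<in> \<int>"
  shows "velocity (t + k) = velocity t"
proof -
  have "((\<lambda>x. x + k) has_vector_derivative 1) (at t)"
    by (auto intro!: derivative_eq_intros)
  from vector_diff_chain_at[OF this has_velocity]
  have "(\<gamma> \<circ> (\<lambda>x. x + k) has_vector_derivative 1 *\<^sub>R velocity (t + k)) (at t)" .
  moreover have "\<gamma> \<circ> (\<lambda>x. x + k) = \<gamma>" using curve_shift[OF assms] by auto
  ultimately show ?thesis using vector_derivative_at by fastforce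
qed

lemma velocity_congruent: "s - t \<in> \<int> \<Longrightarrow> velocity s = velocity t"
  using velocity_shift[of "s - t" t] by simp

lemma finite_double_points: "finite {\<gamma> s |s. \<exists>t. crossing_pair \<gamma> s t}"
  using diagram by (simp add: virtual_knot_diagram_def generic_immersion_def)

lemma crossing_pair_unique:
  "crossing_pair \<gamma> r s \<Longrightarrow> crossing_pair \<gamma> s t \<Longrightarrow> r - t \<in> \<int>"
  using diagram unfolding virtual_knot_diagram_def generic_immersion_def by blast

lemma crossing_pair_sym: "crossing_pair f s t \<longleftrightarrow> crossing_pair f t s"
  by (auto simp: crossing_pair_def Ints_minus minus_in_Ints_iff)
     (metis minus_diff_eq minus_in_Ints_iff)+

lemma crossing_transverse: "crossing_pair \<gamma> s t \<Longrightarrow> wedge (velocity s) (velocity t) \<noteq> 0"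
  using diagram unfolding virtual_knot_diagram_def generic_immersion_def by blast

lemma over_partner: "s \<in> overs K \<Longrightarrow> \<exists>t\<in>unders K. crossing_pair \<gamma> s t"
  using diagram by (auto simp: virtual_knot_diagram_def)

lemma under_partner: "t \<in> unders K \<Longrightarrow> \<exists>s\<in>overs K. crossing_pair \<gamma> s t"
  using diagram by (auto simp: virtual_knot_diagram_def)

lemma over_under_crossing:
  "s \<in> overs K \<Longrightarrow> t \<in> unders K \<Longrightarrow> \<gamma> s = \<gamma> t \<Longrightarrow> crossing_pair \<gamma> s t"
  using overs_congruent overs_unders_disjoint by (auto simp: crossing_pair_def)

text \<open>Triple points are excluded: if \<open>r\<close> is not congruent to \<open>s\<close>,
  then \<open>r\<close>, \<open>s\<close> and \<open>s\<close>, \<open>t\<close> are two crossing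
  pairs sharing \<open>s\<close>.\<close>

lemma over_or_under:
  assumes "s \<in> overs K" "t \<in> unders K" "\<gamma> s = \<gamma> t" "\<gamma> r = \<gamma> s"
  shows "r - s \<in> \<int> \<or> r - t \<in> \<int>"
  using crossing_pair_unique[of r s t] over_under_crossing[OF assms(1-3)] assms(4)
  by (auto simp: crossing_pair_def)

lemma over_unique:
  assumes "s \<in> overs K" "r \<in> overs K" "\<gamma> r = \<gamma> s"
  shows "r - s \<in> \<int>"
proof -
  obtain t where "t \<in> unders K" "crossing_pair \<gamma> s t" using over_partner assms by blast
  then show ?thesis
    using over_or_under[of s t r] assms unders_congruent[of r t] overs_unders_disjoint
    by (auto simp: crossing_pair_def)
qed

lemma under_unique:
  assumes "s \<in> unders K" "r \<in> unders K" "\<gamma> r = \<gamma> s"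
  shows "r - s \<in> \<int>"
proof -
  obtain t where "t \<in> overs K" "crossing_pair \<gamma> t s" using under_partner assms by blast
  then show ?thesis
    using over_or_under[of t s r] assms overs_congruent[of r t] overs_unders_disjoint
    by (auto simp: crossing_pair_def)
qed

text \<open>Evaluates the definite description: \<open>frac s\<close> represents the class of
  \<open>s\<close>, and no other class over-passes the same point.\<close>

lemma over_time_eq:
  assumes "s \<in> overs K"
  shows "over_time K (\<gamma> s) = frac s"
  unfolding over_time_def
proof (rule the_equality)
  have "frac s - s \<in> \<int>" by (simp add: frac_def)
  then show "0 \<le> frac s \<and> frac s < 1 \<and> frac s \<in> overs K \<and> \<gamma> (frac s) = \<gamma> s"
    using assms by (simp add: overs_congruent curve_congruent frac_lt_1)
next
  fix t assume "0 \<le> t \<and> t < 1 \<and> t \<in> overs K \<and> \<gamma> t = \<gamma> s"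
  then show "t = frac s" using over_unique[of t s] assms frac_unique_iff[of s t] by metis
qed

lemma under_time_eq:
  assumes "s \<in> unders K"
  shows "under_time K (\<gamma> s) = frac s"
  unfolding under_time_def
proof (rule the_equality)
  have "frac s - s \<in> \<int>" by (simp add: frac_def)
  then show "0 \<le> frac s \<and> frac s < 1 \<and> frac s \<in> unders K \<and> \<gamma> (frac s) = \<gamma> s"
    using assms by (simp add: unders_congruent curve_congruent frac_lt_1)
next
  fix t assume "0 \<le> t \<and> t < 1 \<and> t \<in> unders K \<and> \<gamma> t = \<gamma> s"
  then show "t = frac s" using under_unique[of t s] assms frac_unique_iff[of s t] by metis
qed

text \<open>Frees the sign from the representatives between 0 and 1: velocities are periodic, so any
  over time and any under time of the crossing may be used.\<close>

lemma crossing_sign_eq: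
  assumes "s \<in> overs K" "t \<in> unders K" "\<gamma> s = \<gamma> t"
  shows "crossing_sign K (\<gamma> s) = (if wedge (velocity s) (velocity t) > 0 then 1 else - 1)"
proof -
  have "velocity (frac s) = velocity s" "velocity (frac t) = velocity t"
    by (auto intro!: velocity_congruent simp: frac_def)
  moreover have "under_time K (\<gamma> s) = frac t" using under_time_eq assms by simp
  ultimately show ?thesis using over_time_eq[OF assms(1)] by (simp add: crossing_sign_def)
qed

lemma classical_crossingE:
  assumes "z \<in> classical_crossings K"
  obtains s t where "s \<in> overs K" "t \<in> unders K" "\<gamma> s = z" "\<gamma> t = z"
  using assms over_partner by (force simp: classical_crossings_def crossing_pair_def)

lemma finite_classical_crossings: "finite (classical_crossings K)"
  by (rule finite_subset[OF _ finite_double_points])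
     (use over_partner in \<open>fastforce simp: classical_crossings_def\<close>)

text \<open>Two over-passages of one point are congruent, and a half-open interval of length 1
  contains exactly one member of each class. With the counterpart for \<open>unders\<close> this
  yields the two passages per period.\<close>

lemma bij_overs_crossings: "bij_betw \<gamma> (overs K \<inter> {t..<t + 1}) (classical_crossings K)"
  unfolding bij_betw_def
proof
  show "inj_on \<gamma> (overs K \<inter> {t..<t + 1})"
  proof (rule inj_onI)
    fix x y assume *: "x \<in> overs K \<inter> {t..<t + 1}" "y \<in> overs K \<inter> {t..<t + 1}" "\<gamma> x = \<gamma> y"
    then have "x - y \<in> \<int>" using over_unique[of y x] by blast
    moreover have "\<bar>x - y\<bar> < 1" using * by auto
    ultimately show "x = y" using Ints_nonzero_abs_less1[of "x - y"] by simp
  qed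
  show "\<gamma> ` (overs K \<inter> {t..<t + 1}) = classical_crossings K"
  proof
    show "classical_crossings K \<subseteq> \<gamma> ` (overs K \<inter> {t..<t + 1})"
    proof
      fix z assume "z \<in> classical_crossings K"
      then obtain s where s: "s \<in> overs K" "\<gamma> s = z" by (auto simp: classical_crossings_def)
      define r where "r = t + frac (s - t)"
      have "r - s \<in> \<int>" by (simp add: r_def frac_def)
      then have "r \<in> overs K" "\<gamma> r = z"
        using s overs_congruent[of r s] curve_congruent[of r s] by simp_all
      then show "z \<in> \<gamma> ` (overs K \<inter> {t..<t + 1})" by (auto simp: r_def frac_lt_1)
    qed
  qed (auto simp: classical_crossings_def)
qed

lemma bij_unders_crossings: "bij_betw \<gamma> (unders K \<inter> {t..<t + 1}) (classical_crossings K)"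
  unfolding bij_betw_def
proof
  show "inj_on \<gamma> (unders K \<inter> {t..<t + 1})"
  proof (rule inj_onI)
    fix x y assume *: "x \<in> unders K \<inter> {t..<t + 1}" "y \<in> unders K \<inter> {t..<t + 1}" "\<gamma> x = \<gamma> y"
    then have "x - y \<in> \<int>" using under_unique[of y x] by blast
    moreover have "\<bar>x - y\<bar> < 1" using * by auto
    ultimately show "x = y" using Ints_nonzero_abs_less1[of "x - y"] by simp
  qed
  show "\<gamma> ` (unders K \<inter> {t..<t + 1}) = classical_crossings K"
  proof
    show "classical_crossings K \<subseteq> \<gamma> ` (unders K \<inter> {t..<t + 1})"
    proof
      fix z assume "z \<in> classical_crossings K"
      then obtain s where s: "s \<in> unders K" "\<gamma> s = z" by (metis classical_crossingE)
      define r where "r = t + frac (s - t)"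
      have "r - s \<in> \<int>" by (simp add: r_def frac_def)
      then have "r \<in> unders K" "\<gamma> r = z"
        using s unders_congruent[of r s] curve_congruent[of r s] by simp_all
      then show "z \<in> \<gamma> ` (unders K \<inter> {t..<t + 1})" by (auto simp: r_def frac_lt_1)
    qed
    show "\<gamma> ` (unders K \<inter> {t..<t + 1}) \<subseteq> classical_crossings K"
    proof
      fix z assume "z \<in> \<gamma> ` (unders K \<inter> {t..<t + 1})"
      then obtain r where r: "r \<in> unders K" "z = \<gamma> r" by blast
      then obtain s where "s \<in> overs K" "crossing_pair \<gamma> s r" using under_partner by blast
      then show "z \<in> classical_crossings K"
        using r by (auto simp: classical_crossings_def crossing_pair_def intro: rev_image_eqI)
    qed
  qed
qed

text \<open>Genericity gives finiteness of double points, not of times; the bijections carry it over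
  to unit intervals, and finitely many of these cover the given one.\<close>

lemma finite_passages: "finite (passages \<inter> {a..<b})"
proof -
  have one: "finite (passages \<inter> {t..<t + 1})" for t
    using bij_betw_finite[OF bij_overs_crossings[of t]] bij_betw_finite[OF bij_unders_crossings[of t]]
      finite_classical_crossings by (simp add: Int_Un_distrib2)
  have "finite (passages \<inter> {a..<a + real n})" for n
  proof (induction n)
    case (Suc n)
    have "passages \<inter> {a..<a + real (Suc n)}
        \<subseteq> (passages \<inter> {a..<a + real n}) \<union> (passages \<inter> {a + real n..<a + real n + 1})" by auto
    then show ?case using Suc one finite_subset by blast
  qed simp
  moreover obtain n :: nat where "b - a \<le> real n" using real_arch_simple by blast
  ultimately show ?thesis
    by (rule_tac finite_subset[of _ "passages \<inter> {a..<a + real n}"]) auto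
qed

lemma even_passages_period: "even (card (passages \<inter> {t..<t + 1}))"
proof -
  have fin: "finite (overs K \<inter> {t..<t + 1})" "finite (unders K \<inter> {t..<t + 1})"
    using finite_passages[of t "t + 1"] by (auto elim: finite_subset[rotated])
  have "card (passages \<inter> {t..<t + 1}) = card (overs K \<inter> {t..<t + 1}) + card (unders K \<inter> {t..<t + 1})"
    using overs_unders_disjoint fin by (subst card_Un_disjoint[symmetric]) (auto simp: Int_Un_distrib2)
  also have "\<dots> = 2 * card (classical_crossings K)"
    using bij_betw_same_card[OF bij_overs_crossings[of t]]
      bij_betw_same_card[OF bij_unders_crossings[of t]] by simp
  finally show ?thesis by simp
qed

lemma parity_exists: "\<exists>P. parity_function passages P"
  using parity_function_exists finite_passages even_passages_period by blast

text \<open>\<open>Odd\<close> counts strictly between the ends, whereas the parity function also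
  counts the passage at \<open>s\<close>; this shift by one turns "odd" into "equal".\<close>

lemma odd_open_interval:
  assumes "parity_function passages P" "s < t" "s \<in> passages"
  shows "odd (card (passages \<inter> {s<..<t})) \<longleftrightarrow> P s = P t"
proof -
  have "passages \<inter> {s..<t} = insert s (passages \<inter> {s<..<t})" using assms by auto
  moreover have "finite (passages \<inter> {s<..<t})"
    by (rule finite_subset[OF _ finite_passages[of s t]]) auto
  ultimately have "card (passages \<inter> {s..<t}) = Suc (card (passages \<inter> {s<..<t}))" by simp
  then show ?thesis using assms parity_function_eq_iff[OF assms(1), of s t] by simp
qed

text \<open>\<open>Odd\<close> asks for one of the two paths at the crossing, but the ends of either
  path are congruent to \<open>s\<close> and \<open>t\<close> in some order, so both paths give the
  same answer.\<close>

lemma Odd_iff_parity: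
  assumes P: "parity_function passages P" and st: "s \<in> overs K" "t \<in> unders K" "\<gamma> s = \<gamma> t"
  shows "\<gamma> s \<in> Odd K \<longleftrightarrow> P s = P t"
proof -
  have nst: "s - t \<notin> \<int>" using over_under_crossing[OF st] by (simp add: crossing_pair_def)
  have nts: "t - s \<notin> \<int>" using nst by (metis minus_diff_eq minus_in_Ints_iff)
  have *: "odd (card (passages \<inter> {a<..<b})) \<longleftrightarrow> P s = P t"
    if ab: "a < b" "b < a + 1" "\<gamma> a = \<gamma> s" "\<gamma> b = \<gamma> s" for a b
  proof -
    have nab: "a - b \<notin> \<int>" using Ints_nonzero_abs_less1[of "a - b"] ab by auto
    have cong: "x - y \<in> \<int>" if "x - z \<in> \<int>" "y - z \<in> \<int>" for x y z :: real
      using Ints_diff[OF that] by simp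
    have "(a - s \<in> \<int> \<and> b - t \<in> \<int>) \<or> (a - t \<in> \<int> \<and> b - s \<in> \<int>)"
      using over_or_under[OF st, of a] over_or_under[OF st, of b] ab cong nab by blast
    moreover from this have "a \<in> passages"
      using st overs_congruent[of a s] unders_congruent[of a t] by blast
    ultimately show ?thesis
      using odd_open_interval[OF P ab(1)] parity_function_congruent[OF P] by metis
  qed
  \<comment> \<open>The first time after \<open>s\<close> congruent to \<open>t\<close>; it supplies
    the path needed to prove membership in \<open>Odd\<close>.\<close>
  define b where "b = s + frac (t - s)"
  have "b - t \<in> \<int>" by (simp add: b_def frac_def)
  then have b: "s < b" "b < s + 1" "\<gamma> b = \<gamma> s"
    using nts curve_congruent[of b t] st frac_gt_0_iff[of "t - s"] by (auto simp: b_def frac_lt_1)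
  show ?thesis
    using * *[OF b(1,2) _ b(3)] b st unfolding Odd_def classical_crossings_def by blast
qed

text \<open>Here \<open>s\<close> and \<open>t\<close> may be several periods apart, since whole
  periods contribute even numbers. In this form oddness is visibly kept by changes that preserve or
  reverse the order of the passages.\<close>

lemma Odd_iff_open:
  assumes st: "s \<in> overs K" "t \<in> unders K" "\<gamma> s = \<gamma> t"
  shows "\<gamma> s \<in> Odd K \<longleftrightarrow> odd (card (passages \<inter> {min s t<..<max s t}))"
proof -
  obtain P where P: "parity_function passages P" using parity_exists by blast
  have "s \<noteq> t" using over_under_crossing[OF st] by (auto simp: crossing_pair_def)
  then show ?thesis
    using odd_open_interval[OF P, of s t] odd_open_interval[OF P, of t s] Odd_iff_parity[OF P st] st
    by (auto simp: min_def max_def)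
qed

end

text \<open>Extending the sign by 0 to even crossings turns \<open>J\<close> into a sum over all
  classical crossings, which can be split into a part inside a disc and the rest.\<close>

definition weight :: "diagram \<Rightarrow> complex \<Rightarrow> int" where
  "weight K z = (if z \<in> Odd K then crossing_sign K z else 0)"

lemma (in knot_diagram) J_eq_sum_weight: "J K = (\<Sum>z\<in>classical_crossings K. weight K z)"
proof -
  have "Odd K = {z \<in> classical_crossings K. z \<in> Odd K}" by (auto simp: Odd_def)
  then show ?thesis
    unfolding J_def weight_def using finite_classical_crossings
    by (simp add: sum.inter_filter[symmetric])
qed

lemma weight_eqI:
  assumes "virtual_knot_diagram K" "virtual_knot_diagram K'"
    and "s \<in> overs K" "t \<in> unders K" "curve K s = curve K t"
    and "s' \<in> overs K'" "t' \<in> unders K'" "curve K' s' = curve K' t'"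
    and "curve K s \<in> Odd K \<longleftrightarrow> curve K' s' \<in> Odd K'"
    and "wedge (vector_derivative (curve K) (at s)) (vector_derivative (curve K) (at t)) > 0
       \<longleftrightarrow> wedge (vector_derivative (curve K') (at s')) (vector_derivative (curve K') (at t')) > 0"
  shows "weight K (curve K s) = weight K' (curve K' s')"
  using assms knot_diagram.crossing_sign_eq[OF knot_diagram.intro, of K s t]
    knot_diagram.crossing_sign_eq[OF knot_diagram.intro, of K' s' t'] by (simp add: weight_def)

section \<open>Reparametrization, planar isotopy and detours\<close>

text \<open>Meant for changes that neither create nor destroy classical crossings; \<open>g\<close>
  is the resulting correspondence of crossings.\<close>

lemma J_eqI:
  assumes K: "virtual_knot_diagram K" and K': "virtual_knot_diagram K'"
    and inj: "inj_on g (classical_crossings K)"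
    and img: "g ` classical_crossings K = classical_crossings K'"
    and w: "\<And>s t. s \<in> overs K \<Longrightarrow> t \<in> unders K \<Longrightarrow> curve K s = curve K t \<Longrightarrow>
              weight K (curve K s) = weight K' (g (curve K s))"
  shows "J K = J K'"
proof -
  interpret A: knot_diagram K by unfold_locales (rule K)
  interpret B: knot_diagram K' by unfold_locales (rule K')
  have "J K' = (\<Sum>z\<in>classical_crossings K. weight K' (g z))"
    unfolding B.J_eq_sum_weight img[symmetric] by (simp add: sum.reindex[OF inj])
  also have "\<dots> = J K"
    unfolding A.J_eq_sum_weight
    by (rule sum.cong[OF refl]) (metis A.classical_crossingE w)
  finally show ?thesis by simp
qed

lemma J_detour_move:
  assumes K: "virtual_knot_diagram K" and K': "virtual_knot_diagram K'" and "detour_move K K'"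
  shows "J K = J K'"
proof -
  interpret A: knot_diagram K by unfold_locales (rule K)
  interpret B: knot_diagram K' by unfold_locales (rule K')
  obtain a b where ab: "a < b" "b < a + 1" "\<forall>t\<in>{b..a + 1}. curve K' t = curve K t"
    and ou: "overs K' = overs K" "unders K' = unders K" "A.passages \<inter> {a..b} = {}"
    using assms(3) unfolding detour_move_def by (elim exE conjE) (rule that)
  have agree: "curve K' t = curve K t \<and> B.velocity t = A.velocity t" if t: "t \<in> A.passages" for t
  proof -
    \<comment> \<open>The representative of \<open>t\<close> between \<open>a\<close> and
      \<open>a + 1\<close>. Passages avoid the closed interval from \<open>a\<close> to
      \<open>b\<close>, so \<open>r\<close> is interior to the unchanged arc and the velocities can
      be compared as well.\<close>
    define r where "r = a + frac (t - a)"
    have rt: "r - t \<in> \<int>" by (simp add: r_def frac_def)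
    then have "r \<in> A.passages" using t A.overs_congruent[of r t] A.unders_congruent[of r t] by blast
    then have "r \<notin> {a..b}" using ou(3) by blast
    moreover have "a \<le> r" "r < a + 1" by (simp_all add: r_def frac_lt_1)
    ultimately have r: "r \<in> {b<..<a + 1}" by simp
    have "(curve K' has_vector_derivative A.velocity r) (at r)"
      by (rule has_vector_derivative_transform_within_open[OF A.has_velocity _ r])
         (use ab in auto)
    then have "B.velocity r = A.velocity r" by (rule vector_derivative_at)
    moreover have "curve K' r = curve K r" using ab r by auto
    ultimately show ?thesis
      using A.curve_congruent[OF rt] B.curve_congruent[OF rt]
        A.velocity_congruent[OF rt] B.velocity_congruent[OF rt] by simp
  qed
  show ?thesis
  proof (rule J_eqI[OF K K', of id])
    have "curve K' ` overs K = curve K ` overs K" using agree by (intro image_cong) auto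
    then show "id ` classical_crossings K = classical_crossings K'"
      by (simp add: classical_crossings_def ou)
  next
    fix s t assume st: "s \<in> overs K" "t \<in> unders K" "curve K s = curve K t"
    have st': "s \<in> overs K'" "t \<in> unders K'" "curve K' s = curve K' t" using st agree ou by auto
    have "curve K s \<in> Odd K \<longleftrightarrow> curve K' s \<in> Odd K'"
      using A.Odd_iff_open[OF st] B.Odd_iff_open[OF st'] ou by simp
    then have "weight K (curve K s) = weight K' (curve K' s)"
      using weight_eqI[OF K K' st st'] agree st by auto
    then show "weight K (curve K s) = weight K' (id (curve K s))" using agree st by auto
  qed simp
qed

text \<open>A continuous derivative without zeros has constant sign by the intermediate value
  theorem.\<close>

lemma C1_deriv_nonzero_cases:
  fixes \<phi> :: "real \<Rightarrow> real"
  assumes C1: "\<phi> C1_differentiable_on UNIV" and nz: "\<And>t. vector_derivative \<phi> (at t) \<noteq> 0"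
  shows "(\<forall>t. vector_derivative \<phi> (at t) > 0) \<and> strict_mono \<phi> \<or>
         (\<forall>t. vector_derivative \<phi> (at t) < 0) \<and> strict_mono (\<lambda>t. - \<phi> t)"
proof -
  define d where "d t = vector_derivative \<phi> (at t)" for t
  have der: "(\<phi> has_real_derivative d t) (at t)" for t
    using C1 unfolding d_def
    by (auto simp: C1_differentiable_on_eq has_real_derivative_iff_has_vector_derivative
        vector_derivative_works[symmetric])
  have "continuous_on UNIV d"
    using C1 unfolding d_def by (auto simp: C1_differentiable_on_eq)
  then have conn: "connected (range d)" using connected_continuous_image connected_UNIV by blast
  have nz': "0 \<notin> range d" using nz by (auto simp: d_def)
  have "(\<forall>t. d t > 0) \<or> (\<forall>t. d t < 0)"
  proof (rule ccontr)
    assume "\<not> ?thesis"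
    then obtain s t where "d s \<le> 0" "d t \<ge> 0" by (meson not_le)
    then have "0 \<in> range d" using connectedD_interval[OF conn, of "d s" "d t" 0] by blast
    then show False using nz' by blast
  qed
  then show ?thesis
  proof
    assume p: "\<forall>t. d t > 0"
    have "\<phi> x < \<phi> y" if "x < y" for x y
      using DERIV_pos_imp_increasing[OF that] der p by blast
    then show ?thesis using p by (auto simp: d_def strict_mono_def)
  next
    assume p: "\<forall>t. d t < 0"
    have "\<phi> y < \<phi> x" if "x < y" for x y
      using DERIV_neg_imp_decreasing[OF that] der p by blast
    then show ?thesis using p by (auto simp: d_def strict_mono_def)
  qed
qed

lemma zero_less_mult_pos_iff:
  fixes a b :: real
  assumes "a > 0"
  shows "a * b > 0 \<longleftrightarrow> b > 0"
  using assms by (simp add: zero_less_mult_iff order_less_imp_not_less)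

lemma J_reparametrization:
  assumes K: "virtual_knot_diagram K" and K': "virtual_knot_diagram K'" and "reparametrization K K'"
  shows "J K = J K'"
proof -
  interpret A: knot_diagram K by unfold_locales (rule K)
  interpret B: knot_diagram K' by unfold_locales (rule K')
  obtain \<phi> :: "real \<Rightarrow> real" and c :: real where c: "c = 1 \<or> c = - 1"
    and C1: "\<phi> C1_differentiable_on UNIV" and nz: "\<And>t. vector_derivative \<phi> (at t) \<noteq> 0"
    and shift: "\<And>t. \<phi> (t + 1) = \<phi> t + c"
    and K'_eq: "curve K' = curve K \<circ> \<phi>" "overs K' = \<phi> -` overs K" "unders K' = \<phi> -` unders K"
    using assms(3) unfolding reparametrization_def by blast
  note cases = C1_deriv_nonzero_cases[OF C1 nz]
  have cont: "continuous_on S \<phi>" for S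
    using C1_differentiable_imp_continuous_on[OF C1] continuous_on_subset by blast
  have shift_nat: "\<phi> (t + real n) = \<phi> t + real n * c" for t n
  proof (induction n)
    case (Suc n)
    then show ?case using shift[of "t + real n"] by (simp add: algebra_simps)
  qed simp
  \<comment> \<open>Each unit step moves \<phi> by \<open>c\<close>, which is 1 or -1, so the values
    are unbounded on both sides and continuity gives surjectivity.\<close>
  have "\<exists>x. \<phi> x = y" for y
  proof -
    obtain n :: nat where n: "\<bar>y - \<phi> 0\<bar> \<le> real n" using real_arch_simple by blast
    have "\<phi> (real n) = \<phi> 0 + real n * c" "\<phi> 0 = \<phi> (- real n) + real n * c"
      using shift_nat[of 0 n] shift_nat[of "- real n" n] by auto
    moreover have "\<phi> 0 - real n \<le> y" "y \<le> \<phi> 0 + real n" using n by linarith+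
    ultimately have "\<phi> (- real n) \<le> y \<and> y \<le> \<phi> (real n) \<or> \<phi> (real n) \<le> y \<and> y \<le> \<phi> (- real n)"
      using c by (elim disjE) simp_all
    moreover have "connected (\<phi> ` UNIV)" using connected_continuous_image cont connected_UNIV by blast
    ultimately have "y \<in> range \<phi>" using connectedD_interval rangeI by metis
    then show ?thesis by blast
  qed
  then have surj: "surj \<phi>" by (metis surjI)
  have vel: "B.velocity t = vector_derivative \<phi> (at t) *\<^sub>R A.velocity (\<phi> t)" for t
    unfolding K'_eq
    by (rule vector_derivative_at, rule vector_diff_chain_at[OF _ A.has_velocity])
       (use C1 in \<open>auto simp: C1_differentiable_on_eq vector_derivative_works[symmetric]\<close>)
  \<comment> \<open>Both factors have the same sign: reversing the direction of travel negates both
    velocities and so keeps the crossing sign.\<close>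
  have pos: "vector_derivative \<phi> (at s) * vector_derivative \<phi> (at t) > 0" for s t
    using cases by (auto intro: mult_pos_pos mult_neg_neg)
  have bij: "bij_betw \<phi> (B.passages \<inter> {min s t<..<max s t})
      (A.passages \<inter> {min (\<phi> s) (\<phi> t)<..<max (\<phi> s) (\<phi> t)})" for s t
  proof -
    have between: "\<phi> x \<in> {min (\<phi> s) (\<phi> t)<..<max (\<phi> s) (\<phi> t)} \<longleftrightarrow> x \<in> {min s t<..<max s t}" for x
    proof -
      from cases show ?thesis
      proof
        assume "(\<forall>t. vector_derivative \<phi> (at t) > 0) \<and> strict_mono \<phi>"
        then have "\<And>x y. \<phi> x < \<phi> y \<longleftrightarrow> x < y" by (simp add: strict_mono_less)
        then show ?thesis by (auto simp: min_less_iff_disj less_max_iff_disj)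
      next
        assume "(\<forall>t. vector_derivative \<phi> (at t) < 0) \<and> strict_mono (\<lambda>t. - \<phi> t)"
        then have "\<And>x y. \<phi> x < \<phi> y \<longleftrightarrow> y < x" using strict_mono_less[of "\<lambda>t. - \<phi> t"] by auto
        then show ?thesis by (auto simp: min_less_iff_disj less_max_iff_disj)
      qed
    qed
    have "inj \<phi>" using cases by (auto simp: inj_def strict_mono_eq dest: strict_mono_eq)
    moreover have "\<phi> ` (B.passages \<inter> {min s t<..<max s t})
        = A.passages \<inter> {min (\<phi> s) (\<phi> t)<..<max (\<phi> s) (\<phi> t)}" (is "_ = ?R")
    proof
      show "?R \<subseteq> \<phi> ` (B.passages \<inter> {min s t<..<max s t})"
      proof
        fix y assume y: "y \<in> ?R"
        obtain x where x: "y = \<phi> x" using surj by blast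
        then have "x \<in> {min s t<..<max s t}" using y between by blast
        moreover have "x \<in> B.passages" using x y K'_eq by auto
        ultimately show "y \<in> \<phi> ` (B.passages \<inter> {min s t<..<max s t})" using x by blast
      qed
      show "\<phi> ` (B.passages \<inter> {min s t<..<max s t}) \<subseteq> ?R"
        using between K'_eq by blast
    qed
    ultimately show ?thesis unfolding bij_betw_def using inj_on_subset by blast
  qed
  show ?thesis
  proof (rule J_eqI[OF K K', of id])
    show "id ` classical_crossings K = classical_crossings K'"
      using surj_image_vimage_eq[OF surj]
      unfolding classical_crossings_def K'_eq image_comp[symmetric] by simp
  next
    fix s t assume st: "s \<in> overs K" "t \<in> unders K" "curve K s = curve K t"
    obtain s' t' where eq: "s = \<phi> s'" "t = \<phi> t'" using surj by (metis surjD)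
    have st': "s' \<in> overs K'" "t' \<in> unders K'" "curve K' s' = curve K' t'"
      using st eq K'_eq by auto
    have "curve K s \<in> Odd K \<longleftrightarrow> curve K' s' \<in> Odd K'"
      using A.Odd_iff_open[OF st] B.Odd_iff_open[OF st'] bij_betw_same_card[OF bij[of s' t']] eq by simp
    moreover have "wedge (A.velocity s) (A.velocity t) > 0 \<longleftrightarrow> wedge (B.velocity s') (B.velocity t') > 0"
      unfolding vel wedge_scaleR eq by (rule zero_less_mult_pos_iff[OF pos, symmetric])
    ultimately have "weight K (curve K s) = weight K' (curve K' s')"
      by (rule weight_eqI[OF K K' st st'])
    then show "weight K (curve K s) = weight K' (id (curve K s))" using eq K'_eq by auto
  qed simp
qed

text \<open>The determinant of the derivative never vanishes along the isotopy and equals 1 at time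
  0, so it is positive at time 1: the end map preserves orientation.\<close>

lemma ambient_isotopy_end:
  assumes "ambient_isotopy H"
  obtains D where "bij (H 1)" "\<And>z. (H 1 has_derivative D z) (at z)" "\<And>z. wedge (D z 1) (D z \<i>) > 0"
proof -
  obtain D :: "real \<Rightarrow> complex \<Rightarrow> complex \<Rightarrow>\<^sub>L complex"
    where cont: "continuous_on ({0..1} \<times> UNIV) (\<lambda>(t, z). D t z)"
      and D: "\<And>t z. t \<in> {0..1} \<Longrightarrow> (H t has_derivative blinfun_apply (D t z)) (at z)"
      and bij: "\<And>t z. t \<in> {0..1} \<Longrightarrow> bij (blinfun_apply (D t z))"
    using assms unfolding ambient_isotopy_def by blast
  have "wedge (D 1 z 1) (D 1 z \<i>) > 0" for z
  proof -
    define f where "f t = wedge (D t z 1) (D t z \<i>)" for t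
    have "continuous_on {0..1} (\<lambda>t. D t z)"
    proof -
      have "continuous_on {0..1} (\<lambda>t. (t, z))" by (intro continuous_intros)
      from continuous_on_compose2[OF cont this] show ?thesis by auto
    qed
    then have "continuous_on {0..1} f"
      unfolding f_def wedge_def by (auto intro!: continuous_intros)
    then have conn: "connected (f ` {0..1})" using connected_continuous_image connected_Icc by blast
    have nz: "f t \<noteq> 0" if t: "t \<in> {0..1}" for t
    proof
      assume "f t = 0"
      have lin: "linear (blinfun_apply (D t z))"
        by (simp add: blinfun.bounded_linear_right bounded_linear.linear)
      obtain u v where "D t z u = 1" "D t z v = \<i>" using bij[OF t, of z] by (metis bij_pointE)
      then have "wedge 1 \<i> = f t * wedge u v" using wedge_linear[OF lin, of u v] by (simp add: f_def)
      then show False using \<open>f t = 0\<close> by (simp add: wedge_def)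
    qed
    have "H 0 = (\<lambda>z. z)" using assms unfolding ambient_isotopy_def by auto
    then have "blinfun_apply (D 0 z) = (\<lambda>z. z)"
      using has_derivative_unique[OF D[of 0 z]] has_derivative_ident by auto
    then have "f 0 = 1" by (simp add: f_def wedge_def)
    show ?thesis
    proof (rule ccontr)
      assume "\<not> ?thesis"
      then have "0 \<in> f ` {0..1}"
        using connectedD_interval[OF conn, of "f 1" "f 0" 0] \<open>f 0 = 1\<close> by (auto simp: f_def)
      then show False using nz by auto
    qed
  qed
  moreover have "bij (H 1)" using assms unfolding ambient_isotopy_def by auto
  ultimately show ?thesis using that[of "\<lambda>z. blinfun_apply (D 1 z)"] D by auto
qed

lemma J_planar_isotopy:
  assumes K: "virtual_knot_diagram K" and K': "virtual_knot_diagram K'" and "planar_isotopy K K'"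
  shows "J K = J K'"
proof -
  interpret A: knot_diagram K by unfold_locales (rule K)
  interpret B: knot_diagram K' by unfold_locales (rule K')
  obtain H where H: "ambient_isotopy H"
    and K'_eq: "curve K' = H 1 \<circ> curve K" "overs K' = overs K" "unders K' = unders K"
    using assms(3) unfolding planar_isotopy_def by blast
  obtain D where bij: "bij (H 1)" and D: "\<And>z. (H 1 has_derivative D z) (at z)"
    and pos: "\<And>z. wedge (D z 1) (D z \<i>) > 0"
    using ambient_isotopy_end[OF H] by metis
  have vel: "B.velocity t = D (curve K t) (A.velocity t)" for t
    unfolding K'_eq
    by (rule vector_derivative_at, rule vector_derivative_diff_chain_within[OF A.has_velocity])
       (rule has_derivative_at_withinI[OF D])
  show ?thesis
  proof (rule J_eqI[OF K K', of "H 1"])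
    show "inj_on (H 1) (classical_crossings K)" using bij by (metis bij_is_inj inj_on_subset subset_UNIV)
    show "H 1 ` classical_crossings K = classical_crossings K'"
      by (simp add: classical_crossings_def K'_eq image_comp)
  next
    fix s t assume st: "s \<in> overs K" "t \<in> unders K" "curve K s = curve K t"
    have st': "s \<in> overs K'" "t \<in> unders K'" "curve K' s = curve K' t"
      using st K'_eq by auto
    have odd: "curve K s \<in> Odd K \<longleftrightarrow> curve K' s \<in> Odd K'"
      using A.Odd_iff_open[OF st] B.Odd_iff_open[OF st'] K'_eq by simp
    have "wedge (B.velocity s) (B.velocity t)
        = wedge (D (curve K t) 1) (D (curve K t) \<i>) * wedge (A.velocity s) (A.velocity t)"
      unfolding vel st(3) by (rule wedge_linear) (use D has_derivative_linear in blast)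
    then have "wedge (A.velocity s) (A.velocity t) > 0 \<longleftrightarrow> wedge (B.velocity s) (B.velocity t) > 0"
      using zero_less_mult_pos_iff[OF pos] by simp
    then have "weight K (curve K s) = weight K' (curve K' s)"
      by (rule weight_eqI[OF K K' st st' odd])
    then show "weight K (curve K s) = weight K' (H 1 (curve K s))" using K'_eq by auto
  qed
qed

section \<open>Pictures inside a disc\<close>

text \<open>The affine parametrization built into \<open>contains_picture\<close>, from
  \<open>p i\<close> at -1 to \<open>q i\<close> at 1; it decreases when the strand is traversed
  backwards.\<close>

definition strand_time :: "(nat \<Rightarrow> real) \<Rightarrow> (nat \<Rightarrow> real) \<Rightarrow> nat \<Rightarrow> real \<Rightarrow> real" where
  "strand_time p q i x = ((1 - x) * p i + (1 + x) * q i) / 2"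

lemma closed_segment_strand_time: "closed_segment (p i) (q i) = strand_time p q i ` {- 1..1}"
proof
  show "closed_segment (p i) (q i) \<subseteq> strand_time p q i ` {- 1..1}"
  proof
    fix t assume "t \<in> closed_segment (p i) (q i)"
    then obtain u where "t = (1 - u) *\<^sub>R p i + u *\<^sub>R q i" "0 \<le> u" "u \<le> 1" by (auto simp: in_segment)
    then show "t \<in> strand_time p q i ` {- 1..1}"
      by (intro image_eqI[of _ _ "2 * u - 1"]) (auto simp: strand_time_def field_simps)
  qed
  show "strand_time p q i ` {- 1..1} \<subseteq> closed_segment (p i) (q i)"
  proof
    fix t assume "t \<in> strand_time p q i ` {- 1..1}"
    then obtain x where "t = strand_time p q i x" "- 1 \<le> x" "x \<le> 1" by auto
    then show "t \<in> closed_segment (p i) (q i)"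
      unfolding in_segment by (intro exI[of _ "(1 + x) / 2"]) (auto simp: strand_time_def field_simps)
  qed
qed

lemma strand_times_iff:
  "t \<in> strand_times n p q \<longleftrightarrow> (\<exists>i<n. \<exists>x\<in>{- 1..1}. \<exists>k\<in>\<int>. t = strand_time p q i x + k)"
proof
  assume "t \<in> strand_times n p q"
  then obtain i k x where "i < n" "k \<in> \<int>" "x \<in> {- 1..1}" "t + k = strand_time p q i x"
    unfolding strand_times_def closed_segment_strand_time by blast
  moreover from this have "t = strand_time p q i x + - k" "- k \<in> \<int>" by auto
  ultimately show "\<exists>i<n. \<exists>x\<in>{- 1..1}. \<exists>k\<in>\<int>. t = strand_time p q i x + k" by blast
next
  assume "\<exists>i<n. \<exists>x\<in>{- 1..1}. \<exists>k\<in>\<int>. t = strand_time p q i x + k"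
  then obtain i k x where "i < n" "k \<in> \<int>" "x \<in> {- 1..1}" "t = strand_time p q i x + k" by blast
  moreover from this have "t + - k = strand_time p q i x" "- k \<in> \<int>" by auto
  ultimately show "t \<in> strand_times n p q"
    unfolding strand_times_def closed_segment_strand_time by blast
qed

lemma strand_time_diff: "strand_time p q i y - strand_time p q i x = (y - x) * (q i - p i) / 2"
  by (simp add: strand_time_def field_simps)

lemma strand_time_less_iff:
  "p i < q i \<Longrightarrow> strand_time p q i x < strand_time p q i y \<longleftrightarrow> x < y"
  "q i < p i \<Longrightarrow> strand_time p q i x < strand_time p q i y \<longleftrightarrow> y < x"
  by (subst diff_gt_0_iff_gt[symmetric], unfold strand_time_diff, simp add: zero_less_mult_iff)+

text \<open>
  Between two times of the following set each translate of a strand is run through completely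
  or not at all.
\<close>

definition outside_times :: "nat \<Rightarrow> (nat \<Rightarrow> real) \<Rightarrow> (nat \<Rightarrow> real) \<Rightarrow> real set" where
  "outside_times n p q = - strand_times n p q \<union> (\<lambda>i. min (p i) (q i)) ` {..<n}"

definition even_in_strands :: "nat \<Rightarrow> (nat \<Rightarrow> real) \<Rightarrow> (nat \<Rightarrow> real) \<Rightarrow> real set \<Rightarrow> bool" where
  "even_in_strands n p q C \<longleftrightarrow>
     (\<forall>s\<in>outside_times n p q. \<forall>t\<in>outside_times n p q.
        s \<le> t \<longrightarrow> even (card (C \<inter> strand_times n p q \<inter> {s..<t})))"

text \<open>Between \<open>s\<close> and \<open>t\<close> the passages off the strands are common to
  both sets, and those on the strands are even in number for each set, so the two counts have equal
  parity.\<close>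

lemma parity_transfer:
  assumes P: "parity_function C P" and P': "parity_function C' P'"
    and fin: "\<And>a b. finite (C \<inter> {a..<b})" "\<And>a b. finite (C' \<inter> {a..<b})"
    and ev: "even_in_strands n p q C" "even_in_strands n p q C'"
    and off: "C - strand_times n p q = C' - strand_times n p q"
    and st: "s \<in> outside_times n p q" "t \<in> outside_times n p q"
  shows "(P s = P t) = (P' s = P' t)"
proof -
  let ?T = "strand_times n p q"
  have split: "even (card (A \<inter> {a..<b})) = even (card ((A - ?T) \<inter> {a..<b}))"
    if "even_in_strands n p q A" "a \<in> outside_times n p q" "b \<in> outside_times n p q" "a \<le> b"
      "finite (A \<inter> {a..<b})" for A a b
  proof -
    have "A \<inter> {a..<b} = ((A - ?T) \<inter> {a..<b}) \<union> (A \<inter> ?T \<inter> {a..<b})" by blast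
    moreover have "finite ((A - ?T) \<inter> {a..<b})" "finite (A \<inter> ?T \<inter> {a..<b})"
      using that(5) by (auto elim: finite_subset[rotated])
    ultimately have "card (A \<inter> {a..<b}) = card ((A - ?T) \<inter> {a..<b}) + card (A \<inter> ?T \<inter> {a..<b})"
      by (metis card_Un_disjoint Diff_disjoint Int_Diff Int_assoc Int_commute disjoint_iff Int_iff Diff_iff)
    moreover have "even (card (A \<inter> ?T \<inter> {a..<b}))" using that unfolding even_in_strands_def by blast
    ultimately show ?thesis by simp
  qed
  have le: "(P a = P b) = (P' a = P' b)"
    if ab: "a \<in> outside_times n p q" "b \<in> outside_times n p q" "a \<le> b" for a b
    unfolding parity_function_eq_iff[OF P ab(3)] parity_function_eq_iff[OF P' ab(3)]
      split[OF ev(1) ab fin(1)] split[OF ev(2) ab fin(2)] off by (rule refl)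
  show ?thesis
  proof (cases "s \<le> t")
    case True
    then show ?thesis by (rule le[OF st])
  next
    case False
    then have "(P t = P s) = (P' t = P' s)" by (intro le[OF st(2,1)]) simp
    then show ?thesis by (simp only: eq_commute)
  qed
qed

lemma strand_time_unique:
  assumes disj: "strands_disjoint n p q"
    and ij: "i < n" "j < n" "x \<in> {- 1..1}" "y \<in> {- 1..1}" "strand_time p q i x - strand_time p q j y \<in> \<int>"
  shows "i = j" "x = y"
proof -
  have "strand_time p q i x \<in> closed_segment (p i) (q i)" "strand_time p q j y \<in> closed_segment (p j) (q j)"
    using ij unfolding closed_segment_strand_time by auto
  then have eq: "i = j \<and> strand_time p q i x = strand_time p q j y" using disj ij unfolding strands_disjoint_def by blast
  then show "i = j" by simp
  have "strand_time p q i x - strand_time p q i y = 0" using eq by auto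
  moreover have "p i \<noteq> q i" using disj ij(1) by (simp add: strands_disjoint_def)
  ultimately show "x = y" unfolding strand_time_diff by simp
qed

text \<open>What the pictures with crossings have in common. One crossing of a strand with itself,
  two crossings of two strands and a triangle of three strands all put exactly two passages on every
  strand.\<close>

locale strand_passages =
  fixes n :: nat and p q a b :: "nat \<Rightarrow> real" and C :: "real set"
  assumes disj: "strands_disjoint n p q"
    and ab: "\<And>i. i < n \<Longrightarrow> - 1 < a i \<and> a i < b i \<and> b i < 1"
    and C: "C \<inter> strand_times n p q = {strand_time p q i x + k |i x k. i < n \<and> x \<in> {a i, b i} \<and> k \<in> \<int>}"
    and fin: "\<And>s t. finite (C \<inter> {s..<t})"
begin

abbreviation "\<sigma> \<equiv> strand_time p q"

lemma pq: "i < n \<Longrightarrow> p i \<noteq> q i"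
  using disj by (simp add: strands_disjoint_def)

lemmas time_unique = strand_time_unique[OF disj]

lemma passage_in_segment:
  assumes "i < n" "t \<in> C" "t \<in> closed_segment (p i) (q i)"
  shows "t = \<sigma> i (a i) \<or> t = \<sigma> i (b i)"
proof -
  obtain x where x: "x \<in> {- 1..1}" "t = \<sigma> i x" using assms(3) unfolding closed_segment_strand_time by auto
  then have "t \<in> strand_times n p q" unfolding strand_times_iff using assms(1) Ints_0 by (metis add_0_right)
  then obtain j c k where j: "j < n" "c \<in> {a j, b j}" "k \<in> \<int>" "t = \<sigma> j c + k"
    using assms(2) C by blast
  then have "c \<in> {- 1..1}" using ab[OF j(1)] by auto
  moreover have "\<sigma> i x - \<sigma> j c = k" using x(2) j(4) by simp
  then have "\<sigma> i x - \<sigma> j c \<in> \<int>" using j(3) by simp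
  ultimately show ?thesis using time_unique[OF assms(1) j(1) x(1)] j x by auto
qed

text \<open>The curve enters the strand at time \<open>min (p i) (q i)\<close>. From there no
  passage precedes the first one and one precedes the second; \<open>p i < q i\<close> decides
  whether \<open>a i\<close> or \<open>b i\<close> comes first.\<close>

lemma parity_at_passage:
  assumes P: "parity_function C P" and i: "i < n"
  shows "P (\<sigma> i (a i)) \<longleftrightarrow> P (min (p i) (q i)) = (p i < q i)"
    and "P (\<sigma> i (b i)) \<longleftrightarrow> P (min (p i) (q i)) \<noteq> (p i < q i)"
proof -
  have main: "P u = P (min (p i) (q i)) \<and> P v \<noteq> P (min (p i) (q i))"
    if uv: "u = \<sigma> i (a i) \<and> v = \<sigma> i (b i) \<or> u = \<sigma> i (b i) \<and> v = \<sigma> i (a i)" "u < v" for u v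
  proof -
    let ?l = "min (p i) (q i)"
    have range: "\<sigma> i (a i) \<in> closed_segment (p i) (q i)" "\<sigma> i (b i) \<in> closed_segment (p i) (q i)"
      using ab[OF i] unfolding closed_segment_strand_time by auto
    have uv': "u \<in> closed_segment (p i) (q i)" "v \<in> closed_segment (p i) (q i)"
      using range uv(1) by blast+
    then have l: "?l \<le> u" "?l \<le> v" by (auto simp: closed_segment_eq_real_ivl split: if_splits)
    have only: "t = u \<or> t = v" if "t \<in> C" "?l \<le> t" "t < v" for t
    proof -
      have "t \<in> closed_segment (p i) (q i)"
        using uv' that by (auto simp: closed_segment_eq_real_ivl split: if_splits)
      then show ?thesis using passage_in_segment[OF i that(1)] uv(1) by blast
    qed
    have "u \<in> C"
    proof -
      have "u = \<sigma> i (a i) \<or> u = \<sigma> i (b i)" using uv(1) by blast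
      then have "u = \<sigma> i (a i) + 0 \<or> u = \<sigma> i (b i) + 0" by simp
      then have "u \<in> C \<inter> strand_times n p q" unfolding C using i Ints_0 by blast
      then show ?thesis by blast
    qed
    have 1: "C \<inter> {?l..<u} = {}"
    proof -
      have False if "t \<in> C" "?l \<le> t" "t < u" for t using only[of t] that uv(2) by linarith
      then show ?thesis by (meson Int_iff all_not_in_conv atLeastLessThan_iff)
    qed
    have 2: "C \<inter> {?l..<v} = {u}"
    proof (rule set_eqI)
      fix t show "t \<in> C \<inter> {?l..<v} \<longleftrightarrow> t \<in> {u}"
        using only[of t] \<open>u \<in> C\<close> l(1) uv(2) by (metis Int_iff atLeastLessThan_iff less_irrefl singleton_iff)
    qed
    have "P ?l = P u" using parity_function_eq_iff[OF P l(1)] unfolding 1 by simp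
    moreover have "P ?l \<noteq> P v" using parity_function_eq_iff[OF P l(2)] unfolding 2 by simp
    ultimately show ?thesis by blast
  qed
  have "(P (\<sigma> i (a i)) \<longleftrightarrow> P (min (p i) (q i)) = (p i < q i)) \<and>
        (P (\<sigma> i (b i)) \<longleftrightarrow> P (min (p i) (q i)) \<noteq> (p i < q i))"
  proof (cases "p i < q i")
    case True
    then have "\<sigma> i (a i) < \<sigma> i (b i)" using ab[OF i] by (simp add: strand_time_less_iff)
    then show ?thesis using main[of "\<sigma> i (a i)" "\<sigma> i (b i)"] True by blast
  next
    case False
    then have "q i < p i" using pq[OF i] by simp
    then have "\<sigma> i (b i) < \<sigma> i (a i)" using ab[OF i] by (simp add: strand_time_less_iff)
    then show ?thesis using main[of "\<sigma> i (b i)" "\<sigma> i (a i)"] False by blast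
  qed
  then show "P (\<sigma> i (a i)) \<longleftrightarrow> P (min (p i) (q i)) = (p i < q i)"
    "P (\<sigma> i (b i)) \<longleftrightarrow> P (min (p i) (q i)) \<noteq> (p i < q i)" by blast+
qed

text \<open>A time of \<open>outside_times\<close> on a translate of a strand can only be its left
  end, and no time of the strand precedes that. The four interval conditions together place
  \<open>x\<close> and \<open>y\<close> strictly between -1 and 1.\<close>

lemma outside_not_between:
  assumes s: "s \<in> outside_times n p q" and i: "i < n" and k: "k \<in> \<int>"
    and xy: "x \<in> {- 1<..1}" "y \<in> {- 1..<1}" "x \<in> {- 1..<1}" "y \<in> {- 1<..1}"
  shows "\<sigma> i x + k < s \<longleftrightarrow> \<sigma> i y + k < s"
proof -
  have False if uv: "u < s" "s \<le> v" "u - k \<in> \<sigma> i ` {- 1<..<1}" "v - k \<in> \<sigma> i ` {- 1<..<1}" for u v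
  proof -
    have seg: "u - k \<in> closed_segment (p i) (q i)" "v - k \<in> closed_segment (p i) (q i)"
      using uv(3,4) unfolding closed_segment_strand_time by auto
    then have "s - k \<in> closed_segment (p i) (q i)"
      using uv(1,2) by (auto simp: closed_segment_eq_real_ivl split: if_splits)
    then obtain c where c: "c \<in> {- 1..1}" "s - k = \<sigma> i c" unfolding closed_segment_strand_time by auto
    then have "s = \<sigma> i c + k" by simp
    then have "s \<in> strand_times n p q" unfolding strand_times_iff using c(1) i k by blast
    then obtain j where j: "j < n" "s = min (p j) (q j)" using s by (auto simp: outside_times_def)
    then have sj: "s \<in> closed_segment (p j) (q j)" by (auto simp: closed_segment_eq_real_ivl min_def)
    have "(s - k) - s \<in> \<int>" using k by simp
    then have "i = j \<and> s - k = s"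
      using disj i j(1) sj \<open>s - k \<in> closed_segment (p i) (q i)\<close> unfolding strands_disjoint_def by blast
    then have "u \<in> closed_segment (p j) (q j)" using seg(1) by simp
    then have "s \<le> u" using j(2) by (auto simp: closed_segment_eq_real_ivl min_def split: if_splits)
    then show False using uv(1) by simp
  qed
  moreover have "\<sigma> i x + k - k \<in> \<sigma> i ` {- 1<..<1}" "\<sigma> i y + k - k \<in> \<sigma> i ` {- 1<..<1}" using xy by auto
  ultimately show ?thesis by (metis not_le)
qed

text \<open>Shifting by the difference of the two passage times matches the two passages on each
  translate of a strand, and a window bounded by outside times contains both or neither.\<close>

lemma even_in_strands: "even_in_strands n p q C"
  unfolding even_in_strands_def
proof (intro ballI impI)
  fix s t assume st: "s \<in> outside_times n p q" "t \<in> outside_times n p q" "s \<le> t"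
  define A where "A i = {\<sigma> i (a i) + k |k. k \<in> \<int>} \<inter> {s..<t}" for i
  define B where "B i = {\<sigma> i (b i) + k |k. k \<in> \<int>} \<inter> {s..<t}" for i
  have eq: "C \<inter> strand_times n p q \<inter> {s..<t} = (\<Union>i<n. A i \<union> B i)"
    unfolding C A_def B_def by blast
  have finAB: "finite (A i)" "finite (B i)" if "i < n" for i
  proof -
    have "A i \<union> B i \<subseteq> C \<inter> {s..<t}" using eq that by blast
    then show "finite (A i)" "finite (B i)" using fin finite_subset by (metis le_sup_iff)+
  qed
  have AB: "A i \<inter> B i = {}" if i: "i < n" for i
  proof (rule ccontr)
    assume "A i \<inter> B i \<noteq> {}"
    then obtain k l where kl: "k \<in> \<int>" "l \<in> \<int>" "\<sigma> i (a i) + k = \<sigma> i (b i) + l" by (auto simp: A_def B_def)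
    then have "\<sigma> i (a i) - \<sigma> i (b i) = l - k" by simp
    then have "\<sigma> i (a i) - \<sigma> i (b i) \<in> \<int>" using Ints_diff[OF kl(2,1)] by (simp only:)
    then show False using time_unique(2)[OF i i, of "a i" "b i"] ab[OF i] by auto
  qed
  have card: "card (A i) = card (B i)" if i: "i < n" for i
  proof -
    have cond: "\<sigma> i (a i) + k \<in> {s..<t} \<longleftrightarrow> \<sigma> i (b i) + k \<in> {s..<t}" if "k \<in> \<int>" for k
      using outside_not_between[OF st(1) i that, of "a i" "b i"]
        outside_not_between[OF st(2) i that, of "a i" "b i"] ab[OF i] by (auto simp: not_less[symmetric])
    have "bij_betw (\<lambda>r. r + (\<sigma> i (b i) - \<sigma> i (a i))) (A i) (B i)"
    proof (rule bij_betw_byWitness[where f' = "\<lambda>r. r + (\<sigma> i (a i) - \<sigma> i (b i))"])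
      show "(\<lambda>r. r + (\<sigma> i (b i) - \<sigma> i (a i))) ` A i \<subseteq> B i"
      proof
        fix r assume "r \<in> (\<lambda>r. r + (\<sigma> i (b i) - \<sigma> i (a i))) ` A i"
        then obtain k where "k \<in> \<int>" "\<sigma> i (a i) + k \<in> {s..<t}" "r = \<sigma> i (b i) + k" by (auto simp: A_def)
        then show "r \<in> B i" using cond unfolding B_def by blast
      qed
      show "(\<lambda>r. r + (\<sigma> i (a i) - \<sigma> i (b i))) ` B i \<subseteq> A i"
      proof
        fix r assume "r \<in> (\<lambda>r. r + (\<sigma> i (a i) - \<sigma> i (b i))) ` B i"
        then obtain k where "k \<in> \<int>" "\<sigma> i (b i) + k \<in> {s..<t}" "r = \<sigma> i (a i) + k" by (auto simp: B_def)
        then show "r \<in> A i" using cond unfolding A_def by blast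
      qed
    qed auto
    then show ?thesis by (rule bij_betw_same_card)
  qed
  have "(A i \<union> B i) \<inter> (A j \<union> B j) = {}" if ij: "i < n" "j < n" "i \<noteq> j" for i j
  proof (rule ccontr)
    assume "(A i \<union> B i) \<inter> (A j \<union> B j) \<noteq> {}"
    then obtain r where "r \<in> A i \<union> B i" "r \<in> A j \<union> B j" by blast
    then obtain x y k l where xy: "x \<in> {a i, b i}" "y \<in> {a j, b j}" "k \<in> \<int>" "l \<in> \<int>"
      "r = \<sigma> i x + k" "r = \<sigma> j y + l" unfolding A_def B_def by blast
    then have "\<sigma> i x - \<sigma> j y = l - k" by simp
    then have "\<sigma> i x - \<sigma> j y \<in> \<int>" using Ints_diff[OF xy(4,3)] by (simp only:)
    moreover have "x \<in> {- 1..1}" "y \<in> {- 1..1}" using xy ab[OF ij(1)] ab[OF ij(2)] by auto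
    ultimately show False using time_unique(1)[OF ij(1,2)] ij(3) by blast
  qed
  then have "card (\<Union>i<n. A i \<union> B i) = (\<Sum>i<n. card (A i \<union> B i))"
    using finAB by (intro card_UN_disjoint) auto
  also have "\<dots> = (\<Sum>i<n. 2 * card (A i))"
    using finAB AB card by (intro sum.cong) (auto simp: card_Un_disjoint)
  finally show "even (card (C \<inter> strand_times n p q \<inter> {s..<t}))"
    unfolding eq by (simp add: sum_distrib_left[symmetric])
qed

end

lemma even_in_strands_empty: "C \<inter> strand_times n p q = {} \<Longrightarrow> even_in_strands n p q C"
  by (simp add: even_in_strands_def)

section \<open>Charts, and separation of the crossings inside the disc from the others\<close>

lemma chart_inj: "chart \<phi> \<Longrightarrow> inj_on \<phi> square"
  by (auto simp: chart_def elim: inj_on_subset)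

lemma chart_derivative:
  assumes "chart \<phi>" "z \<in> square"
  obtains D where "(\<phi> has_derivative D) (at z)" "wedge (D 1) (D \<i>) > 0"
  using assms unfolding chart_def by (metis subset_iff)

text \<open>Closedness of the disc makes the set of times off the picture open, which is needed to
  compare velocities there.\<close>

lemma closed_chart_square:
  assumes "chart \<phi>"
  shows "closed (\<phi> ` square)"
proof -
  have "square = cbox (Complex (- 1) (- 1)) (Complex 1 1)"
    by (auto simp: square_def in_cbox_complex_iff abs_le_iff)
  then have "compact square" by (metis compact_cbox)
  moreover have "continuous_on square \<phi>"
    unfolding continuous_on_eq_continuous_within
    by (metis assms chart_derivative continuous_at_imp_continuous_within has_derivative_continuous)
  ultimately show ?thesis using compact_continuous_image compact_imp_closed by blast
qed

lemma velocity_agree_off: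
  assumes K: "virtual_knot_diagram K" and "chart \<phi>"
    and T: "\<And>t. curve K t \<in> \<phi> ` square \<longleftrightarrow> t \<in> T" and agree: "agree_off T K K'" and t: "t \<notin> T"
  shows "vector_derivative (curve K') (at t) = vector_derivative (curve K) (at t)"
proof -
  interpret knot_diagram K by unfold_locales (rule K)
  have "- T = curve K -` (- (\<phi> ` square))" using T by auto
  then have "open (- T)"
    using closed_chart_square[OF assms(2)] continuous_open_vimage[of "- (\<phi> ` square)" "curve K"] continuous_curve[of UNIV]
    by (auto simp: continuous_on_eq_continuous_at)
  then have "(curve K' has_vector_derivative velocity t) (at t)"
    using t agree by (intro has_vector_derivative_transform_within_open[OF has_velocity]) (auto simp: agree_off_def)
  then show ?thesis by (rule vector_derivative_at)
qed

text \<open>Both passage times lie off the strands. There equality of parities is transferred from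
  one diagram to the other, and the velocities that determine the sign agree.\<close>

lemma crossing_outside_picture:
  assumes K: "virtual_knot_diagram K" and K': "virtual_knot_diagram K'" and chart: "chart \<phi>"
    and T: "\<And>t. curve K t \<in> \<phi> ` square \<longleftrightarrow> t \<in> strand_times n p q"
    and agree: "agree_off (strand_times n p q) K K'"
    and ev: "even_in_strands n p q (overs K \<union> unders K)" "even_in_strands n p q (overs K' \<union> unders K')"
    and z: "z \<in> classical_crossings K" "z \<notin> \<phi> ` square"
  shows "z \<in> classical_crossings K' \<and> weight K z = weight K' z"
proof -
  interpret A: knot_diagram K by unfold_locales (rule K)
  interpret B: knot_diagram K' by unfold_locales (rule K')
  obtain s t where st: "s \<in> overs K" "t \<in> unders K" and "curve K s = z" "curve K t = z"
    using A.classical_crossingE[OF z(1)] by metis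
  then have notin: "s \<notin> strand_times n p q" "t \<notin> strand_times n p q" using z(2) T[of s] T[of t] \<open>curve K s = z\<close> \<open>curve K t = z\<close> by simp_all
  have eq: "curve K s = curve K t" using \<open>curve K s = z\<close> \<open>curve K t = z\<close> by simp
  have agree': "curve K' s = curve K s" "curve K' t = curve K t" "s \<in> overs K'" "t \<in> unders K'"
    using agree notin st unfolding agree_off_def by auto
  have eq': "curve K' s = curve K' t" using agree' eq by simp
  obtain P P' where P: "parity_function A.passages P" and P': "parity_function B.passages P'"
    using A.parity_exists B.parity_exists by blast
  have off: "A.passages - strand_times n p q = B.passages - strand_times n p q"
    using agree unfolding agree_off_def by blast
  have "(P s = P t) = (P' s = P' t)"
    using notin by (intro parity_transfer[OF P P' A.finite_passages B.finite_passages ev off])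
      (auto simp: outside_times_def)
  then have odd: "curve K s \<in> Odd K \<longleftrightarrow> curve K' s \<in> Odd K'"
    using A.Odd_iff_parity[OF P st eq] B.Odd_iff_parity[OF P' agree'(3,4) eq'] by simp
  have "weight K (curve K s) = weight K' (curve K' s)"
    by (rule weight_eqI[OF K K' st eq agree'(3,4) eq' odd])
       (simp add: velocity_agree_off[OF K chart T agree] notin)
  moreover have "curve K' s \<in> classical_crossings K'" using agree'(3) by (simp add: classical_crossings_def)
  ultimately show ?thesis using agree' \<open>curve K s = z\<close> by simp
qed

text \<open>Leaves a purely local identity to each Reidemeister move: off the disc both diagrams
  have the same crossings with the same weights.\<close>

lemma J_local_replacement:
  assumes K: "virtual_knot_diagram K" and K': "virtual_knot_diagram K'" and chart: "chart \<phi>"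
    and pic: "contains_picture n M \<phi> p q K" "contains_picture n M' \<phi> p q K'"
    and agree: "agree_off (strand_times n p q) K K'"
    and ev: "even_in_strands n p q (overs K \<union> unders K)" "even_in_strands n p q (overs K' \<union> unders K')"
    and inside: "(\<Sum>z\<in>classical_crossings K \<inter> \<phi> ` square. weight K z)
      = (\<Sum>z\<in>classical_crossings K' \<inter> \<phi> ` square. weight K' z)"
  shows "J K = J K'"
proof -
  interpret A: knot_diagram K by unfold_locales (rule K)
  interpret B: knot_diagram K' by unfold_locales (rule K')
  let ?S = "\<phi> ` square"
  have T: "curve K t \<in> ?S \<longleftrightarrow> t \<in> strand_times n p q" "curve K' t \<in> ?S \<longleftrightarrow> t \<in> strand_times n p q" for t
    using pic unfolding contains_picture_def by blast+
  have agree': "agree_off (strand_times n p q) K' K" using agree by (simp add: agree_off_def)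
  note out = crossing_outside_picture[OF K K' chart T(1) agree ev]
    crossing_outside_picture[OF K' K chart T(2) agree' ev(2,1)]
  have "classical_crossings K - ?S = classical_crossings K' - ?S" using out by blast
  moreover have "weight K z = weight K' z" if "z \<in> classical_crossings K - ?S" for z using out(1) that by blast
  ultimately have outside: "(\<Sum>z\<in>classical_crossings K - ?S. weight K z)
      = (\<Sum>z\<in>classical_crossings K' - ?S. weight K' z)" by (metis (no_types, lifting) sum.cong)
  have split: "sum f X = sum f (X - ?S) + sum f (X \<inter> ?S)" if "finite X" for f :: "complex \<Rightarrow> int" and X
    using sum.Int_Diff[OF that, of f ?S] by simp
  show ?thesis
    unfolding A.J_eq_sum_weight B.J_eq_sum_weight split[OF A.finite_classical_crossings]
      split[OF B.finite_classical_crossings] inside outside ..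
qed

section \<open>Crossings of the model strands inside a diagram\<close>

locale picture = knot_diagram K for K +
  fixes n :: nat and M :: "nat \<Rightarrow> real \<Rightarrow> complex" and \<phi> :: "complex \<Rightarrow> complex" and p q :: "nat \<Rightarrow> real"
  assumes disj: "strands_disjoint n p q" and chart: "chart \<phi>"
    and picture: "contains_picture n M \<phi> p q K"
    and in_square: "\<And>i x. i < n \<Longrightarrow> x \<in> {- 1..1} \<Longrightarrow> M i x \<in> square"
begin

abbreviation "\<tau> \<equiv> strand_time p q"

lemma curve_strand: "i < n \<Longrightarrow> x \<in> {- 1..1} \<Longrightarrow> \<gamma> (\<tau> i x) = \<phi> (M i x)"
  using picture unfolding contains_picture_def strand_time_def by blast

lemma curve_in_picture: "\<gamma> t \<in> \<phi> ` square \<longleftrightarrow> t \<in> strand_times n p q"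
  using picture unfolding contains_picture_def by blast

lemma same_point_strand:
  assumes "i < n" "j < n" "x \<in> {- 1..1}" "y \<in> {- 1..1}"
  shows "\<gamma> (\<tau> i x) = \<gamma> (\<tau> j y) \<longleftrightarrow> M i x = M j y"
  using assms in_square chart_inj[OF chart] by (auto simp: curve_strand dest: inj_onD)

lemma crossing_pair_strand:
  assumes "i < n" "j < n" "x \<in> {- 1..1}" "y \<in> {- 1..1}"
  shows "crossing_pair \<gamma> (\<tau> i x) (\<tau> j y) \<longleftrightarrow> (i, x) \<noteq> (j, y) \<and> M i x = M j y"
proof -
  have "\<tau> i x - \<tau> j y \<in> \<int> \<longleftrightarrow> (i, x) = (j, y)"
    using strand_time_unique[OF disj assms] by auto
  then show ?thesis using same_point_strand[OF assms] unfolding crossing_pair_def by blast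
qed

text \<open>The partner of a passage lies over the same point of the disc, hence on a strand too, so
  every passage on the strands comes from a double point of the model curves.\<close>

lemma passage_strand:
  assumes t: "t \<in> passages" "t \<in> strand_times n p q"
  obtains i x k j y where "i < n" "x \<in> {- 1..1}" "k \<in> \<int>" "t = \<tau> i x + k"
    "j < n" "y \<in> {- 1..1}" "(i, x) \<noteq> (j, y)" "M i x = M j y"
proof -
  obtain r where r: "crossing_pair \<gamma> t r"
    using t(1) over_partner under_partner crossing_pair_sym by blast
  then have "\<gamma> r = \<gamma> t" "t - r \<notin> \<int>" by (auto simp: crossing_pair_def)
  then have "r \<in> strand_times n p q" using t(2) curve_in_picture by metis
  then obtain j y l where j: "j < n" "y \<in> {- 1..1}" "l \<in> \<int>" "r = \<tau> j y + l"
    unfolding strand_times_iff by blast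
  obtain i x k where i: "i < n" "x \<in> {- 1..1}" "k \<in> \<int>" "t = \<tau> i x + k"
    using t(2) unfolding strand_times_iff by blast
  have "\<gamma> (\<tau> i x) = \<gamma> (\<tau> j y)" using \<open>\<gamma> r = \<gamma> t\<close> i(3,4) j(3,4) by (simp add: curve_shift)
  then have "M i x = M j y" using same_point_strand i j by blast
  moreover have "(i, x) \<noteq> (j, y)"
  proof
    assume "(i, x) = (j, y)"
    then have "t - r = k - l" using i(4) j(4) by simp
    then show False using \<open>t - r \<notin> \<int>\<close> i(3) j(3) by simp
  qed
  ultimately show thesis using that i j by blast
qed

lemma velocity_strand:
  assumes D: "(\<phi> has_derivative D) (at (M i x))" and i: "i < n" and x: "x \<in> {- 1<..<1}"
    and m: "(M i has_vector_derivative m) (at x)"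
  shows "velocity (\<tau> i x) = D ((2 / (q i - p i)) *\<^sub>R m)"
proof (rule vector_derivative_at)
  have pq: "p i \<noteq> q i" using disj i by (simp add: strands_disjoint_def)
  \<comment> \<open>The inverse of \<open>\<tau> i\<close>; its slope \<open>2 / (q i - p i)\<close>
    is negative for a strand run backwards.\<close>
  define g where "g t = 2 / (q i - p i) * (t - (p i + q i) / 2)" for t
  have g\<tau>: "g (\<tau> i y) = y" for y using pq by (simp add: g_def strand_time_def field_simps)
  have \<tau>g: "\<tau> i (g t) = t" for t
  proof -
    have "(1 - g t) * p i + (1 + g t) * q i = p i + q i + g t * (q i - p i)" by (simp add: algebra_simps)
    moreover have "g t * (q i - p i) = 2 * (t - (p i + q i) / 2)" using pq by (simp add: g_def)
    ultimately show ?thesis unfolding strand_time_def by (simp add: field_simps)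
  qed
  have der_g: "(g has_vector_derivative 2 / (q i - p i)) (at t)" for t
  proof -
    have "((\<lambda>t. c * (t - d)) has_real_derivative c) (at t)" for c d
      by (auto intro!: derivative_eq_intros)
    then show ?thesis unfolding g_def has_real_derivative_iff_has_vector_derivative[symmetric] .
  qed
  have "((M i \<circ> g) has_vector_derivative (2 / (q i - p i)) *\<^sub>R m) (at (\<tau> i x))"
    by (rule vector_diff_chain_at[OF der_g]) (simp add: g\<tau> m)
  then have "((\<phi> \<circ> (M i \<circ> g)) has_vector_derivative D ((2 / (q i - p i)) *\<^sub>R m)) (at (\<tau> i x))"
    by (rule vector_derivative_diff_chain_within) (simp add: g\<tau> has_derivative_at_withinI D)
  moreover have "open (g -` {- 1<..<1})"
    by (intro continuous_open_vimage open_greaterThanLessThan)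
       (metis der_g has_vector_derivative_continuous)
  moreover have "\<tau> i x \<in> g -` {- 1<..<1}" using x g\<tau> by simp
  moreover have "(\<phi> \<circ> (M i \<circ> g)) t = \<gamma> t" if "t \<in> g -` {- 1<..<1}" for t
    using curve_strand[OF i, of "g t"] that \<tau>g by simp
  ultimately show "(\<gamma> has_vector_derivative D ((2 / (q i - p i)) *\<^sub>R m)) (at (\<tau> i x))"
    by (rule has_vector_derivative_transform_within_open)
qed

text \<open>The determinant of the chart is positive and drops out of the sign, and the speeds enter
  only through the signs of \<open>q i - p i\<close> and \<open>q j - p j\<close>. What remains is
  the wedge of the model velocities.\<close>

lemma crossing_sign_strand:
  assumes i: "i < n" "x \<in> {- 1<..<1}" "(M i has_vector_derivative m) (at x)"
    and j: "j < n" "y \<in> {- 1<..<1}" "(M j has_vector_derivative m') (at y)"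
    and "M i x = M j y" "\<tau> i x \<in> overs K" "\<tau> j y \<in> unders K"
  shows "crossing_sign K (\<phi> (M i x)) = (if (q i - p i) * (q j - p j) * wedge m m' > 0 then 1 else - 1)"
proof -
  have pq: "p i \<noteq> q i" "p j \<noteq> q j" using disj i j by (simp_all add: strands_disjoint_def)
  have xy: "x \<in> {- 1..1}" "y \<in> {- 1..1}" using i j by auto
  obtain D where D: "(\<phi> has_derivative D) (at (M i x))" "wedge (D 1) (D \<i>) > 0"
    using chart_derivative[OF chart in_square[OF i(1) xy(1)]] by blast
  have eq: "wedge (velocity (\<tau> i x)) (velocity (\<tau> j y))
      = wedge (D 1) (D \<i>) * (4 / ((q i - p i) * (q j - p j)) * wedge m m')"
    unfolding velocity_strand[OF D(1) i] velocity_strand[OF D(1)[unfolded assms(7)] j]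
    by (subst wedge_linear[OF has_derivative_linear[OF D(1)]]) (simp add: wedge_scaleR)
  have "wedge (velocity (\<tau> i x)) (velocity (\<tau> j y)) > 0
      \<longleftrightarrow> 4 / ((q i - p i) * (q j - p j)) * wedge m m' > 0"
    unfolding eq by (rule zero_less_mult_pos_iff[OF D(2)])
  also have "\<dots> \<longleftrightarrow> (q i - p i) * (q j - p j) * wedge m m' > 0"
    using pq by (auto simp: zero_less_mult_iff zero_less_divide_iff mult_less_0_iff divide_less_0_iff)
  finally show ?thesis
    using crossing_sign_eq[OF assms(8,9)] assms(7) same_point_strand[OF i(1) j(1) xy] curve_strand[OF i(1) xy(1)]
    by simp
qed

lemma Odd_strand:
  assumes "parity_function passages P" "i < n" "x \<in> {- 1..1}" "j < n" "y \<in> {- 1..1}"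
    and "M i x = M j y" "\<tau> i x \<in> overs K" "\<tau> j y \<in> unders K"
  shows "\<phi> (M i x) \<in> Odd K \<longleftrightarrow> P (\<tau> i x) = P (\<tau> j y)"
  using Odd_iff_parity[OF assms(1,7,8)] assms same_point_strand curve_strand by metis

end

text \<open>That the model double points are classical follows from a different clause in each move,
  the condition on crossing pairs for move I and the layering for moves II and III; hence it is an
  assumption here.\<close>

locale two_passages_picture = picture +
  fixes a b :: "nat \<Rightarrow> real"
  assumes ab: "\<And>i. i < n \<Longrightarrow> - 1 < a i \<and> a i < b i \<and> b i < 1"
    and double: "\<And>i x j y. i < n \<Longrightarrow> x \<in> {- 1..1} \<Longrightarrow> j < n \<Longrightarrow> y \<in> {- 1..1} \<Longrightarrow>
                  (i, x) \<noteq> (j, y) \<Longrightarrow> M i x = M j y \<Longrightarrow> x \<in> {a i, b i}"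
    and classical: "\<And>i x. i < n \<Longrightarrow> x \<in> {a i, b i} \<Longrightarrow> \<tau> i x \<in> passages"
begin

lemma ab_range: "i < n \<Longrightarrow> x \<in> {a i, b i} \<Longrightarrow> x \<in> {- 1<..<1}" "i < n \<Longrightarrow> x \<in> {a i, b i} \<Longrightarrow> x \<in> {- 1..1}"
  using ab[of i] by auto

sublocale strand_passages n p q a b passages
proof
  show "passages \<inter> strand_times n p q = {\<tau> i x + k |i x k. i < n \<and> x \<in> {a i, b i} \<and> k \<in> \<int>}"
  proof
    show "passages \<inter> strand_times n p q \<subseteq> {\<tau> i x + k |i x k. i < n \<and> x \<in> {a i, b i} \<and> k \<in> \<int>}"
    proof
      fix t assume "t \<in> passages \<inter> strand_times n p q"
      then have "t \<in> passages" "t \<in> strand_times n p q" by auto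
      then obtain i x k j y where *: "i < n" "x \<in> {- 1..1}" "k \<in> \<int>" "t = \<tau> i x + k"
        "j < n" "y \<in> {- 1..1}" "(i, x) \<noteq> (j, y)" "M i x = M j y"
        by (rule passage_strand)
      then have "x \<in> {a i, b i}" using double by blast
      then show "t \<in> {\<tau> i x + k |i x k. i < n \<and> x \<in> {a i, b i} \<and> k \<in> \<int>}" using * by blast
    qed
    show "{\<tau> i x + k |i x k. i < n \<and> x \<in> {a i, b i} \<and> k \<in> \<int>} \<subseteq> passages \<inter> strand_times n p q"
    proof
      fix t assume "t \<in> {\<tau> i x + k |i x k. i < n \<and> x \<in> {a i, b i} \<and> k \<in> \<int>}"
      then obtain i x k where *: "i < n" "x \<in> {a i, b i}" "k \<in> \<int>" "t = \<tau> i x + k" by blast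
      then have "t \<in> strand_times n p q" using ab_range(2) unfolding strand_times_iff by blast
      moreover have "t \<in> passages"
        using classical[OF *(1,2)] *(3,4) by (simp add: overs_shift unders_shift)
      ultimately show "t \<in> passages \<inter> strand_times n p q" by blast
    qed
  qed
qed (use disj ab finite_passages in auto)

lemma crossing_in_picture:
  assumes "z \<in> classical_crossings K" "z \<in> \<phi> ` square"
  obtains i x j y where "i < n" "x \<in> {a i, b i}" "j < n" "y \<in> {a j, b j}" "\<tau> i x \<in> overs K" "\<tau> j y \<in> unders K"
    "z = \<phi> (M i x)" "M i x = M j y"
proof -
  obtain s t where st: "s \<in> overs K" "t \<in> unders K" "\<gamma> s = z" "\<gamma> t = z"
    using classical_crossingE[OF assms(1)] .
  then have "s \<in> passages \<inter> strand_times n p q" "t \<in> passages \<inter> strand_times n p q"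
    using assms(2) curve_in_picture[of s] curve_in_picture[of t] by simp_all
  then obtain i x k j y l where i: "i < n" "x \<in> {a i, b i}" "k \<in> \<int>" "s = \<tau> i x + k"
    and j: "j < n" "y \<in> {a j, b j}" "l \<in> \<int>" "t = \<tau> j y + l"
    unfolding C by blast
  have "\<tau> i x \<in> overs K" "\<tau> j y \<in> unders K" "\<gamma> (\<tau> i x) = z" "\<gamma> (\<tau> j y) = z"
    using st i j by (simp_all add: overs_shift unders_shift curve_shift)
  moreover from this have "z = \<phi> (M i x)" "M i x = M j y"
    using curve_strand same_point_strand i j ab_range(2) by metis+
  ultimately show thesis using that i j by blast
qed

end

section \<open>Reidemeister moves\<close>

text \<open>Where (1 - x^2)^2 = 1/2, the real part of \<open>R1_after\<close> vanishes, and strand 0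
  of \<open>R2_after\<close> meets the real axis. The solutions are sqrt (1 - sqrt (1/2)) and its
  negative.\<close>

lemma R1_R2_parameter:
  obtains c :: real where "0 < c" "c < 1" "\<forall>x\<in>{- 1..1}. (1 - x\<^sup>2)\<^sup>2 = 1 / 2 \<longleftrightarrow> x \<in> {- c, c}"
proof -
  define d where "d = sqrt (1 / 2)"
  have d: "0 < d" "d < 1" "d\<^sup>2 = 1 / 2" by (auto simp: d_def)
  define c where "c = sqrt (1 - d)"
  have c: "0 < c" "c < 1" "c\<^sup>2 = 1 - d" using d by (auto simp: c_def)
  have "(1 - x\<^sup>2)\<^sup>2 = 1 / 2 \<longleftrightarrow> x \<in> {- c, c}" if "x \<in> {- 1..1}" for x
  proof -
    have "x\<^sup>2 \<le> 1" using that by (simp add: abs_square_le_1 abs_le_iff)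
    then have "(1 - x\<^sup>2)\<^sup>2 = d\<^sup>2 \<longleftrightarrow> 1 - x\<^sup>2 = d" using d by (simp add: power2_eq_iff)
    also have "\<dots> \<longleftrightarrow> x\<^sup>2 = c\<^sup>2" using c by auto
    also have "\<dots> \<longleftrightarrow> x \<in> {- c, c}" by (auto simp: power2_eq_iff)
    finally show ?thesis using d by simp
  qed
  then show thesis using that c by blast
qed

text \<open>The equation says that strands 0 and 2 meet, x/2 = (1 - x^2)^2 / 4. The root is not
  computed: it exists by the intermediate value theorem and is unique because \<open>f\<close>
  decreases between 0 and 1; a negative root is impossible since the right side is
  nonnegative.\<close>

lemma R3_parameter:
  obtains c :: real where "0 < c" "c < 1" "\<forall>x\<in>{- 1..1}. 2 * x = (1 - x\<^sup>2)\<^sup>2 \<longleftrightarrow> x = c"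
proof -
  define f where "f x = (1 - x\<^sup>2)\<^sup>2 - 2 * x" for x :: real
  have "\<exists>x. 0 \<le> x \<and> x \<le> 1 \<and> f x = 0"
    by (rule IVT2) (auto simp: f_def intro!: continuous_intros)
  then obtain c where c: "0 \<le> c" "c \<le> 1" "f c = 0" by blast
  have dec: "f y < f x" if "0 \<le> x" "x < y" "y \<le> 1" for x y
  proof -
    have "x\<^sup>2 \<le> y\<^sup>2" "y\<^sup>2 \<le> 1" using that by (auto intro: power_mono simp: abs_square_le_1)
    then have "(1 - y\<^sup>2)\<^sup>2 \<le> (1 - x\<^sup>2)\<^sup>2" by (intro power_mono) auto
    then show ?thesis using that by (simp add: f_def)
  qed
  have "c \<noteq> 0" "c \<noteq> 1" using c(3) by (auto simp: f_def)
  then have "0 < c" "c < 1" using c by simp_all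
  moreover have "2 * x = (1 - x\<^sup>2)\<^sup>2 \<longleftrightarrow> x = c" if x: "x \<in> {- 1..1}" for x
  proof
    assume eq: "2 * x = (1 - x\<^sup>2)\<^sup>2"
    then have "f x = 0" "0 \<le> 2 * x" by (simp_all add: f_def)
    then show "x = c" using dec[of x c] dec[of c x] c x by (cases x c rule: linorder_cases) auto
  next
    assume "x = c"
    then show "2 * x = (1 - x\<^sup>2)\<^sup>2" using c(3) by (simp add: f_def)
  qed
  ultimately show thesis using that by blast
qed

lemma layered_strands:
  assumes "picture K n M \<phi> p q" "layered n h p q K" "i < n" "j < n" "x \<in> {- 1..1}" "y \<in> {- 1..1}"
    and "h j < h i" "M i x = M j y"
  shows "strand_time p q i x \<in> overs K" "strand_time p q j y \<in> unders K"
proof -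
  interpret picture K n M \<phi> p q by (rule assms(1))
  have "\<tau> i x \<in> closed_segment (p i) (q i)" "\<tau> j y \<in> closed_segment (p j) (q j)"
    using assms unfolding closed_segment_strand_time by blast+
  moreover have "curve K (\<tau> i x) = curve K (\<tau> j y)" using same_point_strand assms by blast
  ultimately show "\<tau> i x \<in> overs K" "\<tau> j y \<in> unders K"
    using assms(2-4,7) unfolding layered_def by blast+
qed

lemma (in picture) no_passages_if_inj:
  assumes "\<And>i x j y. i < n \<Longrightarrow> x \<in> {- 1..1} \<Longrightarrow> j < n \<Longrightarrow> y \<in> {- 1..1} \<Longrightarrow>
    M i x = M j y \<Longrightarrow> (i, x) = (j, y)"
  shows "passages \<inter> strand_times n p q = {}" "classical_crossings K \<inter> \<phi> ` square = {}"
proof -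
  show empty: "passages \<inter> strand_times n p q = {}"
    using assms by (auto elim!: passage_strand)
  show "classical_crossings K \<inter> \<phi> ` square = {}"
    using empty curve_in_picture unfolding classical_crossings_def by blast
qed

lemma in_squareI: "\<bar>Re z\<bar> \<le> 1 \<Longrightarrow> \<bar>Im z\<bar> \<le> 1 \<Longrightarrow> z \<in> square"
  by (simp add: square_def)

lemma one_minus_square_bounds:
  fixes x :: real
  assumes "x \<in> {- 1..1}"
  shows "0 \<le> (1 - x\<^sup>2)\<^sup>2" "(1 - x\<^sup>2)\<^sup>2 \<le> 1"
proof -
  have "x\<^sup>2 \<le> 1" using assms by (simp add: abs_square_le_1 abs_le_iff)
  then show "(1 - x\<^sup>2)\<^sup>2 \<le> 1" by (simp add: abs_square_le_1)
qed simp

section \<open>The first Reidemeister move\<close>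

lemma R1_after_double:
  assumes "x \<in> {- 1..1}" "y \<in> {- 1..1}" "x \<noteq> y" "R1_after i x = R1_after j y"
  shows "y = - x" "(1 - x\<^sup>2)\<^sup>2 = 1 / 2"
proof -
  have eq: "(1 - x\<^sup>2)\<^sup>2 = (1 - y\<^sup>2)\<^sup>2" "x * (1 - 2 * (1 - x\<^sup>2)\<^sup>2) = y * (1 - 2 * (1 - y\<^sup>2)\<^sup>2)"
    using arg_cong[OF assms(4), of Im] arg_cong[OF assms(4), of Re]
    unfolding R1_after_def complex.sel by linarith+
  have "x\<^sup>2 \<le> 1" "y\<^sup>2 \<le> 1" using assms by (simp_all add: abs_square_le_1 abs_le_iff)
  \<comment> \<open>Both sides are nonnegative, so equal imaginary parts determine the square of the
    parameter. The real part is odd in the parameter, hence equal values at \<open>x\<close> and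
    \<open>- x\<close> are 0.\<close>
  then have "1 - x\<^sup>2 = 1 - y\<^sup>2" using eq(1) by (simp add: power2_eq_iff_nonneg)
  then show "y = - x" using assms(3) by (auto simp: power2_eq_iff)
  then have "x * (1 - 2 * (1 - x\<^sup>2)\<^sup>2) = 0" "x \<noteq> 0" using eq(2) assms(3) by auto
  then show "(1 - x\<^sup>2)\<^sup>2 = 1 / 2" by simp
qed

lemma R1_after_double_point:
  assumes "(1 - x\<^sup>2)\<^sup>2 = 1 / 2"
  shows "R1_after i x = R1_after j (- x)"
  using assms by (simp add: R1_after_def)

lemma J_reidemeister_1:
  assumes K: "virtual_knot_diagram K" and K': "virtual_knot_diagram K'" and "reidemeister_1 K K'"
  shows "J K = J K'"
proof -
  obtain p q \<phi> where disj: "strands_disjoint 1 p q" and chart: "chart \<phi>"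
    and pic: "contains_picture 1 R1_before \<phi> p q K" "contains_picture 1 R1_after \<phi> p q K'"
    and agree: "agree_off (strand_times 1 p q) K K'"
    and cl: "\<forall>s\<in>closed_segment (p 0) (q 0). \<forall>t\<in>closed_segment (p 0) (q 0).
           crossing_pair (curve K') s t \<longrightarrow> s \<in> overs K' \<union> unders K'"
    using assms(3) unfolding reidemeister_1_def local_replacement_def by blast
  obtain c :: real where c: "0 < c" "c < 1" "\<forall>x\<in>{- 1..1}. (1 - x\<^sup>2)\<^sup>2 = 1 / 2 \<longleftrightarrow> x \<in> {- c, c}"
    by (rule R1_R2_parameter)
  interpret A: picture K 1 R1_before \<phi> p q
    by unfold_locales (use K disj chart pic in \<open>auto simp: R1_before_def square_def\<close>)
  interpret B: picture K' 1 R1_after \<phi> p q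
  proof unfold_locales
    fix i x assume "x \<in> {- 1..1::real}"
    note b = one_minus_square_bounds[OF this]
    have "\<bar>x\<bar> * \<bar>1 - 2 * (1 - x\<^sup>2)\<^sup>2\<bar> \<le> 1" 
    proof (rule mult_le_one)
      show "\<bar>1 - 2 * (1 - x\<^sup>2)\<^sup>2\<bar> \<le> 1" using b by linarith
    qed (use \<open>x \<in> {- 1..1}\<close> in auto)
    then show "R1_after i x \<in> square" using b by (intro in_squareI) (simp_all add: R1_after_def abs_mult)
  qed (use K' disj chart pic in auto)
  interpret B: two_passages_picture K' 1 R1_after \<phi> p q "\<lambda>_. - c" "\<lambda>_. c"
  proof unfold_locales
    fix i j :: nat and x y :: real
    assume *: "i < 1" "x \<in> {- 1..1}" "j < 1" "y \<in> {- 1..1}" "(i, x) \<noteq> (j, y)" "R1_after i x = R1_after j y"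
    then have "(1 - x\<^sup>2)\<^sup>2 = 1 / 2" using R1_after_double(2)[of x y i j] by simp
    then show "x \<in> {- c, c}" using c(3) * by simp
  next
    fix i :: nat and x assume i: "i < 1" and x: "x \<in> {- c, c}"
    have x1: "x \<in> {- 1..1}" "- x \<in> {- 1..1}" "x \<noteq> 0" using x c by auto
    have "R1_after 0 x = R1_after 0 (- x)" using R1_after_double_point c(3) x x1 by blast
    then have "crossing_pair (curve K') (B.\<tau> 0 x) (B.\<tau> 0 (- x))"
      using B.crossing_pair_strand[of 0 0 x "- x"] x1 by auto
    moreover have "B.\<tau> 0 x \<in> closed_segment (p 0) (q 0)" "B.\<tau> 0 (- x) \<in> closed_segment (p 0) (q 0)"
      using x1 unfolding closed_segment_strand_time by blast+
    ultimately show "B.\<tau> i x \<in> B.passages" using cl i by auto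
  qed (use c in auto)
  have empty: "A.passages \<inter> strand_times 1 p q = {}" "classical_crossings K \<inter> \<phi> ` square = {}"
    by (rule A.no_passages_if_inj; simp add: R1_before_def)+
  obtain P where P: "parity_function B.passages P" using B.parity_exists by blast
  have "weight K' z = 0" if z: "z \<in> classical_crossings K'" "z \<in> \<phi> ` square" for z
  proof -
    obtain i x j y where *: "i < 1" "x \<in> {- c, c}" "j < 1" "y \<in> {- c, c}" "B.\<tau> i x \<in> overs K'"
      "B.\<tau> j y \<in> unders K'" "z = \<phi> (R1_after i x)" "R1_after i x = R1_after j y"
      using B.crossing_in_picture[OF z] by metis
    have ij: "i = 0" "j = 0" using * by auto
    have "x \<noteq> y" using * ij B.overs_unders_disjoint by auto
    \<comment> \<open>The parameters are -c and c, the two passages on the only strand; exactly one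
      of them shares the parity at entry.\<close>
    then have "P (B.\<tau> 0 x) \<noteq> P (B.\<tau> 0 y)"
      using * B.parity_at_passage[OF P, of 0] by auto
    moreover have "x \<in> {- 1..1}" "y \<in> {- 1..1}" using * c by auto
    ultimately have "z \<notin> Odd K'" using B.Odd_strand[OF P, of i x j y] * ij by auto
    then show ?thesis by (simp add: weight_def)
  qed
  then have "(\<Sum>z\<in>classical_crossings K' \<inter> \<phi> ` square. weight K' z) = 0" by (intro sum.neutral) auto
  then show ?thesis
    using J_local_replacement[OF K K' chart pic agree even_in_strands_empty[OF empty(1)] B.even_in_strands] empty(2)
    by simp
qed

section \<open>The second Reidemeister move\<close>

lemma has_vector_derivative_Complex:
  assumes "(f has_real_derivative f') (at x)" "(g has_real_derivative g') (at x)"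
  shows "((\<lambda>x. Complex (f x) (g x)) has_vector_derivative Complex f' g') (at x)"
proof -
  have "((\<lambda>x. f x *\<^sub>R 1 + g x *\<^sub>R \<i>) has_vector_derivative f' *\<^sub>R 1 + g' *\<^sub>R \<i>) (at x)"
    using has_vector_derivative_scaleR[OF assms(1) has_vector_derivative_const[of "1::complex"]]
      has_vector_derivative_scaleR[OF assms(2) has_vector_derivative_const[of "\<i>"]]
    by (intro has_vector_derivative_add) simp_all
  moreover have "Complex u v = u *\<^sub>R 1 + v *\<^sub>R \<i>" for u v by (simp add: complex_eq_iff)
  ultimately show ?thesis by simp
qed

lemma R2_after_double:
  assumes "i < 2" "j < 2" "(i, x) \<noteq> (j, y)" "R2_after i x = R2_after j y"
  shows "(1 - x\<^sup>2)\<^sup>2 = 1 / 2"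
proof -
  have "x = y" using arg_cong[OF assms(4), of Re] by (simp add: R2_after_def split: if_splits)
  moreover from this have "i = 0 \<and> j = 1 \<or> i = 1 \<and> j = 0" using assms(1-3) by auto
  ultimately show ?thesis using assms(4) by (auto simp: R2_after_def)
qed

lemma R2_after_double_point:
  assumes "(1 - x\<^sup>2)\<^sup>2 = 1 / 2"
  shows "R2_after i x = R2_after j x"
  using assms by (simp add: R2_after_def)

lemma R2_after_derivative:
  "(R2_after i has_vector_derivative Complex 1 (if i = 0 then 4 * x * (1 - x\<^sup>2) else 0)) (at x)"
proof -
  have "((\<lambda>x. Complex x (if i = 0 then 1 / 2 - (1 - x\<^sup>2)\<^sup>2 else 0)) has_vector_derivative
      Complex 1 (if i = 0 then 4 * x * (1 - x\<^sup>2) else 0)) (at x)"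
    by (rule has_vector_derivative_Complex)
       (cases "i = 0"; auto intro!: derivative_eq_intros simp: algebra_simps)+
  moreover have "R2_after i = (\<lambda>x. Complex x (if i = 0 then 1 / 2 - (1 - x\<^sup>2)\<^sup>2 else 0))"
    by (auto simp: R2_after_def)
  ultimately show ?thesis by simp
qed

lemma J_reidemeister_2:
  assumes K: "virtual_knot_diagram K" and K': "virtual_knot_diagram K'" and "reidemeister_2 K K'"
  shows "J K = J K'"
proof -
  obtain p q \<phi> h where disj: "strands_disjoint 2 p q" and chart: "chart \<phi>"
    and pic: "contains_picture 2 R2_before \<phi> p q K" "contains_picture 2 R2_after \<phi> p q K'"
    and agree: "agree_off (strand_times 2 p q) K K'"
    and h: "inj_on h {..<2::nat}" "layered 2 h p q K'"
    using assms(3) unfolding reidemeister_2_def local_replacement_def by blast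
  obtain c :: real where c: "0 < c" "c < 1" "\<forall>x\<in>{- 1..1}. (1 - x\<^sup>2)\<^sup>2 = 1 / 2 \<longleftrightarrow> x \<in> {- c, c}"
    by (rule R1_R2_parameter)
  have c': "x \<in> {- 1..1}" "x \<in> {- 1<..<1}" "(1 - x\<^sup>2)\<^sup>2 = 1 / 2" if "x \<in> {- c, c}" for x
    using that c by auto
  interpret A: picture K 2 R2_before \<phi> p q
    by unfold_locales (use K disj chart pic in \<open>auto simp: R2_before_def square_def\<close>)
  interpret B: picture K' 2 R2_after \<phi> p q
  proof unfold_locales
    fix i x assume x: "x \<in> {- 1..1::real}"
    have "\<bar>1 / 2 - (1 - x\<^sup>2)\<^sup>2\<bar> \<le> 1" using one_minus_square_bounds[OF x] by linarith
    then show "R2_after i x \<in> square" using x by (intro in_squareI) (auto simp: R2_after_def)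
  qed (use K' disj chart pic in auto)
  have "h 0 \<noteq> h 1" using inj_onD[OF h(1), of 0 1] by auto
  \<comment> \<open>The strands are renamed by height, since either of them may be the upper
    one.\<close>
  have "\<exists>ov<2. \<exists>un<2. ov \<noteq> un \<and> h un < h ov"
  proof (cases "h 0 < h 1")
    case True
    then show ?thesis by (intro exI[of _ 1] conjI exI[of _ 0]) auto
  next
    case False
    then show ?thesis using \<open>h 0 \<noteq> h 1\<close> by (intro exI[of _ 0] conjI exI[of _ 1]) auto
  qed
  then obtain ov un where ou: "ov < 2" "un < 2" "ov \<noteq> un" "h un < h ov" by blast
  have two: "i = ov \<or> i = un" if "i < 2" for i using that ou by (auto simp: less_2_cases_iff)
  have times: "B.\<tau> ov x \<in> overs K'" "B.\<tau> un x \<in> unders K'" if "x \<in> {- c, c}" for x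
    using layered_strands[OF B.picture_axioms h(2) ou(1,2) c'(1)[OF that] c'(1)[OF that] ou(4)]
      R2_after_double_point[OF c'(3)[OF that]] by blast+
  interpret B: two_passages_picture K' 2 R2_after \<phi> p q "\<lambda>_. - c" "\<lambda>_. c"
  proof unfold_locales
    fix i j :: nat and x y :: real
    assume *: "i < 2" "x \<in> {- 1..1}" "j < 2" "y \<in> {- 1..1}" "(i, x) \<noteq> (j, y)" "R2_after i x = R2_after j y"
    then show "x \<in> {- c, c}" using R2_after_double[OF *(1,3,5,6)] c(3) by blast
  next
    fix i :: nat and x assume "i < 2" "x \<in> {- c, c}"
    then show "B.\<tau> i x \<in> B.passages" using two times by blast
  qed (use c in auto)
  have empty: "A.passages \<inter> strand_times 2 p q = {}" "classical_crossings K \<inter> \<phi> ` square = {}"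
    by (rule A.no_passages_if_inj; auto simp: R2_before_def less_2_cases_iff)+
  have crossings: "classical_crossings K' \<inter> \<phi> ` square = {\<phi> (R2_after ov (- c)), \<phi> (R2_after ov c)}"
  proof
    show "classical_crossings K' \<inter> \<phi> ` square \<subseteq> {\<phi> (R2_after ov (- c)), \<phi> (R2_after ov c)}"
    proof
      fix z assume "z \<in> classical_crossings K' \<inter> \<phi> ` square"
      then obtain i x where *: "i < 2" "x \<in> {- c, c}" "z = \<phi> (R2_after i x)"
        using B.crossing_in_picture[of z] by (metis IntD1 IntD2)
      then have "z = \<phi> (R2_after ov x)" using R2_after_double_point[OF c'(3), of x i ov] by simp
      then show "z \<in> {\<phi> (R2_after ov (- c)), \<phi> (R2_after ov c)}" using * by blast
    qed
    have "\<phi> (R2_after ov x) \<in> classical_crossings K' \<inter> \<phi> ` square" if x: "x \<in> {- c, c}" for x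
    proof -
      have "\<phi> (R2_after ov x) = curve K' (B.\<tau> ov x)" using B.curve_strand[OF ou(1) c'(1)[OF x]] by simp
      then show ?thesis using times(1)[OF x] B.in_square[OF ou(1) c'(1)[OF x]]
        unfolding classical_crossings_def by blast
    qed
    then show "{\<phi> (R2_after ov (- c)), \<phi> (R2_after ov c)} \<subseteq> classical_crossings K' \<inter> \<phi> ` square" by blast
  qed
  have ne: "\<phi> (R2_after ov (- c)) \<noteq> \<phi> (R2_after ov c)"
  proof
    assume "\<phi> (R2_after ov (- c)) = \<phi> (R2_after ov c)"
    then have "R2_after ov (- c) = R2_after ov c"
      using chart_inj[OF chart] B.in_square[OF ou(1)] c'(1) by (auto dest: inj_onD)
    then show False using c(1) by (simp add: R2_after_def split: if_splits)
  qed
  obtain P where P: "parity_function B.passages P" using B.parity_exists by blast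
  define E where "E = (q ov - p ov) * (q un - p un)"
  have E: "E \<noteq> 0" using B.pq[OF ou(1)] B.pq[OF ou(2)] by (simp add: E_def)
  define m where "m i x = Complex 1 (if i = 0 then 4 * x * (1 - x\<^sup>2) else 0)" for i :: nat and x :: real
  define w where "w = wedge (m ov c) (m un c)"
  \<comment> \<open>Strand 1 is horizontal and the slope of strand 0 is odd in the parameter, so the
    wedge is negated between c and -c: the crossings have opposite signs.\<close>
  have w: "wedge (m ov (- c)) (m un (- c)) = - w" by (auto simp: w_def m_def wedge_def)
  have "c\<^sup>2 \<noteq> 1" using c by (auto simp: power2_eq_1_iff)
  then have "w \<noteq> 0" using ou c(1) by (auto simp: w_def m_def wedge_def less_2_cases_iff)
  have der: "(R2_after i has_vector_derivative m i x) (at x)" for i x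
    using R2_after_derivative unfolding m_def .
  have sign: "crossing_sign K' (\<phi> (R2_after ov x)) = (if E * wedge (m ov x) (m un x) > 0 then 1 else - 1)"
    and odd: "\<phi> (R2_after ov x) \<in> Odd K' \<longleftrightarrow> P (B.\<tau> ov x) = P (B.\<tau> un x)" if x: "x \<in> {- c, c}" for x
  proof -
    note eq = R2_after_double_point[OF c'(3)[OF x], of ov un]
    show "crossing_sign K' (\<phi> (R2_after ov x)) = (if E * wedge (m ov x) (m un x) > 0 then 1 else - 1)"
      using B.crossing_sign_strand[OF ou(1) c'(2)[OF x] der ou(2) c'(2)[OF x] der eq times[OF x]]
      unfolding E_def .
    show "\<phi> (R2_after ov x) \<in> Odd K' \<longleftrightarrow> P (B.\<tau> ov x) = P (B.\<tau> un x)"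
      by (rule B.Odd_strand[OF P ou(1) c'(1)[OF x] ou(2) c'(1)[OF x] eq times[OF x]])
  qed
  \<comment> \<open>Going from -c to c negates the parity on both strands, whatever their
    directions, so equality of the two parities is kept.\<close>
  have "\<phi> (R2_after ov (- c)) \<in> Odd K' \<longleftrightarrow> \<phi> (R2_after ov c) \<in> Odd K'"
    using odd[of c] odd[of "- c"] B.parity_at_passage[OF P ou(1)] B.parity_at_passage[OF P ou(2)] by auto
  moreover have "crossing_sign K' (\<phi> (R2_after ov (- c))) = - crossing_sign K' (\<phi> (R2_after ov c))"
  proof -
    have "E * w \<noteq> 0" using E \<open>w \<noteq> 0\<close> by simp
    then show ?thesis using sign[of c] sign[of "- c"] w unfolding w_def[symmetric] by simp
  qed
  ultimately have "weight K' (\<phi> (R2_after ov (- c))) + weight K' (\<phi> (R2_after ov c)) = 0"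
    by (simp add: weight_def)
  then have "(\<Sum>z\<in>classical_crossings K' \<inter> \<phi> ` square. weight K' z) = 0"
    unfolding crossings using ne by simp
  then show ?thesis
    using J_local_replacement[OF K K' chart pic agree even_in_strands_empty[OF empty(1)] B.even_in_strands] empty(2)
    by simp
qed

section \<open>The third Reidemeister move\<close>

definition R3_position :: "real \<Rightarrow> nat \<Rightarrow> nat \<Rightarrow> real" where
  "R3_position c i j = (if i + j = 1 then 0 else if i + j = 2 then c else - c)"

definition R3_slope :: "real \<Rightarrow> nat \<Rightarrow> real \<Rightarrow> real" where
  "R3_slope k i x = (if i = 0 then 1 / 2 else if i = 1 then - 1 / 2 else - (4 * k * x * (1 - x\<^sup>2)))"

text \<open>Strands 0 and 1 meet at 0, strands 0 and 2 at c, strands 1 and 2 at -c;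
  \<open>R3_position\<close> reads this off the index sum. So strand 0 carries the parameters 0, c,
  strand 1 carries -c, 0 and strand 2 carries -c, c. The smaller one is given here, the larger one
  by the next definition.\<close>

definition R3_first :: "real \<Rightarrow> nat \<Rightarrow> real" where
  "R3_first c i = (if i = 0 then 0 else - c)"

definition R3_second :: "real \<Rightarrow> nat \<Rightarrow> real" where
  "R3_second c i = (if i = 1 then 0 else c)"

lemma less_3_cases: "i < 3 \<Longrightarrow> i = 0 \<or> i = 1 \<or> i = (2::nat)"
  by auto

text \<open>A half-turn interchanges the pictures before and after the move and reverses every
  strand. Hence both are treated together by means of a sign, and the two passages on each strand
  change their order.\<close>

lemma R3_picture_rotated: "R3_picture (- k) i (- x) = - R3_picture k i x"
  by (simp add: R3_picture_def complex_eq_iff)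

lemma R3_picture_derivative:
  "(R3_picture k i has_vector_derivative Complex 1 (R3_slope k i x)) (at x)"
proof -
  let ?f = "\<lambda>x. if i = 0 then x / 2 else if i = 1 then - x / 2 else k * (1 - x\<^sup>2)\<^sup>2"
  have "((\<lambda>x. Complex x (?f x)) has_vector_derivative Complex 1 (R3_slope k i x)) (at x)"
    unfolding R3_slope_def
    by (rule has_vector_derivative_Complex)
       (cases "i = 0"; cases "i = 1"; auto intro!: derivative_eq_intros simp: algebra_simps)+
  moreover have "R3_picture k i = (\<lambda>x. Complex x (?f x))" by (auto simp: R3_picture_def)
  ultimately show ?thesis by simp
qed

lemma R3_picture_meet:
  assumes c: "\<forall>x\<in>{- 1..1}. 2 * x = (1 - x\<^sup>2)\<^sup>2 \<longleftrightarrow> x = c"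
    and ij: "i < 3" "j < 3" "i \<noteq> j" and x: "x \<in> {- 1..1}"
  shows "R3_picture (1 / 4) i x = R3_picture (1 / 4) j x \<longleftrightarrow> x = R3_position c i j"
proof -
  have 1: "x / 2 = (1 - x\<^sup>2)\<^sup>2 / 4 \<longleftrightarrow> x = c"
  proof -
    have "x / 2 = (1 - x\<^sup>2)\<^sup>2 / 4 \<longleftrightarrow> 2 * x = (1 - x\<^sup>2)\<^sup>2" by linarith
    then show ?thesis using c x by blast
  qed
  have 2: "- x / 2 = (1 - x\<^sup>2)\<^sup>2 / 4 \<longleftrightarrow> x = - c"
  proof -
    have "- x / 2 = (1 - x\<^sup>2)\<^sup>2 / 4 \<longleftrightarrow> 2 * (- x) = (1 - (- x)\<^sup>2)\<^sup>2" by simp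
    moreover have "- x \<in> {- 1..1}" using x by auto
    ultimately show ?thesis using c by (metis minus_minus)
  qed
  have 3: "x / 2 = - x / 2 \<longleftrightarrow> x = 0" by auto
  have 4: "(1 - x\<^sup>2)\<^sup>2 / 4 = x / 2 \<longleftrightarrow> x = c" using 1 by (simp only: eq_commute[of "_ / 4"])
  have 5: "(1 - x\<^sup>2)\<^sup>2 / 4 = - x / 2 \<longleftrightarrow> x = - c" using 2 by (simp only: eq_commute[of "_ / 4"])
  have "i = 0 \<and> j = 1 \<or> i = 1 \<and> j = 0 \<or> i = 0 \<and> j = 2 \<or> i = 2 \<and> j = 0 \<or> i = 1 \<and> j = 2 \<or> i = 2 \<and> j = 1"
    using ij less_3_cases by blast
  then show ?thesis
    using 1 2 3 4 5 by (elim disjE) (simp_all add: R3_picture_def R3_position_def)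
qed

lemma R3_picture_meet_sign:
  assumes c: "\<forall>x\<in>{- 1..1}. 2 * x = (1 - x\<^sup>2)\<^sup>2 \<longleftrightarrow> x = c" and s: "s = 1 \<or> s = - 1"
    and ij: "i < 3" "j < 3" "i \<noteq> j" and x: "x \<in> {- 1..1}"
  shows "R3_picture (s / 4) i x = R3_picture (s / 4) j x \<longleftrightarrow> x = s * R3_position c i j"
  using s
proof
  assume "s = 1"
  then show ?thesis using R3_picture_meet[OF c ij x] by simp
next
  assume s: "s = - 1"
  have x': "- x \<in> {- 1..1}" using x by auto
  have "R3_picture (s / 4) i x = - R3_picture (1 / 4) i (- x)" for i
    using R3_picture_rotated[of "1 / 4" i "- x"] s by simp
  then have "R3_picture (s / 4) i x = R3_picture (s / 4) j x \<longleftrightarrow> - x = R3_position c i j"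
    using R3_picture_meet[OF c ij x'] by simp
  then show ?thesis using s by auto
qed

lemma R3_double:
  assumes c: "\<forall>x\<in>{- 1..1}. 2 * x = (1 - x\<^sup>2)\<^sup>2 \<longleftrightarrow> x = c" and s: "s = 1 \<or> s = - 1"
    and ij: "i < 3" "j < 3" and x: "x \<in> {- 1..1}"
    and "(i, x) \<noteq> (j, y)" "R3_picture (s / 4) i x = R3_picture (s / 4) j y"
  shows "i \<noteq> j" "x = y" "x = s * R3_position c i j"
proof -
  show "x = y" using arg_cong[OF assms(7), of Re] by (simp add: R3_picture_def split: if_splits)
  then show "i \<noteq> j" using assms(6) by simp
  then show "x = s * R3_position c i j"
    using R3_picture_meet_sign[OF c s ij _ x] assms(7) \<open>x = y\<close> by blast
qed

lemma R3_position_cases: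
  assumes "i < 3" "j < 3" "i \<noteq> j"
  shows "R3_position c i j \<in> {R3_first c i, R3_second c i}"
  using less_3_cases[OF assms(1)] less_3_cases[OF assms(2)] assms(3)
  by (elim disjE) (simp_all add: R3_position_def R3_first_def R3_second_def)

lemma R3_position_exists:
  assumes "i < 3" "x \<in> {R3_first c i, R3_second c i}"
  obtains j where "j < 3" "j \<noteq> i" "x = R3_position c i j"
proof -
  have "\<exists>j<3. j \<noteq> i \<and> x = R3_position c i j"
    using less_3_cases[OF assms(1)] assms(2)
    by (elim disjE) (auto simp: R3_position_def R3_first_def R3_second_def numeral_eq_Suc less_Suc_eq)
  then show thesis using that by blast
qed

lemma R3_picture_in_square:
  assumes "s = 1 \<or> s = - 1" "x \<in> {- 1..1}"
  shows "R3_picture (s / 4) i x \<in> square"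
proof -
  have "\<bar>s / 4 * (1 - x\<^sup>2)\<^sup>2\<bar> \<le> 1" using one_minus_square_bounds[OF assms(2)] assms(1) by (elim disjE) simp_all
  then show ?thesis using assms(2) by (intro in_squareI) (auto simp: R3_picture_def)
qed

lemma R3_position_commute: "R3_position c i j = R3_position c j i"
  by (simp add: R3_position_def add.commute)

lemma R3_position_range:
  "0 < c \<Longrightarrow> c < 1 \<Longrightarrow> s = 1 \<or> s = - 1 \<Longrightarrow> s * R3_position c i j \<in> {- 1<..<1}"
  by (auto simp: R3_position_def)

text \<open>Multiplication by s = -1 reverses the order of the parameters, hence the exchange of
  first and second in that case.\<close>

lemma R3_two_passages:
  assumes "picture K 3 (R3_picture (s / 4)) \<phi> p q"
    and lay: "layered 3 h p q K" and h: "inj_on h {..<3::nat}" and s: "s = 1 \<or> s = - 1"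
    and c: "0 < c" "c < 1" "\<forall>x\<in>{- 1..1}. 2 * x = (1 - x\<^sup>2)\<^sup>2 \<longleftrightarrow> x = c"
  shows "two_passages_picture K 3 (R3_picture (s / 4)) \<phi> p q
    (\<lambda>i. if s = 1 then R3_first c i else - R3_second c i)
    (\<lambda>i. if s = 1 then R3_second c i else - R3_first c i)"
proof -
  interpret picture K 3 "R3_picture (s / 4)" \<phi> p q by (rule assms(1))
  have set: "{if s = 1 then R3_first c i else - R3_second c i, if s = 1 then R3_second c i else - R3_first c i}
      = (\<lambda>x. s * x) ` {R3_first c i, R3_second c i}" for i
    using s by auto
  show ?thesis
  proof unfold_locales
    fix i :: nat assume "i < 3"
    then show "- 1 < (if s = 1 then R3_first c i else - R3_second c i) \<and>
        (if s = 1 then R3_first c i else - R3_second c i) < (if s = 1 then R3_second c i else - R3_first c i) \<and>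
        (if s = 1 then R3_second c i else - R3_first c i) < 1"
      using c by (auto simp: R3_first_def R3_second_def)
  next
    fix i j :: nat and x y :: real
    assume *: "i < 3" "x \<in> {- 1..1}" "j < 3" "y \<in> {- 1..1}" "(i, x) \<noteq> (j, y)"
      "R3_picture (s / 4) i x = R3_picture (s / 4) j y"
    note d = R3_double[OF c(3) s *(1,3,2,5,6)]
    show "x \<in> {if s = 1 then R3_first c i else - R3_second c i, if s = 1 then R3_second c i else - R3_first c i}"
      unfolding set using R3_position_cases[OF *(1,3) d(1)] d(3) by blast
  next
    fix i :: nat and x assume i: "i < 3"
      and "x \<in> {if s = 1 then R3_first c i else - R3_second c i, if s = 1 then R3_second c i else - R3_first c i}"
    then obtain y where y: "y \<in> {R3_first c i, R3_second c i}" "x = s * y" unfolding set by blast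
    obtain j where j: "j < 3" "j \<noteq> i" "y = R3_position c i j" using R3_position_exists[OF i y(1)] .
    have x1: "x \<in> {- 1..1}" using R3_position_range[OF c(1,2) s, of i j] y j by auto
    have eq: "R3_picture (s / 4) i x = R3_picture (s / 4) j x"
      using R3_picture_meet_sign[OF c(3) s i j(1) j(2)[symmetric] x1] y(2) j(3) by simp
    have "h i \<noteq> h j" using h i j by (auto simp: inj_on_def)
    then consider "h j < h i" | "h i < h j" by linarith
    then show "\<tau> i x \<in> passages"
    proof cases
      case 1
      then show ?thesis using layered_strands(1)[OF assms(1) lay i j(1) x1 x1 1 eq] by blast
    next
      case 2
      then show ?thesis using layered_strands(2)[OF assms(1) lay j(1) i x1 x1 2 eq[symmetric]] by blast
    qed
  qed
qed

text \<open>The three crossings correspond to the unordered pairs of strands; each point is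
  evaluated on the strand of smaller index, whether or not that is the upper one.\<close>

lemma R3_crossing_sum:
  assumes pic: "picture K 3 (R3_picture (s / 4)) \<phi> p q"
    and lay: "layered 3 h p q K" and h: "inj_on h {..<3::nat}" and s: "s = 1 \<or> s = - 1"
    and c: "0 < c" "c < 1" "\<forall>x\<in>{- 1..1}. 2 * x = (1 - x\<^sup>2)\<^sup>2 \<longleftrightarrow> x = c"
  shows "(\<Sum>z\<in>classical_crossings K \<inter> \<phi> ` square. weight K z)
    = (\<Sum>(i, j)\<in>{(0, 1), (0, 2), (1, 2)}. weight K (\<phi> (R3_picture (s / 4) i (s * R3_position c i j))))"
proof -
  let ?I = "{(0, 1), (0, 2), (1, 2)} :: (nat \<times> nat) set"
  let ?M = "R3_picture (s / 4)"
  define f where "f = (\<lambda>(i, j). \<phi> (?M i (s * R3_position c i j)))"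
  interpret two_passages_picture K 3 ?M \<phi> p q
    "\<lambda>i. if s = 1 then R3_first c i else - R3_second c i"
    "\<lambda>i. if s = 1 then R3_second c i else - R3_first c i"
    by (rule R3_two_passages[OF pic lay h s c])
  have range: "s * R3_position c i j \<in> {- 1..1}" for i j
    using R3_position_range[OF c(1,2) s, of i j] by auto
  have meet: "?M i (s * R3_position c i j) = ?M j (s * R3_position c i j)" if "i < 3" "j < 3" "i \<noteq> j" for i j
    using R3_picture_meet_sign[OF c(3) s that range] by blast
  have inj: "inj_on f ?I"
  proof (rule inj_onI)
    fix a b assume ab: "a \<in> ?I" "b \<in> ?I" "f a = f b"
    obtain i j k l where eq: "a = (i, j)" "b = (k, l)" by (metis surj_pair)
    have "i < 3" "k < 3" using ab(1,2) eq by auto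
    then have "?M i (s * R3_position c i j) = ?M k (s * R3_position c k l)"
      using ab(3) eq chart_inj[OF chart] in_square[OF _ range] unfolding f_def by (auto dest: inj_onD)
    from arg_cong[OF this, of Re] have "s * R3_position c i j = s * R3_position c k l"
      by (simp add: R3_picture_def split: if_splits)
    then have "R3_position c i j = R3_position c k l" using s by auto
    then show "a = b" using ab(1,2) eq c(1) by (auto simp: R3_position_def)
  qed
  have "classical_crossings K \<inter> \<phi> ` square = f ` ?I"
  proof
    show "classical_crossings K \<inter> \<phi> ` square \<subseteq> f ` ?I"
    proof
      fix z assume "z \<in> classical_crossings K \<inter> \<phi> ` square"
      then have z: "z \<in> classical_crossings K" "z \<in> \<phi> ` square" by auto
      obtain i x j y where *: "i < 3" "j < 3" "\<tau> i x \<in> overs K" "\<tau> j y \<in> unders K" "z = \<phi> (?M i x)" "?M i x = ?M j y"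
        "x \<in> {- 1..1}"
        using crossing_in_picture[OF z] ab_range(2) by metis
      have "(i, x) \<noteq> (j, y)" using *(3,4) overs_unders_disjoint by auto
      note d = R3_double[OF c(3) s *(1,2,7) this *(6)]
      have zij: "z = f (i, j)" using *(5) d(3) by (simp add: f_def)
      have "f (i, j) = f (j, i)"
        using meet[OF *(1,2) d(1)] R3_position_commute[of c i j] by (simp add: f_def)
      moreover have "(i, j) \<in> ?I \<or> (j, i) \<in> ?I"
        using less_3_cases[OF *(1)] less_3_cases[OF *(2)] d(1) by auto
      ultimately show "z \<in> f ` ?I" using zij by (metis imageI)
    qed
    show "f ` ?I \<subseteq> classical_crossings K \<inter> \<phi> ` square"
    proof
      fix z assume "z \<in> f ` ?I"
      then obtain i j where ij: "(i, j) \<in> ?I" "z = f (i, j)" by auto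
      then have lt: "i < 3" "j < 3" "i \<noteq> j" by auto
      let ?x = "s * R3_position c i j"
      have "h i \<noteq> h j" using h lt by (auto simp: inj_on_def)
      then consider "h j < h i" | "h i < h j" by linarith
      then have "\<exists>k<3. \<tau> k ?x \<in> overs K \<and> z = \<phi> (?M k ?x)"
      proof cases
        case 1
        then show ?thesis
          using layered_strands(1)[OF pic lay lt(1,2) range range 1 meet[OF lt]] lt ij(2) by (auto simp: f_def)
      next
        case 2
        then show ?thesis
          using layered_strands(1)[OF pic lay lt(2,1) range range 2 meet[OF lt, symmetric]] lt ij(2) meet[OF lt]
          by (auto simp: f_def)
      qed
      then obtain k where k: "k < 3" "\<tau> k ?x \<in> overs K" "z = \<phi> (?M k ?x)" by blast
      then have "z = curve K (\<tau> k ?x)" using curve_strand[OF k(1) range] by simp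
      then show "z \<in> classical_crossings K \<inter> \<phi> ` square"
        using k in_square[OF k(1) range] unfolding classical_crossings_def by blast
    qed
  qed
  then show ?thesis by (simp only: sum.reindex[OF inj] comp_def) (simp add: f_def)
qed

lemma J_reidemeister_3:
  assumes K: "virtual_knot_diagram K" and K': "virtual_knot_diagram K'" and "reidemeister_3 K K'"
  shows "J K = J K'"
proof -
  obtain p q \<phi> h where disj: "strands_disjoint 3 p q" and chart: "chart \<phi>"
    and pics: "contains_picture 3 (R3_picture (1 / 4)) \<phi> p q K" "contains_picture 3 (R3_picture (- 1 / 4)) \<phi> p q K'"
    and agree: "agree_off (strand_times 3 p q) K K'"
    and h: "inj_on h {..<3::nat}" and lay: "layered 3 h p q K" "layered 3 h p q K'"
    using assms(3) unfolding reidemeister_3_def local_replacement_def by blast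
  obtain c :: real where c: "0 < c" "c < 1" "\<forall>x\<in>{- 1..1}. 2 * x = (1 - x\<^sup>2)\<^sup>2 \<longleftrightarrow> x = c"
    by (rule R3_parameter)
  have pic: "picture K 3 (R3_picture (1 / 4)) \<phi> p q"
    by unfold_locales (use K disj chart pics R3_picture_in_square[of 1] in auto)
  have pic': "picture K' 3 (R3_picture (- 1 / 4)) \<phi> p q"
    by unfold_locales (use K' disj chart pics R3_picture_in_square[of "- 1"] in auto)
  interpret A: two_passages_picture K 3 "R3_picture (1 / 4)" \<phi> p q "R3_first c" "R3_second c"
    using R3_two_passages[OF pic lay(1) h _ c] by simp
  interpret B: two_passages_picture K' 3 "R3_picture (- 1 / 4)" \<phi> p q "\<lambda>i. - R3_second c i" "\<lambda>i. - R3_first c i"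
    using R3_two_passages[OF pic' lay(2) h _ c] by simp
  obtain P P' where P: "parity_function A.passages P" and P': "parity_function B.passages P'"
    using A.parity_exists B.parity_exists by blast
  have off: "A.passages - strand_times 3 p q = B.passages - strand_times 3 p q"
    using agree unfolding agree_off_def by blast
  have rot: "R3_picture (- 1 / 4) i (- x) = - R3_picture (1 / 4) i x" for i x
    using R3_picture_rotated[of "1 / 4" i x] by simp
  \<comment> \<open>The crossing of two strands at \<open>x\<close> is matched with the crossing of
    the same strands at \<open>- x\<close> after the move.\<close>
  have weights: "weight K (\<phi> (R3_picture (1 / 4) i x)) = weight K' (\<phi> (R3_picture (- 1 / 4) i (- x)))"
    if ij: "i < 3" "j < 3" "h j < h i" and x: "x = R3_position c i j" for i j x
  proof -
    have ne: "i \<noteq> j" using ij by auto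
    have x1: "x \<in> {- 1<..<1}" "- x \<in> {- 1<..<1}" "x \<in> {- 1..1}" "- x \<in> {- 1..1}"
      using R3_position_range[OF c(1,2), of 1 i j] x by auto
    have meet: "R3_picture (1 / 4) i x = R3_picture (1 / 4) j x"
      using R3_picture_meet[OF c(3) ij(1,2) ne x1(3)] x by simp
    then have meet': "R3_picture (- 1 / 4) i (- x) = R3_picture (- 1 / 4) j (- x)" by (simp only: rot)
    note ou = layered_strands[OF pic lay(1) ij(1,2) x1(3) x1(3) ij(3) meet]
    note ou' = layered_strands[OF pic' lay(2) ij(1,2) x1(4) x1(4) ij(3) meet']
    \<comment> \<open>The half-turn keeps tangent directions at matched points, so the signs
      agree.\<close>
    have slope: "R3_slope (- 1 / 4) k (- x) = R3_slope (1 / 4) k x" for k by (simp add: R3_slope_def)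
    have sign: "crossing_sign K (\<phi> (R3_picture (1 / 4) i x)) = crossing_sign K' (\<phi> (R3_picture (- 1 / 4) i (- x)))"
      unfolding A.crossing_sign_strand[OF ij(1) x1(1) R3_picture_derivative ij(2) x1(1) R3_picture_derivative meet ou]
        B.crossing_sign_strand[OF ij(1) x1(2) R3_picture_derivative ij(2) x1(2) R3_picture_derivative meet' ou']
        slope ..
    \<comment> \<open>\<open>e\<close> tells whether the passage comes first on strand
      \<open>k\<close>; after the move its place in the order is the opposite one.\<close>
    have flip: "\<exists>e. P (A.\<tau> k x) = (P (min (p k) (q k)) = e) \<and> P' (A.\<tau> k (- x)) = (P' (min (p k) (q k)) \<noteq> e)"
      if k: "k < 3" "x \<in> {R3_first c k, R3_second c k}" for k
      using k(2) A.parity_at_passage[OF P k(1)] B.parity_at_passage[OF P' k(1)] by auto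
    have "x \<in> {R3_first c i, R3_second c i}" "x \<in> {R3_first c j, R3_second c j}"
      using R3_position_cases[of i j c] R3_position_cases[of j i c] ij ne x R3_position_commute[of c i j] by auto
    note fl = flip[OF ij(1) this(1)] flip[OF ij(2) this(2)]
    obtain e where e: "P (A.\<tau> i x) = (P (min (p i) (q i)) = e)" "P' (A.\<tau> i (- x)) = (P' (min (p i) (q i)) \<noteq> e)"
      using fl(1) by (elim exE conjE) (rule that)
    obtain e' where e': "P (A.\<tau> j x) = (P (min (p j) (q j)) = e')" "P' (A.\<tau> j (- x)) = (P' (min (p j) (q j)) \<noteq> e')"
      using fl(2) by (elim exE conjE) (rule that)
    \<comment> \<open>Entry times belong to \<open>outside_times\<close>, so equality of the
      parities at entry survives the move; flipping both sides then preserves the equality at the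
      passages.\<close>
    have "(P (min (p i) (q i)) = P (min (p j) (q j))) = (P' (min (p i) (q i)) = P' (min (p j) (q j)))"
      using ij by (intro parity_transfer[OF P P' A.finite_passages B.finite_passages A.even_in_strands
            B.even_in_strands off]) (auto simp: outside_times_def)
    then have "(P (A.\<tau> i x) = P (A.\<tau> j x)) = (P' (A.\<tau> i (- x)) = P' (A.\<tau> j (- x)))" unfolding e e' by argo
    then have "\<phi> (R3_picture (1 / 4) i x) \<in> Odd K \<longleftrightarrow> \<phi> (R3_picture (- 1 / 4) i (- x)) \<in> Odd K'"
      using A.Odd_strand[OF P ij(1) x1(3) ij(2) x1(3) meet ou] B.Odd_strand[OF P' ij(1) x1(4) ij(2) x1(4) meet' ou']
      by simp
    then show ?thesis using sign by (simp add: weight_def)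
  qed
  have "weight K (\<phi> (R3_picture (1 / 4) i (R3_position c i j)))
      = weight K' (\<phi> (R3_picture (- 1 / 4) i (- R3_position c i j)))"
    if ij: "i < 3" "j < 3" "i \<noteq> j" for i j
  proof -
    have "h i \<noteq> h j" using h ij by (auto simp: inj_on_def)
    then consider "h j < h i" | "h i < h j" by linarith
    then show ?thesis
    proof cases
      case 1
      then show ?thesis using weights[OF ij(1,2) 1] by simp
    next
      case 2
      have "R3_position c i j \<in> {- 1..1}" using R3_position_range[OF c(1,2), of 1 i j] by auto
      then have meet: "R3_picture (1 / 4) i (R3_position c i j) = R3_picture (1 / 4) j (R3_position c i j)"
        using R3_picture_meet[OF c(3) ij] by blast
      have "R3_picture (- 1 / 4) i (- R3_position c i j) = R3_picture (- 1 / 4) j (- R3_position c i j)"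
        by (simp only: rot meet)
      then show ?thesis using weights[OF ij(2,1) 2 R3_position_commute] unfolding meet by (simp only:)
    qed
  qed
  then have "(\<Sum>(i, j)\<in>{(0, 1), (0, 2), (1, 2)}. weight K (\<phi> (R3_picture (1 / 4) i (1 * R3_position c i j))))
      = (\<Sum>(i, j)\<in>{(0, 1), (0, 2), (1, 2)}. weight K' (\<phi> (R3_picture (- 1 / 4) i (- 1 * R3_position c i j))))"
    by (intro sum.cong) auto
  then have "(\<Sum>z\<in>classical_crossings K \<inter> \<phi> ` square. weight K z)
      = (\<Sum>z\<in>classical_crossings K' \<inter> \<phi> ` square. weight K' z)"
    using R3_crossing_sum[OF pic lay(1) h _ c] R3_crossing_sum[OF pic' lay(2) h _ c] by simp
  then show ?thesis
    by (rule J_local_replacement[OF K K' chart pics agree A.even_in_strands B.even_in_strands])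
qed

section \<open>Winding numbers near a crossing and near a corner\<close>

text \<open>The values are integer multiples of 2 pi i, and distinct ones are at least 2 pi
  apart.\<close>

lemma exp_one_constant:
  fixes f :: "real \<Rightarrow> complex"
  assumes "connected S" "continuous_on S f" "\<And>x. x \<in> S \<Longrightarrow> exp (f x) = 1" "x \<in> S" "y \<in> S"
  shows "f x = f y"
proof -
  have "f constant_on S"
  proof (rule continuous_discrete_range_constant[OF assms(1,2)])
    fix x assume x: "x \<in> S"
    have "2 * pi \<le> norm (f y - f x)" if "y \<in> S" "f y \<noteq> f x" for y
    proof -
      have "exp (f y) = exp (f x)" using assms(3) x that by simp
      then obtain n :: int where n: "f y = f x + (of_int (2 * n) * pi) * \<i>" unfolding exp_eq by blast
      then have "n \<noteq> 0" using that by auto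
      then have "1 \<le> \<bar>real_of_int n\<bar>" by linarith
      moreover have "norm (f y - f x) = 2 * pi * \<bar>real_of_int n\<bar>"
        using n by (simp add: norm_mult)
      ultimately show ?thesis by (simp add: mult_le_cancel_left1)
    qed
    then show "\<exists>e>0. \<forall>y. y \<in> S \<and> f y \<noteq> f x \<longrightarrow> e \<le> norm (f y - f x)"
      using pi_gt_zero by (intro exI[of _ "2 * pi"]) auto
  qed
  then show ?thesis using assms(4,5) by (auto simp: constant_on_def)
qed

text \<open>Up to constants \<open>d\<close> and \<open>Ln (c * r u)\<close> are continuous
  logarithms of one function. The factor \<open>c\<close> turns the branch cut: it is used with 1 or
  -1, according to the half-line that the ratio avoids.\<close>

lemma log_branch_diff:
  fixes d r :: "real \<Rightarrow> complex"
  assumes "connected S" "continuous_on S d" "\<And>u. u \<in> S \<Longrightarrow> exp (d u) = r u" "c \<noteq> 0"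
    and "\<And>u. u \<in> S \<Longrightarrow> c * r u \<notin> \<real>\<^sub>\<le>\<^sub>0" "x \<in> S" "y \<in> S"
  shows "d x - d y = Ln (c * r x) - Ln (c * r y)"
proof -
  have cont: "continuous_on S r"
    using continuous_on_exp[OF assms(2)] assms(3) by (simp cong: continuous_on_cong)
  have nz: "r u \<noteq> 0" if "u \<in> S" for u using assms(3)[OF that] by (metis exp_not_eq_zero)
  have "d x - Ln (c * r x) + Ln c = d y - Ln (c * r y) + Ln c"
  proof (rule exp_one_constant[OF assms(1) _ _ assms(6,7)])
    show "continuous_on S (\<lambda>x. d x - Ln (c * r x) + Ln c)"
      using assms(2,5) cont by (intro continuous_intros) auto
    show "exp (d u - Ln (c * r u) + Ln c) = 1" if "u \<in> S" for u
      using assms(3)[OF that] nz[OF that] assms(4) by (simp add: exp_add exp_diff)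
  qed
  then show ?thesis by (simp add: algebra_simps)
qed

text \<open>The difference of continuous logarithms of \<open>\<alpha> u - p1\<close> and
  \<open>\<alpha> u - p2\<close>. For nearby points the ratio is easier to control than either
  factor, being close to 1 wherever \<alpha> is far from both.\<close>

lemma winding_number_diff_log:
  assumes "path \<alpha>" "p1 \<notin> path_image \<alpha>" "p2 \<notin> path_image \<alpha>"
  obtains d where "continuous_on {0..1} d"
    "\<And>u. u \<in> {0..1} \<Longrightarrow> exp (d u) = (\<alpha> u - p1) / (\<alpha> u - p2)"
    "d 1 - d 0 = 2 * of_real pi * \<i> * (winding_number \<alpha> p1 - winding_number \<alpha> p2)"
proof -
  obtain q1 where q1: "path q1" "pathfinish q1 - pathstart q1 = 2 * of_real pi * \<i> * winding_number \<alpha> p1"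
    "\<And>t. t \<in> {0..1} \<Longrightarrow> \<alpha> t = p1 + exp (q1 t)"
    using winding_number_as_continuous_log[OF assms(1,2)] by blast
  obtain q2 where q2: "path q2" "pathfinish q2 - pathstart q2 = 2 * of_real pi * \<i> * winding_number \<alpha> p2"
    "\<And>t. t \<in> {0..1} \<Longrightarrow> \<alpha> t = p2 + exp (q2 t)"
    using winding_number_as_continuous_log[OF assms(1,3)] by blast
  show thesis
  proof (rule that[of "\<lambda>u. q1 u - q2 u"])
    show "continuous_on {0..1} (\<lambda>u. q1 u - q2 u)"
      using q1(1) q2(1) unfolding path_def by (intro continuous_intros)
    fix u :: real assume u: "u \<in> {0..1}"
    have "\<alpha> u - p1 = exp (q1 u)" using q1(3)[OF u] by simp
    moreover have "\<alpha> u - p2 = exp (q2 u)" using q2(3)[OF u] by simp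
    ultimately show "exp (q1 u - q2 u) = (\<alpha> u - p1) / (\<alpha> u - p2)" by (simp add: exp_diff)
  next
    show "q1 1 - q2 1 - (q1 0 - q2 0) = 2 * of_real pi * \<i> * (winding_number \<alpha> p1 - winding_number \<alpha> p2)"
      using q1(2) q2(2) by (simp add: pathfinish_def pathstart_def algebra_simps)
  qed
qed

text \<open>The principal logarithm of the ratio is continuous along the whole closed path, so its
  total change is 0.\<close>

lemma winding_number_eq_slit:
  assumes "path \<alpha>" "pathfinish \<alpha> = pathstart \<alpha>" "p1 \<notin> path_image \<alpha>" "p2 \<notin> path_image \<alpha>"
    and slit: "\<And>u. u \<in> {0..1} \<Longrightarrow> (\<alpha> u - p1) / (\<alpha> u - p2) \<notin> \<real>\<^sub>\<le>\<^sub>0"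
  shows "winding_number \<alpha> p1 = winding_number \<alpha> p2"
proof -
  obtain d where d: "continuous_on {0..1} d"
    "\<And>u. u \<in> {0..1} \<Longrightarrow> exp (d u) = (\<alpha> u - p1) / (\<alpha> u - p2)"
    "d 1 - d 0 = 2 * of_real pi * \<i> * (winding_number \<alpha> p1 - winding_number \<alpha> p2)"
    using winding_number_diff_log[OF assms(1,3,4)] by blast
  have "d 1 - d 0 = 0"
    using log_branch_diff[OF connected_Icc d(1,2), of 1 1 0] slit assms(2)
    by (simp add: pathfinish_def pathstart_def)
  then show ?thesis using d(3) by simp
qed

lemma Ln_minus_diff:
  "Im z > 0 \<Longrightarrow> Ln (- z) - Ln z = - \<i> * pi" "Im z < 0 \<Longrightarrow> Ln (- z) - Ln z = \<i> * pi"
  by (subst Ln_minus; force)+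

text \<open>The logarithm of the ratio is followed by \<open>Ln\<close> on the outer pieces and by
  \<open>Ln\<close> of the negative on the inner one. Each change of branch contributes pi i with a
  sign given by the half-plane; opposite half-planes make the contributions add up to 2 pi i or -2
  pi i, so the difference is 1 or -1.\<close>

lemma winding_number_diff_odd:
  assumes "path \<alpha>" "pathfinish \<alpha> = pathstart \<alpha>" "p1 \<notin> path_image \<alpha>" "p2 \<notin> path_image \<alpha>"
    and u: "0 \<le> u1" "u1 \<le> u2" "u2 \<le> 1"
    and outer: "\<And>u. u \<in> {0..1} \<Longrightarrow> u \<le> u1 \<or> u2 \<le> u \<Longrightarrow> (\<alpha> u - p1) / (\<alpha> u - p2) \<notin> \<real>\<^sub>\<le>\<^sub>0"
    and inner: "\<And>u. u \<in> {u1..u2} \<Longrightarrow> - ((\<alpha> u - p1) / (\<alpha> u - p2)) \<notin> \<real>\<^sub>\<le>\<^sub>0"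
    and sides: "Im ((\<alpha> u1 - p1) / (\<alpha> u1 - p2)) * Im ((\<alpha> u2 - p1) / (\<alpha> u2 - p2)) < 0"
  shows "\<exists>k. odd k \<and> winding_number \<alpha> p1 - winding_number \<alpha> p2 = of_int k"
proof -
  define r where "r u = (\<alpha> u - p1) / (\<alpha> u - p2)" for u
  obtain d where d: "continuous_on {0..1} d" "\<And>u. u \<in> {0..1} \<Longrightarrow> exp (d u) = r u"
    "d 1 - d 0 = 2 * of_real pi * \<i> * (winding_number \<alpha> p1 - winding_number \<alpha> p2)"
    using winding_number_diff_log[OF assms(1,3,4)] unfolding r_def by blast
  have cont: "continuous_on {a..b} d" if "0 \<le> a" "b \<le> 1" for a b
    using continuous_on_subset[OF d(1)] that by auto
  have 1: "d u1 - d 0 = Ln (r u1) - Ln (r 0)"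
    using log_branch_diff[of "{0..u1}" d r 1 u1 0] cont[of 0 u1] d(2) u outer
    by (auto simp: r_def)
  have 2: "d u2 - d u1 = Ln (- r u2) - Ln (- r u1)"
    using log_branch_diff[of "{u1..u2}" d r "-1" u2 u1] cont[of u1 u2] d(2) u inner[folded r_def]
    by auto
  have 3: "d 1 - d u2 = Ln (r 1) - Ln (r u2)"
    using log_branch_diff[of "{u2..1}" d r 1 1 u2] cont[of u2 1] d(2) u outer
    by (auto simp: r_def)
  have "r 1 = r 0" using assms(2) by (simp add: r_def pathfinish_def pathstart_def)
  have "d 1 - d 0 = (Ln (- r u2) - Ln (r u2)) - (Ln (- r u1) - Ln (r u1))"
  proof -
    have "d 1 - d 0 = (d 1 - d u2) + (d u2 - d u1) + (d u1 - d 0)" by simp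
    then show ?thesis unfolding 1 2 3 \<open>r 1 = r 0\<close> by simp
  qed
  then have *: "2 * of_real pi * \<i> * (winding_number \<alpha> p1 - winding_number \<alpha> p2)
      = (Ln (- r u2) - Ln (r u2)) - (Ln (- r u1) - Ln (r u1))"
    using d(3) by simp
  consider "Im (r u1) > 0" "Im (r u2) < 0" | "Im (r u1) < 0" "Im (r u2) > 0"
    using sides unfolding r_def[symmetric] mult_less_0_iff by blast
  then show ?thesis
  proof cases
    case 1
    have "2 * of_real pi * \<i> * (winding_number \<alpha> p1 - winding_number \<alpha> p2) = 2 * of_real pi * \<i> * 1"
      unfolding * Ln_minus_diff(1)[OF 1(1)] Ln_minus_diff(2)[OF 1(2)] by (simp add: algebra_simps)
    then have "winding_number \<alpha> p1 - winding_number \<alpha> p2 = 1"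
      unfolding mult_cancel_left by simp
    then show ?thesis by (intro exI[of _ 1]) simp
  next
    case 2
    have "2 * of_real pi * \<i> * (winding_number \<alpha> p1 - winding_number \<alpha> p2) = 2 * of_real pi * \<i> * (- 1)"
      unfolding * Ln_minus_diff(2)[OF 2(1)] Ln_minus_diff(1)[OF 2(2)] by (simp add: algebra_simps)
    then have "winding_number \<alpha> p1 - winding_number \<alpha> p2 = - 1"
      unfolding mult_cancel_left by simp
    then show ?thesis by (intro exI[of _ "- 1"]) simp
  qed
qed

section \<open>First-order models of a curve near a crossing and near a corner\<close>

lemma wedge_simps:
  "wedge (u + u') v = wedge u v + wedge u' v" "wedge u (v + v') = wedge u v + wedge u v'"
  "wedge (u - u') v = wedge u v - wedge u' v" "wedge u (v - v') = wedge u v - wedge u v'"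
  "wedge (c *\<^sub>R u) v = c * wedge u v" "wedge u (c *\<^sub>R v) = c * wedge u v" "wedge u u = 0"
  by (simp_all add: wedge_def algebra_simps)

lemma wedge_commute: "wedge v u = - wedge u v"
  by (simp add: wedge_def)

lemma abs_wedge_le: "\<bar>wedge u v\<bar> \<le> norm u * norm v"
proof -
  have "wedge u v = Im (cnj u * v)" by (simp add: wedge_def)
  then show ?thesis using abs_Im_le_cmod[of "cnj u * v"] by (simp add: norm_mult)
qed

lemma Im_divide_wedge: "Im (a / b) = wedge b a / (norm b)\<^sup>2"
  by (simp add: Im_divide wedge_def cmod_power2 algebra_simps)

text \<open>The ratio lies in the open disc of radius 1 about 1, hence in the right
  half-plane.\<close>

lemma near_one_not_nonpos:
  fixes a b :: complex
  assumes "norm (a - b) < norm b"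
  shows "a \<noteq> 0" "b \<noteq> 0" "a / b \<notin> \<real>\<^sub>\<le>\<^sub>0"
proof -
  show b: "b \<noteq> 0" using assms norm_ge_zero[of "a - b"] by (metis norm_zero not_le)
  show "a \<noteq> 0" using assms by auto
  have "norm (1 - a / b) < 1"
  proof -
    have "1 - a / b = - ((a - b) / b)" using b by (simp add: field_simps)
    then have "norm (1 - a / b) = norm (a - b) / norm b" by (simp only: norm_minus_cancel norm_divide)
    then show ?thesis using assms b by (simp add: divide_less_eq)
  qed
  then have "Re (1 - a / b) < 1" using complex_Re_le_cmod le_less_trans by blast
  then show "a / b \<notin> \<real>\<^sub>\<le>\<^sub>0" by (simp add: complex_nonpos_Reals_iff)
qed

text \<open>Turns the slit condition into a linear relation with nonnegative coefficient, to which
  \<open>wedge\<close> can be applied.\<close>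

lemma ratio_nonpos_iff:
  fixes a b :: complex
  assumes "b \<noteq> 0"
  shows "a / b \<in> \<real>\<^sub>\<le>\<^sub>0 \<longleftrightarrow> (\<exists>\<rho>\<ge>0. a + \<rho> *\<^sub>R b = 0)"
proof
  assume "a / b \<in> \<real>\<^sub>\<le>\<^sub>0"
  then obtain x where "a / b = of_real x" "x \<le> 0" by (auto elim: nonpos_Reals_cases)
  then have "a + (- x) *\<^sub>R b = 0" using assms by (simp add: field_simps scaleR_conv_of_real)
  then show "\<exists>\<rho>\<ge>0. a + \<rho> *\<^sub>R b = 0" using \<open>x \<le> 0\<close> by (intro exI[of _ "- x"]) auto
next
  assume "\<exists>\<rho>\<ge>0. a + \<rho> *\<^sub>R b = 0"
  then obtain \<rho> where "\<rho> \<ge> 0" "a = - (\<rho> *\<^sub>R b)" by (auto simp: add_eq_0_iff2)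
  then have "a / b = of_real (- \<rho>)" using assms by (simp add: scaleR_conv_of_real)
  then show "a / b \<in> \<real>\<^sub>\<le>\<^sub>0" using \<open>\<rho> \<ge> 0\<close> by (simp add: complex_nonpos_Reals_iff)
qed

lemma has_vector_derivative_approx:
  fixes f :: "real \<Rightarrow> complex"
  assumes "(f has_vector_derivative v) (at x within S)" "\<eta> > 0"
  obtains \<delta> where "\<delta> > 0"
    "\<And>y. y \<in> S \<Longrightarrow> \<bar>y - x\<bar> < \<delta> \<Longrightarrow> norm (f y - f x - (y - x) *\<^sub>R v) \<le> \<eta> * \<bar>y - x\<bar>"
proof -
  have "\<exists>d>0. \<forall>y\<in>S. norm (y - x) < d \<longrightarrow> norm (f y - f x - (y - x) *\<^sub>R v) \<le> \<eta> * norm (y - x)"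
    using assms unfolding has_vector_derivative_def has_derivative_within_alt by auto
  then show thesis using that by auto
qed

text \<open>Here \<open>h\<close> is \<open>u - u0\<close>, and \<open>A\<close>, \<open>B\<close>
  model \<open>\<alpha> u - p1\<close>, \<open>\<alpha> u - p2\<close> with first-order errors
  \<open>a\<close>, \<open>b\<close>. \<open>wedge v\<close> measures the offset from the tangent
  line of \<alpha>; its main terms on \<open>A\<close> and \<open>B\<close> are opposite and
  outweigh the errors. So \<open>A\<close> and \<open>B\<close> lie on opposite sides of that line
  and are not positive multiples of each other.\<close>

lemma crossing_model_inner:
  fixes v w a b :: complex
  assumes "\<epsilon> > 0" "\<bar>h\<bar> \<le> k * \<epsilon>" "norm a \<le> \<eta> * (\<bar>h\<bar> + \<epsilon>)" "norm b \<le> \<eta> * (\<bar>h\<bar> + \<epsilon>)"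
    and "\<eta> > 0" "norm v * \<eta> * (k + 1) < \<bar>wedge v w\<bar>"
  defines "A \<equiv> h *\<^sub>R v - \<epsilon> *\<^sub>R w + a" and "B \<equiv> h *\<^sub>R v + \<epsilon> *\<^sub>R w + b"
  shows "A \<noteq> 0" "B \<noteq> 0" "- (A / B) \<notin> \<real>\<^sub>\<le>\<^sub>0"
proof -
  have bnd: "\<bar>wedge v c\<bar> < \<epsilon> * \<bar>wedge v w\<bar>" if "norm c \<le> \<eta> * (\<bar>h\<bar> + \<epsilon>)" for c
  proof -
    have "\<bar>wedge v c\<bar> \<le> norm v * (\<eta> * (\<bar>h\<bar> + \<epsilon>))"
      using abs_wedge_le[of v c] that mult_left_mono[OF that, of "norm v"] by simp
    also have "\<dots> \<le> norm v * (\<eta> * ((k + 1) * \<epsilon>))"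
      using assms by (intro mult_left_mono) (auto simp: algebra_simps)
    also have "\<dots> = (norm v * \<eta> * (k + 1)) * \<epsilon>" by simp
    also have "\<dots> < \<bar>wedge v w\<bar> * \<epsilon>" using assms by (intro mult_strict_right_mono) auto
    finally show ?thesis by (simp add: mult.commute)
  qed
  have A: "wedge v A = - (\<epsilon> * wedge v w) + wedge v a" and B: "wedge v B = \<epsilon> * wedge v w + wedge v b"
    by (simp_all add: A_def B_def wedge_simps)
  have W: "\<epsilon> * \<bar>wedge v w\<bar> = \<bar>\<epsilon> * wedge v w\<bar>" using assms by (simp add: abs_mult)
  have sgn: "(wedge v A < 0 \<and> wedge v B > 0) \<or> (wedge v A > 0 \<and> wedge v B < 0)"
    using A B bnd[OF assms(3)] bnd[OF assms(4)] unfolding W by linarith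
  show "A \<noteq> 0" "B \<noteq> 0" using sgn by (auto simp: wedge_def)
  show "- (A / B) \<notin> \<real>\<^sub>\<le>\<^sub>0"
  proof
    assume "- (A / B) \<in> \<real>\<^sub>\<le>\<^sub>0"
    then have "(- A) / B \<in> \<real>\<^sub>\<le>\<^sub>0" by simp
    then obtain \<rho> where "\<rho> \<ge> 0" "- A + \<rho> *\<^sub>R B = 0" using ratio_nonpos_iff[OF \<open>B \<noteq> 0\<close>] by blast
    then have "A = \<rho> *\<^sub>R B" by (simp add: neg_eq_iff_add_eq_0)
    then have "wedge v A = \<rho> * wedge v B" by (simp add: wedge_simps)
    then show False using sgn \<open>\<rho> \<ge> 0\<close>
      by (metis linorder_not_less mult_nonneg_nonneg mult_nonneg_nonpos less_imp_le)
  qed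
qed

text \<open>\<open>wedge B A\<close> has the sign of the imaginary part of \<open>A / B\<close>.
  Without errors it equals \<open>- 2 * \<epsilon> * h * wedge v w\<close> and thus changes sign
  with \<open>h\<close>; \<open>small\<close> keeps the error terms below this.\<close>

lemma crossing_model_side:
  fixes v w a b :: complex
  assumes "\<epsilon> > 0" "\<bar>h\<bar> = k * \<epsilon>" "norm a \<le> \<eta> * (\<bar>h\<bar> + \<epsilon>)" "norm b \<le> \<eta> * (\<bar>h\<bar> + \<epsilon>)"
    and "\<eta> > 0" "\<eta> \<le> 1" "k > 0"
    and small: "\<eta> * (k + 1) * (2 * (norm v * k + norm w) + (k + 1)) < 2 * k * \<bar>wedge v w\<bar>"
  defines "A \<equiv> h *\<^sub>R v - \<epsilon> *\<^sub>R w + a" and "B \<equiv> h *\<^sub>R v + \<epsilon> *\<^sub>R w + b"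
  shows "wedge B A * (h * wedge v w) < 0"
proof -
  let ?m = "(norm v * k + norm w) * \<epsilon>" and ?n = "\<eta> * (k + 1) * \<epsilon>"
  have ab: "norm a \<le> ?n" "norm b \<le> ?n" using assms by (auto simp: algebra_simps)
  have m: "norm (h *\<^sub>R v - \<epsilon> *\<^sub>R w) \<le> ?m" "norm (h *\<^sub>R v + \<epsilon> *\<^sub>R w) \<le> ?m"
    using norm_triangle_ineq4[of "h *\<^sub>R v" "\<epsilon> *\<^sub>R w"] norm_triangle_ineq[of "h *\<^sub>R v" "\<epsilon> *\<^sub>R w"] assms
    by (auto simp: algebra_simps)
  have n0: "?n \<ge> 0" "?m \<ge> 0" using assms by auto
  have eq: "wedge B A = - (2 * \<epsilon> * (h * wedge v w)) + (wedge (h *\<^sub>R v + \<epsilon> *\<^sub>R w) a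
      + wedge b (h *\<^sub>R v - \<epsilon> *\<^sub>R w) + wedge b a)"
    unfolding A_def B_def by (simp add: wedge_simps wedge_commute[of w v] algebra_simps)
  have "\<bar>wedge (h *\<^sub>R v + \<epsilon> *\<^sub>R w) a\<bar> \<le> ?m * ?n"
    using abs_wedge_le mult_mono[OF m(2) ab(1) n0(2) norm_ge_zero] order_trans by blast
  moreover have "\<bar>wedge b (h *\<^sub>R v - \<epsilon> *\<^sub>R w)\<bar> \<le> ?n * ?m"
    using abs_wedge_le mult_mono[OF ab(2) m(1) n0(1) norm_ge_zero] order_trans by blast
  moreover have "\<bar>wedge b a\<bar> \<le> ?n * ?n"
    using abs_wedge_le mult_mono[OF ab(2) ab(1) n0(1) norm_ge_zero] order_trans by blast
  ultimately have "\<bar>wedge (h *\<^sub>R v + \<epsilon> *\<^sub>R w) a + wedge b (h *\<^sub>R v - \<epsilon> *\<^sub>R w) + wedge b a\<bar>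
      \<le> 2 * (?m * ?n) + ?n * ?n" by (simp add: mult.commute)
  also have "\<dots> = \<eta> * (k + 1) * (2 * (norm v * k + norm w) + \<eta> * (k + 1)) * \<epsilon>\<^sup>2"
    by (simp add: algebra_simps power2_eq_square)
  also have "\<dots> \<le> \<eta> * (k + 1) * (2 * (norm v * k + norm w) + (k + 1)) * \<epsilon>\<^sup>2"
    using assms by (intro mult_right_mono mult_left_mono add_left_mono) (auto simp: mult_le_cancel_right1)
  also have "\<dots> < 2 * k * \<bar>wedge v w\<bar> * \<epsilon>\<^sup>2"
    using small assms(1) by (intro mult_strict_right_mono) auto
  also have "\<dots> = \<bar>2 * \<epsilon> * (h * wedge v w)\<bar>"
    using assms by (simp add: abs_mult power2_eq_square)
  finally have "(wedge B A < 0 \<and> 2 * \<epsilon> * (h * wedge v w) > 0) \<or> (wedge B A > 0 \<and> 2 * \<epsilon> * (h * wedge v w) < 0)"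
    unfolding eq by linarith
  then show ?thesis using \<open>\<epsilon> > 0\<close> by (auto simp: mult_less_0_iff zero_less_mult_iff)
qed

text \<open>The gap between the two displacements stays of order \<epsilon>, because
  \<open>a\<close> and \<open>b\<close> share the error of \<alpha>, whereas the displacements grow
  with \<open>\<bar>h\<bar>\<close>. One half of \<open>norm v * \<bar>h\<bar>\<close> absorbs
  \<open>\<eta> * \<bar>h\<bar>\<close>. The 6 makes the other half at least
  \<open>3 * (norm w + 1) * \<epsilon>\<close>, of which
  \<open>2 * (norm w + 1) * \<epsilon>\<close> is left to exceed the gap.\<close>

lemma crossing_model_outer:
  fixes v w a b :: complex
  assumes "\<epsilon> > 0" "\<bar>h\<bar> \<ge> k * \<epsilon>" "norm b \<le> \<eta> * (\<bar>h\<bar> + \<epsilon>)"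
    and "norm (a - b) \<le> 2 * \<eta> * \<epsilon>" "\<eta> > 0" "\<eta> \<le> 1 / 2" "\<eta> \<le> norm v / 2"
    and "norm v * k = 6 * (norm w + 1)"
  shows "norm ((h *\<^sub>R v - \<epsilon> *\<^sub>R w + a) - (h *\<^sub>R v + \<epsilon> *\<^sub>R w + b)) < norm (h *\<^sub>R v + \<epsilon> *\<^sub>R w + b)"
proof -
  have "(h *\<^sub>R v - \<epsilon> *\<^sub>R w + a) - (h *\<^sub>R v + \<epsilon> *\<^sub>R w + b) = (a - b) - (2 * \<epsilon>) *\<^sub>R w"
    by (simp add: algebra_simps scaleR_conv_of_real)
  then have "norm ((h *\<^sub>R v - \<epsilon> *\<^sub>R w + a) - (h *\<^sub>R v + \<epsilon> *\<^sub>R w + b)) \<le> 2 * \<eta> * \<epsilon> + 2 * \<epsilon> * norm w"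
    using norm_triangle_ineq4[of "a - b" "(2 * \<epsilon>) *\<^sub>R w"] assms by simp
  also have "\<dots> \<le> (2 * norm w + 1) * \<epsilon>"
    using mult_right_mono[OF \<open>\<eta> \<le> 1 / 2\<close>, of \<epsilon>] assms(1) by (simp add: algebra_simps)
  also have "\<dots> < (2 * norm w + 2) * \<epsilon>" using assms(1) by (simp add: algebra_simps)
  also have "\<dots> \<le> (norm v / 2) * \<bar>h\<bar> - norm w * \<epsilon> - \<epsilon>"
  proof -
    have "(norm v / 2) * (k * \<epsilon>) \<le> (norm v / 2) * \<bar>h\<bar>" using assms by (intro mult_left_mono) auto
    moreover have "(norm v / 2) * (k * \<epsilon>) = (norm v * k) / 2 * \<epsilon>" by simp
    ultimately show ?thesis unfolding assms(8) using assms(1) by (simp add: algebra_simps)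
  qed
  also have "\<dots> \<le> norm v * \<bar>h\<bar> - norm w * \<epsilon> - \<eta> * (\<bar>h\<bar> + \<epsilon>)"
  proof -
    have "\<eta> * \<bar>h\<bar> \<le> norm v * \<bar>h\<bar> / 2" using mult_right_mono[OF assms(7), of "\<bar>h\<bar>"] by simp
    moreover have "\<eta> * \<epsilon> \<le> \<epsilon> / 2" using mult_right_mono[OF \<open>\<eta> \<le> 1 / 2\<close>, of \<epsilon>] assms(1) by simp
    moreover have "norm v / 2 * \<bar>h\<bar> = norm v * \<bar>h\<bar> / 2" by simp
    ultimately show ?thesis using assms(1) unfolding distrib_left by linarith
  qed
  also have "\<dots> \<le> norm (h *\<^sub>R v) - norm (\<epsilon> *\<^sub>R w) - norm b"
    using assms by (simp add: mult.commute)
  also have "\<dots> \<le> norm (h *\<^sub>R v + \<epsilon> *\<^sub>R w + b)"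
    by (smt (verit) norm_diff_ineq)
  finally show ?thesis .
qed

text \<open>A compact image has positive distance from a point off it. This covers the parameters to
  which the first-order approximation does not extend.\<close>

lemma far_part_separated:
  fixes \<alpha> :: "real \<Rightarrow> complex"
  assumes "path \<alpha>" "S \<subseteq> {0..1}" "closed S" "z \<notin> \<alpha> ` S"
  obtains \<mu> where "\<mu> > 0" "\<And>u. u \<in> S \<Longrightarrow> \<mu> \<le> norm (\<alpha> u - z)"
proof -
  have "compact S" using assms bounded_subset[OF bounded_closed_interval] by (auto simp: compact_eq_bounded_closed)
  moreover have "continuous_on S \<alpha>" using assms continuous_on_subset unfolding path_def by blast
  ultimately have "closed (\<alpha> ` S)" using compact_continuous_image compact_imp_closed by blast
  then show thesis
    using separate_point_closed[OF _ assms(4)] that by (force simp: dist_norm norm_minus_commute)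
qed

text \<open>
  The change of the winding number is the winding of the ratio \<open>(\<alpha> u - p1) / (\<alpha> u - p2)\<close>, where
  \<open>p1\<close>, \<open>p2\<close> lie on the two sides of the crossing at distance of order \<open>\<epsilon>\<close>.  For \<open>\<bar>u - u0\<bar> \<ge> k \<epsilon>\<close>
  with \<open>k\<close> large the ratio is close to 1; for \<open>\<bar>u - u0\<bar> \<le> k \<epsilon>\<close> it avoids the positive reals and its
  imaginary part has opposite signs at both ends.
\<close>

lemma winding_number_jump:
  assumes path: "path \<alpha>" and loop: "pathfinish \<alpha> = pathstart \<alpha>" and u0: "0 < u0" "u0 < 1"
    and v: "(\<alpha> has_vector_derivative v) (at u0)" and w: "(\<beta> has_vector_derivative w) (at y0)"
    and z: "\<beta> y0 = \<alpha> u0" and once: "\<And>u. u \<in> {0..1} \<Longrightarrow> \<alpha> u = \<alpha> u0 \<Longrightarrow> u = u0"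
    and W: "wedge v w \<noteq> 0"
  obtains e where "e > 0"
    "\<And>\<epsilon>. 0 < \<epsilon> \<Longrightarrow> \<epsilon> < e \<Longrightarrow>
       \<beta> (y0 + \<epsilon>) \<notin> path_image \<alpha> \<and> \<beta> (y0 - \<epsilon>) \<notin> path_image \<alpha> \<and>
       (\<exists>k. odd k \<and> winding_number \<alpha> (\<beta> (y0 + \<epsilon>)) - winding_number \<alpha> (\<beta> (y0 - \<epsilon>)) = of_int k)"
proof -
  have nv: "norm v > 0" using W by (auto simp: wedge_def)
  \<comment> \<open>The half-width of the window is \<open>k * \<epsilon>\<close>; the value is the
    one demanded by \<open>crossing_model_outer\<close>.\<close>
  define k where "k = 6 * (norm w + 1) / norm v"
  have k: "k > 0" "norm v * k = 6 * (norm w + 1)"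
    using nv norm_ge_zero[of w] by (auto simp: k_def intro!: divide_pos_pos add_nonneg_pos)
  define c where "c = (k + 1) * (2 * (norm v * k + norm w) + (k + 1))"
  have c: "c > 0" using k nv norm_ge_zero[of w] unfolding c_def
    by (intro mult_pos_pos add_nonneg_pos mult_nonneg_nonneg add_nonneg_nonneg) auto
  \<comment> \<open>The first two bounds serve the outer model, the third the inner model, the
    fourth the sign at the ends of the window.\<close>
  define \<eta> where "\<eta> = Min {1 / 2, norm v / 2, \<bar>wedge v w\<bar> / (2 * norm v * (k + 1)), k * \<bar>wedge v w\<bar> / c}"
  have \<eta>: "\<eta> > 0" "\<eta> \<le> 1 / 2" "\<eta> \<le> norm v / 2"
    "\<eta> \<le> \<bar>wedge v w\<bar> / (2 * norm v * (k + 1))" "\<eta> \<le> k * \<bar>wedge v w\<bar> / c"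
  proof -
    show "\<eta> > 0" using W k nv c unfolding \<eta>_def by (auto simp: Min_gr_iff simp del: Min_insert)
  qed (unfold \<eta>_def, rule Min_le; simp)+
  have \<eta>4: "norm v * \<eta> * (k + 1) < \<bar>wedge v w\<bar>"
  proof -
    have "\<eta> * (2 * norm v * (k + 1)) \<le> \<bar>wedge v w\<bar>"
      using \<eta>(4) nv k(1) by (subst pos_le_divide_eq[symmetric]) auto
    then have "norm v * \<eta> * (k + 1) \<le> \<bar>wedge v w\<bar> / 2" by (simp add: algebra_simps)
    then show ?thesis using W by linarith
  qed
  have \<eta>5: "\<eta> * (k + 1) * (2 * (norm v * k + norm w) + (k + 1)) < 2 * k * \<bar>wedge v w\<bar>"
  proof -
    have "\<eta> * c \<le> k * \<bar>wedge v w\<bar>" using \<eta>(5) c by (simp add: field_simps)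
    moreover have "k * \<bar>wedge v w\<bar> > 0" using k W by simp
    ultimately show ?thesis by (simp add: c_def mult.assoc)
  qed
  obtain \<delta>1 where \<delta>1: "\<delta>1 > 0"
    "\<And>u. \<bar>u - u0\<bar> < \<delta>1 \<Longrightarrow> norm (\<alpha> u - \<alpha> u0 - (u - u0) *\<^sub>R v) \<le> \<eta> * \<bar>u - u0\<bar>"
    using has_vector_derivative_approx[OF v \<eta>(1)] by auto
  obtain \<delta>2 where \<delta>2: "\<delta>2 > 0"
    "\<And>y. \<bar>y - y0\<bar> < \<delta>2 \<Longrightarrow> norm (\<beta> y - \<beta> y0 - (y - y0) *\<^sub>R w) \<le> \<eta> * \<bar>y - y0\<bar>"
    using has_vector_derivative_approx[OF w \<eta>(1)] by auto
  define far where "far = {u \<in> {0..1}. \<delta>1 \<le> \<bar>u - u0\<bar>}"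
  have "closed far"
  proof -
    have "far = {0..1} \<inter> {u. \<delta>1 \<le> \<bar>u - u0\<bar>}" by (auto simp: far_def)
    then show ?thesis by (simp add: closed_Int closed_Collect_le continuous_intros)
  qed
  have "\<alpha> u0 \<notin> \<alpha> ` far" using once \<delta>1(1) by (force simp: far_def)
  then obtain \<mu> where \<mu>: "\<mu> > 0" "\<And>u. u \<in> far \<Longrightarrow> \<mu> \<le> norm (\<alpha> u - \<alpha> u0)"
    using far_part_separated[OF path _ \<open>closed far\<close>] by (metis (no_types, lifting) far_def mem_Collect_eq subsetI)
  \<comment> \<open>In order: validity of the approximation of \<beta>, smallness against the
    distance \<mu> of the far part, validity of the approximation of \<alpha> on the window, and, by
    the last two, a window inside the parameter interval.\<close>
  define e where "e = Min {\<delta>2, \<mu> / (4 * norm w + 4), \<delta>1 / k, u0 / k, (1 - u0) / k}"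
  have e: "e > 0" "e \<le> \<delta>2" "e \<le> \<mu> / (4 * norm w + 4)" "e \<le> \<delta>1 / k" "e \<le> u0 / k" "e \<le> (1 - u0) / k"
    using \<delta>1(1) \<delta>2(1) \<mu>(1) k(1) u0 norm_ge_zero[of w] unfolding e_def
    by (auto simp: Min_gr_iff simp del: Min_insert intro!: Min_le divide_pos_pos add_nonneg_pos)
  show thesis
  proof (rule that[OF e(1)])
    fix \<epsilon> :: real assume \<epsilon>: "0 < \<epsilon>" "\<epsilon> < e"
    have ke: "k * \<epsilon> < \<delta>1" "k * \<epsilon> < u0" "k * \<epsilon> < 1 - u0"
    proof -
      have "k * \<epsilon> < k * e" using \<epsilon> k(1) by simp
      moreover have "k * e \<le> \<delta>1" "k * e \<le> u0" "k * e \<le> 1 - u0"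
        using e(4-6) k(1) by (simp_all add: pos_le_divide_eq mult.commute)
      ultimately show "k * \<epsilon> < \<delta>1" "k * \<epsilon> < u0" "k * \<epsilon> < 1 - u0" by linarith+
    qed
    define p1 p2 where "p1 = \<beta> (y0 + \<epsilon>)" and "p2 = \<beta> (y0 - \<epsilon>)"
    define e1 e2 where "e1 = p1 - \<alpha> u0 - \<epsilon> *\<^sub>R w" and "e2 = p2 - \<alpha> u0 + \<epsilon> *\<^sub>R w"
    have e12: "norm e1 \<le> \<eta> * \<epsilon>" "norm e2 \<le> \<eta> * \<epsilon>"
      using \<delta>2(2)[of "y0 + \<epsilon>"] \<delta>2(2)[of "y0 - \<epsilon>"] \<epsilon> e(2) by (auto simp: e1_def e2_def p1_def p2_def z)
    define a where "a u = \<alpha> u - \<alpha> u0 - (u - u0) *\<^sub>R v - e1" for u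
    define b where "b u = \<alpha> u - \<alpha> u0 - (u - u0) *\<^sub>R v - e2" for u
    have A: "\<alpha> u - p1 = (u - u0) *\<^sub>R v - \<epsilon> *\<^sub>R w + a u" for u by (simp add: a_def e1_def)
    have B: "\<alpha> u - p2 = (u - u0) *\<^sub>R v + \<epsilon> *\<^sub>R w + b u" for u by (simp add: b_def e2_def)
    have ab: "norm (a u) \<le> \<eta> * (\<bar>u - u0\<bar> + \<epsilon>)" "norm (b u) \<le> \<eta> * (\<bar>u - u0\<bar> + \<epsilon>)"
      if "\<bar>u - u0\<bar> < \<delta>1" for u
      using norm_triangle_ineq4[of "\<alpha> u - \<alpha> u0 - (u - u0) *\<^sub>R v" e1]
        norm_triangle_ineq4[of "\<alpha> u - \<alpha> u0 - (u - u0) *\<^sub>R v" e2] \<delta>1(2)[OF that] e12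
      by (simp_all add: a_def b_def algebra_simps)
    have diff: "norm (e2 - e1) \<le> 2 * \<eta> * \<epsilon>" using norm_triangle_ineq4[of e2 e1] e12 by simp
    have outer: "norm ((\<alpha> u - p1) - (\<alpha> u - p2)) < norm (\<alpha> u - p2)"
      if u: "u \<in> {0..1}" "k * \<epsilon> \<le> \<bar>u - u0\<bar>" for u
    proof (cases "\<bar>u - u0\<bar> < \<delta>1")
      case True
      have "norm (a u - b u) \<le> 2 * \<eta> * \<epsilon>" using diff by (simp add: a_def b_def)
      then show ?thesis
        unfolding A B using crossing_model_outer[OF \<epsilon>(1) u(2) ab(2)[OF True] _ \<eta>(1-3) k(2)] by blast
    next
      case False
      then have "\<mu> \<le> norm (\<alpha> u - \<alpha> u0)" using u \<mu>(2) by (simp add: far_def)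
      moreover have "norm (\<alpha> u - \<alpha> u0) \<le> norm (\<alpha> u - p2) + norm (p2 - \<alpha> u0)"
        using norm_triangle_ineq[of "\<alpha> u - p2" "p2 - \<alpha> u0"] by simp
      moreover have "norm (p2 - \<alpha> u0) \<le> norm e2 + \<epsilon> * norm w"
        using norm_triangle_ineq4[of e2 "\<epsilon> *\<^sub>R w"] \<epsilon> by (simp add: e2_def)
      moreover have "norm ((\<alpha> u - p1) - (\<alpha> u - p2)) \<le> 2 * \<eta> * \<epsilon> + 2 * \<epsilon> * norm w"
      proof -
        have "(\<alpha> u - p1) - (\<alpha> u - p2) = (e2 - e1) - (2 * \<epsilon>) *\<^sub>R w"
          by (simp add: e1_def e2_def algebra_simps scaleR_conv_of_real)
        then show ?thesis using norm_triangle_ineq4[of "e2 - e1" "(2 * \<epsilon>) *\<^sub>R w"] diff \<epsilon> by simp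
      qed
      moreover have "\<eta> * \<epsilon> \<le> \<epsilon> / 2" using mult_right_mono[OF \<eta>(2), of \<epsilon>] \<epsilon> by simp
      moreover have "4 * (\<epsilon> * norm w) + 4 * \<epsilon> < \<mu>"
      proof -
        have "0 < 4 * norm w + 4" using norm_ge_zero[of w] by linarith
        moreover have "\<epsilon> < \<mu> / (4 * norm w + 4)" using \<epsilon>(2) e(3) by linarith
        ultimately have "\<epsilon> * (4 * norm w + 4) < \<mu>" by (simp only: pos_less_divide_eq)
        then show ?thesis by (simp add: algebra_simps)
      qed
      moreover have "\<epsilon> * norm w \<ge> 0" using \<epsilon> by simp
      moreover have "2 * \<eta> * \<epsilon> = 2 * (\<eta> * \<epsilon>)" "2 * \<epsilon> * norm w = 2 * (\<epsilon> * norm w)" by simp_all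
      ultimately show ?thesis using e12 \<epsilon>(1) by linarith
    qed
    note outer' = near_one_not_nonpos[OF outer]
    have inner: "\<alpha> u - p1 \<noteq> 0" "\<alpha> u - p2 \<noteq> 0" "- ((\<alpha> u - p1) / (\<alpha> u - p2)) \<notin> \<real>\<^sub>\<le>\<^sub>0"
      if u: "\<bar>u - u0\<bar> \<le> k * \<epsilon>" for u
      using crossing_model_inner[OF \<epsilon>(1) u ab[of u] \<eta>(1) \<eta>4] u ke(1) unfolding A B by auto
    have notin: "p1 \<notin> path_image \<alpha>" "p2 \<notin> path_image \<alpha>"
      using outer'(1,2) inner(1,2) unfolding path_image_def by (force simp: not_le)+
    define s1 where "s1 = wedge (\<alpha> (u0 - k * \<epsilon>) - p2) (\<alpha> (u0 - k * \<epsilon>) - p1)"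
    define s2 where "s2 = wedge (\<alpha> (u0 + k * \<epsilon>) - p2) (\<alpha> (u0 + k * \<epsilon>) - p1)"
    have ke0: "k * \<epsilon> > 0" using k \<epsilon> by simp
    have "s1 * (- (k * \<epsilon>) * wedge v w) < 0"
      using crossing_model_side[OF \<epsilon>(1) _ ab[of "u0 - k * \<epsilon>"] \<eta>(1) _ k(1) \<eta>5] ke(1) ke0 \<eta>(2)
      unfolding s1_def A B by simp
    moreover have "s2 * ((k * \<epsilon>) * wedge v w) < 0"
      using crossing_model_side[OF \<epsilon>(1) _ ab[of "u0 + k * \<epsilon>"] \<eta>(1) _ k(1) \<eta>5] ke(1) ke0 \<eta>(2)
      unfolding s2_def A B by simp
    ultimately have "s1 * s2 < 0"
      using ke0 by (auto simp: mult_less_0_iff zero_less_mult_iff)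
    moreover have "norm (\<alpha> (u0 - k * \<epsilon>) - p2) > 0" "norm (\<alpha> (u0 + k * \<epsilon>) - p2) > 0"
      using inner(2)[of "u0 - k * \<epsilon>"] inner(2)[of "u0 + k * \<epsilon>"] ke0 by auto
    ultimately have sides: "Im ((\<alpha> (u0 - k * \<epsilon>) - p1) / (\<alpha> (u0 - k * \<epsilon>) - p2))
        * Im ((\<alpha> (u0 + k * \<epsilon>) - p1) / (\<alpha> (u0 + k * \<epsilon>) - p2)) < 0"
      unfolding Im_divide_wedge s1_def[symmetric] s2_def[symmetric]
      by (simp add: divide_less_0_iff mult_less_0_iff)
    have "\<exists>k. odd k \<and> winding_number \<alpha> p1 - winding_number \<alpha> p2 = of_int k"
    proof (rule winding_number_diff_odd[OF path loop notin _ _ _ _ _ sides])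
      show "(\<alpha> u - p1) / (\<alpha> u - p2) \<notin> \<real>\<^sub>\<le>\<^sub>0"
        if "u \<in> {0..1}" "u \<le> u0 - k * \<epsilon> \<or> u0 + k * \<epsilon> \<le> u" for u
      proof -
        have "k * \<epsilon> \<le> \<bar>u - u0\<bar>" using that(2) ke0 by arith
        then show ?thesis by (rule outer'(3)[OF that(1)])
      qed
      show "- ((\<alpha> u - p1) / (\<alpha> u - p2)) \<notin> \<real>\<^sub>\<le>\<^sub>0" if "u \<in> {u0 - k * \<epsilon>..u0 + k * \<epsilon>}" for u
      proof -
        have "\<bar>u - u0\<bar> \<le> k * \<epsilon>" using that by (simp add: abs_le_iff)
        then show ?thesis by (rule inner(3))
      qed
    qed (use ke ke0 in auto)
    then show "\<beta> (y0 + \<epsilon>) \<notin> path_image \<alpha> \<and> \<beta> (y0 - \<epsilon>) \<notin> path_image \<alpha> \<and>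
       (\<exists>k. odd k \<and> winding_number \<alpha> (\<beta> (y0 + \<epsilon>)) - winding_number \<alpha> (\<beta> (y0 - \<epsilon>)) = of_int k)"
      using notin unfolding p1_def p2_def by blast
  qed
qed

lemma inverse_nonpos_Reals:
  fixes z :: complex
  assumes "z \<in> \<real>\<^sub>\<le>\<^sub>0"
  shows "inverse z \<in> \<real>\<^sub>\<le>\<^sub>0"
proof -
  obtain x where "z = of_real x" "x \<le> 0" using assms by (auto elim: nonpos_Reals_cases)
  then have "inverse z = of_real (inverse x)" "inverse x \<le> 0" by simp_all
  then show ?thesis by (simp only: nonpos_Reals_of_real_iff)
qed

text \<open>A nonpositive ratio would give \<open>x *\<^sub>R A + y *\<^sub>R B = 0\<close> with
  nonnegative coefficients. Taking \<open>wedge\<close> with \<open>v\<close> and with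
  \<open>w\<close> bounds \<open>x * \<epsilon>\<close> and
  \<open>x * h + y * (h + \<epsilon>)\<close> by the errors. These two add up to
  \<open>(x + y) * (h + \<epsilon>)\<close>, the very scale of the errors, which contradicts
  \<open>small\<close>. The coefficients 1, 0 and 0, 1 show that \<open>A\<close> and
  \<open>B\<close> are nonzero.\<close>

lemma corner_model:
  fixes v w a b :: complex
  assumes "\<epsilon> > 0" "h \<ge> 0" "norm a \<le> \<eta> * (h + \<epsilon>)" "norm b \<le> \<eta> * (h + \<epsilon>)" "\<eta> > 0"
    and small: "(norm v + norm w) * \<eta> < \<bar>wedge v w\<bar>"
  defines "A \<equiv> h *\<^sub>R v - \<epsilon> *\<^sub>R w + a" and "B \<equiv> (h + \<epsilon>) *\<^sub>R v + b"
  shows "A \<noteq> 0" "B \<noteq> 0" "A / B \<notin> \<real>\<^sub>\<le>\<^sub>0"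
proof -
  have main: False
    if eq: "x *\<^sub>R A + y *\<^sub>R B = 0" and xy: "x \<ge> 0" "y \<ge> 0" "x + y > 0" for x y
  proof -
    let ?c = "x *\<^sub>R a + y *\<^sub>R b"
    let ?W = "wedge v w"
    have eq': "(x * h + y * (h + \<epsilon>)) *\<^sub>R v - (x * \<epsilon>) *\<^sub>R w + ?c = 0"
      using eq by (simp add: A_def B_def algebra_simps)
    have c: "norm ?c \<le> (x + y) * (\<eta> * (h + \<epsilon>))"
    proof -
      have "norm ?c \<le> x * norm a + y * norm b"
        using norm_triangle_ineq[of "x *\<^sub>R a" "y *\<^sub>R b"] xy by simp
      also have "\<dots> \<le> x * (\<eta> * (h + \<epsilon>)) + y * (\<eta> * (h + \<epsilon>))"
        using assms xy by (intro add_mono mult_left_mono) auto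
      finally show ?thesis by (simp add: algebra_simps)
    qed
    have "wedge v ((x * h + y * (h + \<epsilon>)) *\<^sub>R v - (x * \<epsilon>) *\<^sub>R w + ?c) = 0"
      "wedge ((x * h + y * (h + \<epsilon>)) *\<^sub>R v - (x * \<epsilon>) *\<^sub>R w + ?c) w = 0"
      unfolding eq' by (simp_all add: wedge_def)
    then have 1: "wedge v ?c = x * \<epsilon> * ?W" and 2: "wedge ?c w = - ((x * h + y * (h + \<epsilon>)) * ?W)"
      by (simp_all only: wedge_simps)
    have "(x * \<epsilon>) * \<bar>?W\<bar> = \<bar>wedge v ?c\<bar>" unfolding 1 using assms xy by (simp add: abs_mult)
    also have "\<dots> \<le> norm v * ((x + y) * (\<eta> * (h + \<epsilon>)))"
      using abs_wedge_le mult_left_mono[OF c norm_ge_zero] order_trans by blast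
    finally have 3: "(x * \<epsilon>) * \<bar>?W\<bar> \<le> norm v * ((x + y) * (\<eta> * (h + \<epsilon>)))" .
    have "(x * h + y * (h + \<epsilon>)) * \<bar>?W\<bar> = \<bar>wedge ?c w\<bar>"
      unfolding 2 using assms xy by (simp add: abs_mult)
    also have "\<dots> \<le> ((x + y) * (\<eta> * (h + \<epsilon>))) * norm w"
      using abs_wedge_le mult_right_mono[OF c norm_ge_zero] order_trans by blast
    finally have "(x * h + y * (h + \<epsilon>)) * \<bar>?W\<bar> \<le> norm w * ((x + y) * (\<eta> * (h + \<epsilon>)))"
      by (simp add: mult.commute)
    with 3 have "(x * \<epsilon>) * \<bar>?W\<bar> + (x * h + y * (h + \<epsilon>)) * \<bar>?W\<bar>
        \<le> norm v * ((x + y) * (\<eta> * (h + \<epsilon>))) + norm w * ((x + y) * (\<eta> * (h + \<epsilon>)))"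
      by (rule add_mono)
    then have "((x + y) * (h + \<epsilon>)) * \<bar>?W\<bar> \<le> ((x + y) * (h + \<epsilon>)) * ((norm v + norm w) * \<eta>)"
      by (simp add: algebra_simps)
    moreover have "(x + y) * (h + \<epsilon>) > 0" using assms xy by (intro mult_pos_pos) auto
    ultimately show False using small by (simp add: mult_le_cancel_left)
  qed
  show "A \<noteq> 0" using main[of 1 0] by auto
  show "B \<noteq> 0" using main[of 0 1] by auto
  then show "A / B \<notin> \<real>\<^sub>\<le>\<^sub>0" using ratio_nonpos_iff[of B A] main[of 1] by auto
qed

text \<open>
  Near the start of the loop the ratio \<open>(\<alpha> u - p1) / (\<alpha> u - p2)\<close> stays close to the segment
  from 1 to \<open>- w / v\<close>, near its end the inverse of the ratio stays close to the segment from 1 to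
  \<open>- v / w\<close>.  As \<open>w / v\<close> is not real, the ratio avoids the nonpositive reals.
\<close>

lemma winding_number_corner:
  assumes path: "path \<alpha>" and loop: "\<alpha> 1 = \<alpha> 0"
    and v: "(\<alpha> has_vector_derivative v) (at 0 within {0..1})"
    and w: "(\<alpha> has_vector_derivative w) (at 1 within {0..1})"
    and \<beta>1: "(\<beta>1 has_vector_derivative w) (at 0)" "\<beta>1 0 = \<alpha> 0"
    and \<beta>2: "(\<beta>2 has_vector_derivative - v) (at 0)" "\<beta>2 0 = \<alpha> 0"
    and once: "\<And>u. 0 < u \<Longrightarrow> u < 1 \<Longrightarrow> \<alpha> u \<noteq> \<alpha> 0"
    and W: "wedge v w \<noteq> 0"
  obtains e where "e > 0"
    "\<And>\<epsilon>. 0 < \<epsilon> \<Longrightarrow> \<epsilon> < e \<Longrightarrow>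
       \<beta>1 \<epsilon> \<notin> path_image \<alpha> \<and> \<beta>2 \<epsilon> \<notin> path_image \<alpha> \<and>
       winding_number \<alpha> (\<beta>1 \<epsilon>) = winding_number \<alpha> (\<beta>2 \<epsilon>)"
proof -
  have nv: "norm v > 0" using W by (auto simp: wedge_def)
  define c where "c = norm v + norm w"
  have c: "c > 0" using nv norm_ge_zero[of w] unfolding c_def by linarith
  define \<eta> where "\<eta> = min 1 (\<bar>wedge v w\<bar> / (2 * c))"
  have \<eta>: "\<eta> > 0" "\<eta> \<le> 1" using W c by (auto simp: \<eta>_def)
  have small: "c * \<eta> < \<bar>wedge v w\<bar>"
  proof -
    have "c * \<eta> \<le> c * (\<bar>wedge v w\<bar> / (2 * c))" using c unfolding \<eta>_def by (intro mult_left_mono) auto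
    also have "\<dots> < \<bar>wedge v w\<bar>" using W c by simp
    finally show ?thesis .
  qed
  obtain \<delta>1 where \<delta>1: "\<delta>1 > 0"
    "\<And>u. u \<in> {0..1} \<Longrightarrow> \<bar>u\<bar> < \<delta>1 \<Longrightarrow> norm (\<alpha> u - \<alpha> 0 - u *\<^sub>R v) \<le> \<eta> * \<bar>u\<bar>"
    using has_vector_derivative_approx[OF v \<eta>(1)] unfolding diff_zero by metis
  obtain \<delta>2 where \<delta>2: "\<delta>2 > 0"
    "\<And>u. u \<in> {0..1} \<Longrightarrow> \<bar>u - 1\<bar> < \<delta>2 \<Longrightarrow> norm (\<alpha> u - \<alpha> 1 - (u - 1) *\<^sub>R w) \<le> \<eta> * \<bar>u - 1\<bar>"
    using has_vector_derivative_approx[OF w \<eta>(1)] by metis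
  obtain \<delta>3 where \<delta>3: "\<delta>3 > 0"
    "\<And>y. \<bar>y\<bar> < \<delta>3 \<Longrightarrow> norm (\<beta>1 y - \<beta>1 0 - y *\<^sub>R w) \<le> \<eta> * \<bar>y\<bar>"
    using has_vector_derivative_approx[OF \<beta>1(1) \<eta>(1)] unfolding diff_zero by (metis UNIV_I)
  obtain \<delta>4 where \<delta>4: "\<delta>4 > 0"
    "\<And>y. \<bar>y\<bar> < \<delta>4 \<Longrightarrow> norm (\<beta>2 y - \<beta>2 0 - y *\<^sub>R (- v)) \<le> \<eta> * \<bar>y\<bar>"
    using has_vector_derivative_approx[OF \<beta>2(1) \<eta>(1)] unfolding diff_zero by (metis UNIV_I)
  have "\<alpha> 0 \<notin> \<alpha> ` {\<delta>1..1 - \<delta>2}"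
  proof
    assume "\<alpha> 0 \<in> \<alpha> ` {\<delta>1..1 - \<delta>2}"
    then obtain u where "\<alpha> u = \<alpha> 0" "\<delta>1 \<le> u" "u \<le> 1 - \<delta>2" by (auto simp: eq_commute)
    then show False using once[of u] \<delta>1(1) \<delta>2(1) by auto
  qed
  then obtain \<mu> where \<mu>: "\<mu> > 0" "\<And>u. u \<in> {\<delta>1..1 - \<delta>2} \<Longrightarrow> \<mu> \<le> norm (\<alpha> u - \<alpha> 0)"
  proof (rule far_part_separated[OF path, rotated 2])
    show "{\<delta>1..1 - \<delta>2} \<subseteq> {0..1}" using \<delta>1(1) \<delta>2(1) by auto
  qed auto
  define e where "e = min (min \<delta>3 \<delta>4) (\<mu> / (2 * c + 4))"
  have "e > 0" using \<delta>3(1) \<delta>4(1) \<mu>(1) c by (auto simp: e_def)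
  then show thesis
  proof (rule that)
    fix \<epsilon> :: real assume \<epsilon>: "0 < \<epsilon>" "\<epsilon> < e"
    define p1 p2 where "p1 = \<beta>1 \<epsilon>" and "p2 = \<beta>2 \<epsilon>"
    define e1 e2 where "e1 = p1 - \<alpha> 0 - \<epsilon> *\<^sub>R w" and "e2 = p2 - \<alpha> 0 + \<epsilon> *\<^sub>R v"
    have e12: "norm e1 \<le> \<eta> * \<epsilon>" "norm e2 \<le> \<eta> * \<epsilon>"
      using \<delta>3(2)[of \<epsilon>] \<delta>4(2)[of \<epsilon>] \<epsilon> \<beta>1 \<beta>2 by (auto simp: e1_def e2_def p1_def p2_def e_def)
    have all: "\<alpha> u - p1 \<noteq> 0 \<and> \<alpha> u - p2 \<noteq> 0 \<and> (\<alpha> u - p1) / (\<alpha> u - p2) \<notin> \<real>\<^sub>\<le>\<^sub>0" if u: "u \<in> {0..1}" for u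
    proof -
      consider "u < \<delta>1" | "u > 1 - \<delta>2" | "u \<in> {\<delta>1..1 - \<delta>2}" by force
      then show ?thesis
      proof cases
        case 1
        define d where "d = \<alpha> u - \<alpha> 0 - u *\<^sub>R v"
        have d: "norm d \<le> \<eta> * u" using \<delta>1(2)[of u] 1 u by (simp add: d_def)
        have "norm (d - e1) \<le> \<eta> * (u + \<epsilon>)" "norm (d - e2) \<le> \<eta> * (u + \<epsilon>)"
          using norm_triangle_ineq4[of d e1] norm_triangle_ineq4[of d e2] d e12 by (simp_all add: distrib_left)
        moreover have "\<alpha> u - p1 = u *\<^sub>R v - \<epsilon> *\<^sub>R w + (d - e1)" "\<alpha> u - p2 = (u + \<epsilon>) *\<^sub>R v + (d - e2)"
          by (simp_all add: d_def e1_def e2_def algebra_simps)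
        ultimately show ?thesis
          using corner_model[OF \<epsilon>(1), of u "d - e1" \<eta> "d - e2" v w] u \<eta>(1) small by (simp add: c_def)
      next
        case 2
        \<comment> \<open>Time reversal at the end exchanges \<open>v\<close> with \<open>w\<close>
          and \<open>p1\<close> with \<open>p2\<close>; the displacements are negated to fit the
          model.\<close>
        define d where "d = \<alpha> u - \<alpha> 0 - (u - 1) *\<^sub>R w"
        have d: "norm d \<le> \<eta> * (1 - u)" using \<delta>2(2)[of u] 2 u loop by (simp add: d_def)
        have "norm (e1 - d) \<le> \<eta> * (1 - u + \<epsilon>)" "norm (e2 - d) \<le> \<eta> * (1 - u + \<epsilon>)"
          using norm_triangle_ineq4[of e1 d] norm_triangle_ineq4[of e2 d] d e12 by (simp_all add: distrib_left)
        moreover have "- (\<alpha> u - p2) = (1 - u) *\<^sub>R w - \<epsilon> *\<^sub>R v + (e2 - d)"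
          "- (\<alpha> u - p1) = (1 - u + \<epsilon>) *\<^sub>R w + (e1 - d)"
          by (simp_all add: d_def e1_def e2_def algebra_simps)
        moreover have "\<bar>wedge w v\<bar> = \<bar>wedge v w\<bar>" by (simp add: wedge_commute[of w v])
        ultimately have *: "- (\<alpha> u - p2) \<noteq> 0" "- (\<alpha> u - p1) \<noteq> 0" "- (\<alpha> u - p2) / - (\<alpha> u - p1) \<notin> \<real>\<^sub>\<le>\<^sub>0"
          using corner_model[OF \<epsilon>(1), of "1 - u" "e2 - d" \<eta> "e1 - d" w v] u \<eta>(1) small
          by (simp_all only: c_def) (simp_all add: add.commute)
        have "(\<alpha> u - p1) / (\<alpha> u - p2) \<notin> \<real>\<^sub>\<le>\<^sub>0"
        proof
          assume "(\<alpha> u - p1) / (\<alpha> u - p2) \<in> \<real>\<^sub>\<le>\<^sub>0"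
          then have "inverse ((\<alpha> u - p1) / (\<alpha> u - p2)) \<in> \<real>\<^sub>\<le>\<^sub>0" by (rule inverse_nonpos_Reals)
          moreover have "- (\<alpha> u - p2) / - (\<alpha> u - p1) = inverse ((\<alpha> u - p1) / (\<alpha> u - p2))"
            unfolding inverse_divide by (rule minus_divide_divide)
          ultimately show False using *(3) by (simp only: not_True_eq_False)
        qed
        then show ?thesis using * by auto
      next
        case 3
        have "\<eta> * \<epsilon> \<le> \<epsilon>" using \<eta>(2) \<epsilon>(1) by simp
        moreover have "norm (p2 - \<alpha> 0) \<le> norm e2 + \<epsilon> * norm v"
          using norm_triangle_ineq4[of e2 "\<epsilon> *\<^sub>R v"] \<epsilon> by (simp add: e2_def)
        moreover have "norm (p1 - \<alpha> 0) \<le> norm e1 + \<epsilon> * norm w"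
          using norm_triangle_ineq[of e1 "\<epsilon> *\<^sub>R w"] \<epsilon> by (simp add: e1_def)
        moreover have "norm (\<alpha> u - \<alpha> 0) \<le> norm (\<alpha> u - p2) + norm (p2 - \<alpha> 0)"
          using norm_triangle_ineq[of "\<alpha> u - p2" "p2 - \<alpha> 0"] by simp
        moreover have "norm ((\<alpha> u - p1) - (\<alpha> u - p2)) \<le> norm (p2 - \<alpha> 0) + norm (p1 - \<alpha> 0)"
          using norm_triangle_ineq4[of "p2 - \<alpha> 0" "p1 - \<alpha> 0"] by simp
        moreover have "\<mu> \<le> norm (\<alpha> u - \<alpha> 0)" using \<mu>(2) 3 by blast
        moreover have "2 * (\<epsilon> * norm v) + 2 * (\<epsilon> * norm w) + 4 * \<epsilon> < \<mu>"
        proof -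
          have "0 < 2 * c + 4" using c by linarith
          moreover have "\<epsilon> < \<mu> / (2 * c + 4)" using \<epsilon>(2) by (simp add: e_def)
          ultimately have "\<epsilon> * (2 * c + 4) < \<mu>" by (simp only: pos_less_divide_eq)
          then show ?thesis by (simp add: algebra_simps c_def)
        qed
        moreover have "\<epsilon> * norm w \<ge> 0" "\<epsilon> * norm v \<ge> 0" using \<epsilon> by auto
        ultimately have "norm ((\<alpha> u - p1) - (\<alpha> u - p2)) < norm (\<alpha> u - p2)"
          using e12 \<epsilon>(1) by linarith
        from near_one_not_nonpos[OF this] show ?thesis by blast
      qed
    qed
    then have notin: "p1 \<notin> path_image \<alpha>" "p2 \<notin> path_image \<alpha>" unfolding path_image_def by force+
    then have "winding_number \<alpha> p1 = winding_number \<alpha> p2"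
      using all loop by (intro winding_number_eq_slit path) (auto simp: pathfinish_def pathstart_def)
    then show "\<beta>1 \<epsilon> \<notin> path_image \<alpha> \<and> \<beta>2 \<epsilon> \<notin> path_image \<alpha> \<and>
       winding_number \<alpha> (\<beta>1 \<epsilon>) = winding_number \<alpha> (\<beta>2 \<epsilon>)"
      using notin unfolding p1_def p2_def by blast
  qed
qed

section \<open>Classical diagrams\<close>

text \<open>\<open>f\<close> may behave arbitrarily at isolated points, so the constant is found
  from the punctured limits \<open>G\<close>, which are locally constant in the ordinary sense on a
  connected interval.\<close>

lemma punctured_locally_constant:
  fixes f :: "real \<Rightarrow> bool"
  assumes "\<And>y. y \<in> {a<..<b} \<Longrightarrow> \<exists>c. \<forall>\<^sub>F x in at y. f x = c"
  shows "\<exists>c. \<forall>y\<in>{a<..<b}. \<forall>\<^sub>F x in at y. f x = c"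
proof -
  define G where "G y = (\<forall>\<^sub>F x in at y. f x)" for y
  have G: "G y = c" if "\<forall>\<^sub>F x in at y. f x = c" for y c
  proof (cases c)
    case True
    then show ?thesis using that by (simp add: G_def)
  next
    case False
    then have "\<not> G y" using that eventually_conj[of f "at y" "\<lambda>x. \<not> f x"] by (auto simp: G_def)
    then show ?thesis using False by simp
  qed
  have Gf: "\<forall>\<^sub>F x in at y. f x = G y" if "y \<in> {a<..<b}" for y
    using assms[OF that]
  proof (elim exE)
    fix c assume c: "\<forall>\<^sub>F x in at y. f x = c"
    show ?thesis unfolding G[OF c] by (rule c)
  qed
  have const: "G x = G y" if xy: "x \<in> {a<..<b}" "y \<in> {a<..<b}" for x y
  proof (rule connected_local_const[OF connected_Ioo xy], rule ballI)
    fix p assume p: "p \<in> {a<..<b}"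
    obtain S where S: "open S" "p \<in> S" "\<And>x. x \<in> S \<Longrightarrow> x \<noteq> p \<Longrightarrow> f x = G p"
      using Gf[OF p] unfolding eventually_at_topological
      by (elim exE conjE) (rule that, assumption, assumption, simp)
    have "G q = G p" if "q \<in> S" "q \<noteq> p" for q
    proof (rule G)
      have "open (S - {p})" "q \<in> S - {p}" using S that by auto
      then show "\<forall>\<^sub>F x in at q. f x = G p"
        unfolding eventually_at_topological using S(3) by (intro exI[of _ "S - {p}"]) simp
    qed
    then show "\<forall>\<^sub>F q in at p within {a<..<b}. G p = G q"
      using S(1,2) unfolding eventually_at_topological by (intro exI[of _ S]) simp
  qed
  show ?thesis
  proof (cases "{a<..<b} = {}")
    case False
    then obtain p where p: "p \<in> {a<..<b}" by blast
    have "\<forall>y\<in>{a<..<b}. \<forall>\<^sub>F x in at y. f x = G p"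
    proof
      fix y assume y: "y \<in> {a<..<b}"
      show "\<forall>\<^sub>F x in at y. f x = G p" using Gf[OF y] unfolding const[OF y p] .
    qed
    then show ?thesis by blast
  qed auto
qed

lemma finite_isolated:
  fixes Y :: "real set"
  assumes "finite Y"
  obtains e where "e > 0" "\<And>y. y \<in> Y \<Longrightarrow> y \<noteq> x \<Longrightarrow> e \<le> \<bar>y - x\<bar>"
proof -
  obtain d where d: "d > 0" "\<forall>y\<in>Y. y \<noteq> x \<longrightarrow> d \<le> dist x y"
    using finite_set_avoid[OF assms, of x] by blast
  have "d \<le> \<bar>y - x\<bar>" if "y \<in> Y" "y \<noteq> x" for y
    using d(2) that by (metis abs_minus_commute dist_real_def)
  then show thesis using d(1) that by blast
qed

section \<open>Intersections of the two loops at a crossing\<close>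

context knot_diagram
begin

lemma crossing_pairI: "\<gamma> x = \<gamma> y \<Longrightarrow> x \<noteq> y \<Longrightarrow> \<bar>x - y\<bar> < 1 \<Longrightarrow> crossing_pair \<gamma> x y"
  using Ints_nonzero_abs_less1[of "x - y"] by (auto simp: crossing_pair_def)

text \<open>Distinct times less than 1 apart are incongruent, so three of them over one point would
  contradict the uniqueness of partners.\<close>

lemma no_triple_point:
  assumes "\<gamma> x = \<gamma> y" "\<gamma> y = \<gamma> z" "\<bar>x - y\<bar> < 1" "\<bar>y - z\<bar> < 1" "\<bar>x - z\<bar> < 1" "x \<noteq> y" "y \<noteq> z" "x \<noteq> z"
  shows False
  using crossing_pair_unique[of x y z] crossing_pairI[of x y] crossing_pairI[of y z] assms
    Ints_nonzero_abs_less1[of "x - z"] by auto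

lemma finite_crossing_times:
  assumes "inj_on \<gamma> X" "\<And>x. x \<in> X \<Longrightarrow> \<exists>y. crossing_pair \<gamma> x y"
  shows "finite X"
proof -
  have "\<gamma> ` X \<subseteq> {\<gamma> s |s. \<exists>t. crossing_pair \<gamma> s t}" using assms(2) by blast
  then show ?thesis using finite_double_points assms(1) finite_imageD finite_subset by blast
qed

lemma even_card_loop_intersections:
  assumes st: "s < t" "t < s + 1" "\<gamma> s = \<gamma> t"
  defines "Y \<equiv> {y \<in> {t<..<s + 1}. \<exists>x\<in>{s<..<t}. \<gamma> x = \<gamma> y}"
  shows "finite Y" "even (card Y)"
proof -
  define L where "L = t - s"
  have L: "L > 0" "L < 1" using st by (simp_all add: L_def)
  define \<alpha> where "\<alpha> u = \<gamma> (s + u * L)" for u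
  have \<alpha>01: "\<alpha> 0 = \<gamma> s" "\<alpha> 1 = \<gamma> s" using st(3) by (simp_all add: \<alpha>_def L_def)
  have \<gamma>1: "\<gamma> (s + 1) = \<gamma> s" by (rule curve_shift) simp
  have path: "path \<alpha>" unfolding path_def \<alpha>_def
    by (intro continuous_on_compose2[OF continuous_curve[of UNIV]] continuous_intros) auto
  have loop: "pathfinish \<alpha> = pathstart \<alpha>" using \<alpha>01 by (simp add: pathfinish_def pathstart_def)
  have range: "s + u * L \<in> {s..t}" if "u \<in> {0..1}" for u
  proof -
    have "0 \<le> u * L" "u * L \<le> 1 * L" using that L by (auto intro!: mult_right_mono)
    then show ?thesis by (simp add: L_def)
  qed
  have range': "s + u * L \<in> {s<..<t}" if "u \<in> {0<..<1}" for u
  proof -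
    have "0 < u * L" "u * L < 1 * L" using that L by (auto intro!: mult_strict_right_mono)
    then show ?thesis by (simp add: L_def)
  qed
  have image: "path_image \<alpha> = \<gamma> ` {s..t}"
  proof -
    have "x \<in> (\<lambda>u. s + u * L) ` {0..1}" if "x \<in> {s..t}" for x
      using that L by (intro image_eqI[of _ _ "(x - s) / L"]) (auto simp: L_def)
    then have "(\<lambda>u. s + u * L) ` {0..1} = {s..t}" using range by blast
    then show ?thesis unfolding path_image_def \<alpha>_def by (metis image_image)
  qed
  have der_\<alpha>: "(\<alpha> has_vector_derivative L *\<^sub>R velocity (s + u * L)) (at u)" for u
  proof -
    have "((\<lambda>u. s + u * L) has_vector_derivative L) (at u)"
      by (auto intro!: derivative_eq_intros simp: has_real_derivative_iff_has_vector_derivative[symmetric])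
    from vector_diff_chain_at[OF this has_velocity] show ?thesis by (simp add: \<alpha>_def[abs_def] comp_def)
  qed
  have inj: "inj_on \<gamma> Y"
  proof (rule inj_onI)
    fix y y' assume *: "y \<in> Y" "y' \<in> Y" "\<gamma> y = \<gamma> y'"
    then obtain x where "x \<in> {s<..<t}" "\<gamma> x = \<gamma> y" by (auto simp: Y_def)
    then show "y = y'"
        using no_triple_point[of x y y'] * st by (cases "y = y'") (auto simp: Y_def abs_less_iff)
  qed
  show finY: "finite Y"
  proof (rule finite_crossing_times[OF inj])
    fix y assume "y \<in> Y"
    then obtain x where "x \<in> {s<..<t}" "\<gamma> y = \<gamma> x" "y \<in> {t<..<s + 1}" by (auto simp: Y_def)
    then show "\<exists>x. crossing_pair \<gamma> y x" by (intro exI[of _ x] crossing_pairI) auto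
  qed
  have off: "\<gamma> y \<notin> path_image \<alpha>" if y: "y \<in> {t<..<s + 1}" "y \<notin> Y" for y
  proof
    assume "\<gamma> y \<in> path_image \<alpha>"
    then obtain x where x: "x \<in> {s..t}" "\<gamma> y = \<gamma> x" by (auto simp: image)
    then have "x = s \<or> x = t" using y by (force simp: Y_def)
    then have "\<gamma> y = \<gamma> s" using x st by auto
    then show False using no_triple_point[of y s t] st y by auto
  qed
  define W where "W y = winding_number \<alpha> (\<gamma> y)" for y
  \<comment> \<open>At times in \<open>Y\<close> the point lies on \<alpha> and its winding number
    carries no information; \<open>f\<close> is therefore examined only off \<open>Y\<close> and in
    punctured neighbourhoods.\<close>
  define par where "par y = (\<exists>k. even k \<and> W y = of_int k)" for y
  have par_iff: "par y \<longleftrightarrow> even k" if "W y = of_int k" for y k using that by (auto simp: par_def)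
  \<comment> \<open>Compares the parity of the winding number with that of the number of
    intersections already passed. Both flip at a point of \<open>Y\<close>, so \<open>f\<close> does
    not.\<close>
  define f where "f y = (par y = even (card (Y \<inter> {..<y})))" for y
  have const: "f x = f y"
    if I: "{a<..<b} \<subseteq> {t<..<s + 1}" "{a<..<b} \<inter> Y = {}" and xy: "x \<in> {a<..<b}" "y \<in> {a<..<b}" for a b x y
  proof -
    have "connected (\<gamma> ` {a<..<b})" using connected_continuous_image continuous_curve connected_Ioo by blast
    moreover have "\<gamma> ` {a<..<b} \<inter> path_image \<alpha> = {}" using off I by blast
    ultimately have "W x = W y"
      using winding_number_constant[OF path loop] xy unfolding constant_on_def W_def by (metis imageI)
    moreover have "z < x \<longleftrightarrow> z < y" if "z \<in> Y" for z
    proof -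
      have "z \<notin> {a<..<b}" using I(2) that by blast
      then show ?thesis using xy by auto
    qed
    then have "Y \<inter> {..<x} = Y \<inter> {..<y}" by blast
    ultimately show ?thesis by (simp add: f_def par_def)
  qed
  \<comment> \<open>The clause for times off \<open>Y\<close> allows the return from the common
    punctured limit to values of \<open>f\<close>.\<close>
  have "\<exists>c. (\<forall>\<^sub>F x in at y0. f x = c) \<and> (y0 \<notin> Y \<longrightarrow> c = f y0)" if y0: "y0 \<in> {t<..<s + 1}" for y0
  proof -
    obtain e0 where e0: "e0 > 0" "\<And>y. y \<in> Y \<Longrightarrow> y \<noteq> y0 \<Longrightarrow> e0 \<le> \<bar>y - y0\<bar>"
      using finite_isolated[OF finY] by metis
    define e where "e = min e0 (min (y0 - t) (s + 1 - y0))"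
    have e: "e > 0" "e \<le> e0" "e \<le> y0 - t" "e \<le> s + 1 - y0" using e0 y0 by (auto simp: e_def)
    have sub: "{y0 - e<..<y0 + e} \<subseteq> {t<..<s + 1}" using e by auto
    have iso: "y = y0" if "y \<in> Y" "y \<in> {y0 - e<..<y0 + e}" for y
    proof (rule ccontr)
      assume "y \<noteq> y0"
      then have "e0 \<le> \<bar>y - y0\<bar>" using e0(2) that by blast
      moreover have "\<bar>y - y0\<bar> < e" using that(2) by (auto simp: abs_less_iff)
      ultimately show False using e(2) by simp
    qed
    have ev: "\<forall>\<^sub>F x in at y0. f x = c" if "\<And>x. x \<in> {y0 - e<..<y0 + e} \<Longrightarrow> x \<noteq> y0 \<Longrightarrow> f x = c" for c
      unfolding eventually_at_topological
      using that e(1) by (intro exI[of _ "{y0 - e<..<y0 + e}"]) auto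
    show ?thesis
    proof (cases "y0 \<in> Y")
      case False
      have "f x = f y0" if "x \<in> {y0 - e<..<y0 + e}" for x
        using const[OF sub _ that, of y0] iso False e(1) by force
      then show ?thesis using ev by blast
    next
      case True
      then obtain x0 where x0: "x0 \<in> {s<..<t}" "\<gamma> x0 = \<gamma> y0" by (auto simp: Y_def)
      define u0 where "u0 = (x0 - s) / L"
      have u0: "0 < u0" "u0 < 1" "s + u0 * L = x0" using x0 L by (auto simp: u0_def L_def)
      have cp: "crossing_pair \<gamma> x0 y0" using x0 y0 by (intro crossing_pairI) auto
      \<comment> \<open>Another parameter of \<alpha> over this point would be a third passage
        besides \<open>x0\<close> and \<open>y0\<close>.\<close>
      have once: "u = u0" if "u \<in> {0..1}" "\<alpha> u = \<alpha> u0" for u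
      proof (rule ccontr)
        assume "u \<noteq> u0"
        then have "s + u * L \<noteq> x0" using u0(3) L by auto
        moreover have "\<gamma> (s + u * L) = \<gamma> x0" using that(2) u0(3) by (simp add: \<alpha>_def)
        ultimately show False
          using no_triple_point[of "s + u * L" x0 y0] x0 y0 range[OF that(1)] st
          by (auto simp: abs_less_iff)
      qed
      have "wedge (L *\<^sub>R velocity (s + u0 * L)) (velocity y0) \<noteq> 0"
        using crossing_transverse[OF cp] L u0(3) by (simp add: wedge_simps)
      moreover have "\<gamma> y0 = \<alpha> u0" using x0 u0(3) by (simp add: \<alpha>_def)
      ultimately obtain d where d: "d > 0" "\<And>\<epsilon>. 0 < \<epsilon> \<Longrightarrow> \<epsilon> < d \<Longrightarrow>
         \<gamma> (y0 + \<epsilon>) \<notin> path_image \<alpha> \<and> \<gamma> (y0 - \<epsilon>) \<notin> path_image \<alpha> \<and>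
         (\<exists>k. odd k \<and> W (y0 + \<epsilon>) - W (y0 - \<epsilon>) = of_int k)"
        using winding_number_jump[OF path loop u0(1,2) der_\<alpha> has_velocity _ once] unfolding W_def by metis
      define \<epsilon> where "\<epsilon> = min d e / 2"
      have \<epsilon>: "0 < \<epsilon>" "\<epsilon> < d" "\<epsilon> < e" using d(1) e(1) by (auto simp: \<epsilon>_def)
      obtain k where k: "odd k" "W (y0 + \<epsilon>) - W (y0 - \<epsilon>) = of_int k" using d(2)[OF \<epsilon>(1,2)] by blast
      obtain k1 where k1: "W (y0 - \<epsilon>) = of_int k1"
        using integer_winding_number[OF path loop] d(2)[OF \<epsilon>(1,2)] unfolding W_def by (meson Ints_cases)
      have "W (y0 + \<epsilon>) = of_int (k1 + k)" using k(2) k1 by (simp add: algebra_simps)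
      then have "par (y0 + \<epsilon>) \<noteq> par (y0 - \<epsilon>)" using par_iff k1 k(1) by (metis even_add)
      moreover have "Y \<inter> {..<y0 + \<epsilon>} = insert y0 (Y \<inter> {..<y0 - \<epsilon>})"
        using True iso \<epsilon> by force
      then have "card (Y \<inter> {..<y0 + \<epsilon>}) = Suc (card (Y \<inter> {..<y0 - \<epsilon>}))"
        using finY \<epsilon> by (simp add: card_insert_if)
      ultimately have match: "f (y0 + \<epsilon>) = f (y0 - \<epsilon>)" unfolding f_def by auto
      have "f x = f (y0 + \<epsilon>)" if "x \<in> {y0 - e<..<y0 + e}" "x \<noteq> y0" for x
      proof (cases "x < y0")
        case True
        have "{y0 - e<..<y0} \<inter> Y = {}" using iso e(1) by fastforce
        then have "f x = f (y0 - \<epsilon>)" using sub that True \<epsilon> by (intro const[of "y0 - e" y0]) auto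
        then show ?thesis using match by simp
      next
        case False
        have "{y0<..<y0 + e} \<inter> Y = {}" using iso e(1) by fastforce
        then show ?thesis using sub that False \<epsilon> by (intro const[of y0 "y0 + e"]) auto
      qed
      then show ?thesis using ev True by blast
    qed
  qed
  note local = this
  then obtain c where c: "\<And>y. y \<in> {t<..<s + 1} \<Longrightarrow> \<forall>\<^sub>F x in at y. f x = c"
    using punctured_locally_constant[of t "s + 1" f] by metis
  have f_c: "f y = c" if "y \<in> {t<..<s + 1}" "y \<notin> Y" for y
  proof -
    have "\<forall>\<^sub>F x in at y. f x = f y" using local that by blast
    then have "\<forall>\<^sub>F x in at y. f y = c" using c[OF that(1)] by eventually_elim simp
    then show ?thesis by simp
  qed
  \<comment> \<open>\<open>\<beta>1\<close> follows the curve past the end of \<alpha>, and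
    \<open>\<beta>2\<close> runs backwards from \<open>s + 1\<close>, the start of \<alpha> one
    period later. The factor \<open>L\<close> matches the speed of the rescaled \<alpha>.\<close>
  define \<beta>1 \<beta>2 where "\<beta>1 \<epsilon> = \<gamma> (t + \<epsilon> * L)" and "\<beta>2 \<epsilon> = \<gamma> (s + 1 - \<epsilon> * L)" for \<epsilon>
  have "velocity (s + 1) = velocity s" by (rule velocity_shift) simp
  have der_\<beta>1: "(\<beta>1 has_vector_derivative L *\<^sub>R velocity t) (at 0)"
  proof -
    have "((\<lambda>u. t + u * L) has_vector_derivative L) (at 0)"
      by (auto intro!: derivative_eq_intros simp: has_real_derivative_iff_has_vector_derivative[symmetric])
    from vector_diff_chain_at[OF this has_velocity] show ?thesis by (simp add: \<beta>1_def[abs_def] comp_def)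
  qed
  have der_\<beta>2: "(\<beta>2 has_vector_derivative - (L *\<^sub>R velocity s)) (at 0)"
  proof -
    have "((\<lambda>u. s + 1 - u * L) has_vector_derivative - L) (at 0)"
      by (auto intro!: derivative_eq_intros simp: has_real_derivative_iff_has_vector_derivative[symmetric])
    from vector_diff_chain_at[OF this has_velocity] show ?thesis
      using \<open>velocity (s + 1) = velocity s\<close> by (simp add: \<beta>2_def[abs_def] comp_def)
  qed
  have "crossing_pair \<gamma> s t" using st by (intro crossing_pairI) auto
  then have W0: "wedge (L *\<^sub>R velocity s) (L *\<^sub>R velocity t) \<noteq> 0"
    using crossing_transverse L by (simp add: wedge_simps)
  have simple_base: "\<gamma> x \<noteq> \<gamma> s" if "x \<in> {s<..<t}" for x
    using no_triple_point[of x s t] that st by (auto simp: abs_less_iff)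
  have once0: "\<alpha> u \<noteq> \<alpha> 0" if "0 < u" "u < 1" for u
    using simple_base[OF range'[of u]] that unfolding \<alpha>01(1) by (simp add: \<alpha>_def)
  have der0: "(\<alpha> has_vector_derivative L *\<^sub>R velocity s) (at 0 within {0..1})"
    using has_vector_derivative_at_within[OF der_\<alpha>[of 0]] by simp
  have der1: "(\<alpha> has_vector_derivative L *\<^sub>R velocity t) (at 1 within {0..1})"
    using has_vector_derivative_at_within[OF der_\<alpha>[of 1]] by (simp add: L_def)
  have "\<alpha> 1 = \<alpha> 0" "\<beta>1 0 = \<alpha> 0" "\<beta>2 0 = \<alpha> 0" using \<alpha>01 \<gamma>1 st(3) by (simp_all add: \<beta>1_def \<beta>2_def)
  then obtain d where d: "d > 0" "\<And>\<epsilon>. 0 < \<epsilon> \<Longrightarrow> \<epsilon> < d \<Longrightarrow>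
       winding_number \<alpha> (\<beta>1 \<epsilon>) = winding_number \<alpha> (\<beta>2 \<epsilon>)"
    using winding_number_corner[OF path _ der0 der1 der_\<beta>1 _ der_\<beta>2 _ once0 W0] by metis
  obtain e1 where e1: "e1 > 0" "\<And>y. y \<in> Y \<Longrightarrow> y \<noteq> t \<Longrightarrow> e1 \<le> \<bar>y - t\<bar>"
    using finite_isolated[OF finY] by metis
  obtain e2 where e2: "e2 > 0" "\<And>y. y \<in> Y \<Longrightarrow> y \<noteq> s + 1 \<Longrightarrow> e2 \<le> \<bar>y - (s + 1)\<bar>"
    using finite_isolated[OF finY] by metis
  \<comment> \<open>For such \<epsilon> the corner estimate applies, \<open>y1\<close> precedes all
    of \<open>Y\<close> and \<open>y2\<close> follows all of it, so the counts to be compared are 0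
    and \<open>card Y\<close>.\<close>
  have "Min {d, e1 / L, e2 / L, (s + 1 - t) / L} > 0" using d(1) e1(1) e2(1) L st by auto
  from dense[OF this] obtain \<epsilon>
    where "\<epsilon> > 0" "\<epsilon> < Min {d, e1 / L, e2 / L, (s + 1 - t) / L}" by blast
  then have "\<epsilon> < d" "\<epsilon> < e1 / L" "\<epsilon> < e2 / L" "\<epsilon> < (s + 1 - t) / L" by auto
  then have \<epsilon>: "\<epsilon> < d" "\<epsilon> * L < e1" "\<epsilon> * L < e2" "\<epsilon> * L < s + 1 - t" "\<epsilon> * L > 0"
    using L \<open>\<epsilon> > 0\<close> by (auto simp: pos_less_divide_eq)
  define y1 y2 where "y1 = t + \<epsilon> * L" and "y2 = s + 1 - \<epsilon> * L"
  have y12: "y1 \<in> {t<..<s + 1}" "y2 \<in> {t<..<s + 1}" using \<epsilon> by (auto simp: y1_def y2_def)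
  have Y1: "y > y1" if "y \<in> Y" for y
    using e1(2)[OF that] that \<epsilon>(2) by (auto simp: y1_def Y_def)
  have Y2: "y < y2" if "y \<in> Y" for y
    using e2(2)[OF that] that \<epsilon>(3) by (auto simp: y2_def Y_def)
  have "f y1 = f y2" using f_c[OF y12(1)] f_c[OF y12(2)] Y1 Y2 by blast
  moreover have "par y1 = par y2"
    using d(2)[OF \<open>\<epsilon> > 0\<close> \<epsilon>(1)] by (simp add: par_def W_def \<beta>1_def \<beta>2_def y1_def y2_def)
  moreover have "Y \<inter> {..<y1} = {}" using Y1 by (force simp: disjoint_iff)
  moreover have "Y \<inter> {..<y2} = Y" using Y2 by blast
  ultimately show "even (card Y)" unfolding f_def by (cases "par y2") simp_all
qed

text \<open>Passages of the loop are sorted by their partners: on the other loop for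
  \<open>X\<close>, later on the same loop for \<open>A\<close>, earlier for \<open>B\<close>.
  Through their points in the plane \<open>X\<close> is matched with \<open>Y\<close>, the same
  intersections timed on the other loop, and \<open>A\<close> with \<open>B\<close>.\<close>

lemma even_card_crossing_times:
  assumes st: "s < t" "t < s + 1" "\<gamma> s = \<gamma> t"
  shows "even (card ({x. \<exists>y. crossing_pair \<gamma> x y} \<inter> {s<..<t}))"
proof -
  define Y where "Y = {y \<in> {t<..<s + 1}. \<exists>x\<in>{s<..<t}. \<gamma> x = \<gamma> y}"
  define X where "X = {x \<in> {s<..<t}. \<exists>y\<in>{t<..<s + 1}. \<gamma> x = \<gamma> y}"
  define A where "A = {x \<in> {s<..<t}. \<exists>y\<in>{s<..<t}. x < y \<and> \<gamma> x = \<gamma> y}"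
  define B where "B = {x \<in> {s<..<t}. \<exists>y\<in>{s<..<t}. y < x \<and> \<gamma> x = \<gamma> y}"
  have inj: "inj_on \<gamma> X" "inj_on \<gamma> Y" "inj_on \<gamma> A" "inj_on \<gamma> B"
  proof -
    show "inj_on \<gamma> X"
    proof (rule inj_onI)
      fix x x' assume *: "x \<in> X" "x' \<in> X" "\<gamma> x = \<gamma> x'"
      then obtain y where "y \<in> {t<..<s + 1}" "\<gamma> x = \<gamma> y" by (auto simp: X_def)
      then show "x = x'"
        using no_triple_point[of y x x'] * st by (cases "x = x'") (auto simp: X_def abs_less_iff)
    qed
    show "inj_on \<gamma> Y"
    proof (rule inj_onI)
      fix x x' assume *: "x \<in> Y" "x' \<in> Y" "\<gamma> x = \<gamma> x'"
      then obtain y where "y \<in> {s<..<t}" "\<gamma> y = \<gamma> x" by (auto simp: Y_def)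
      then show "x = x'"
        using no_triple_point[of y x x'] * st by (cases "x = x'") (auto simp: Y_def abs_less_iff)
    qed
    show "inj_on \<gamma> A"
    proof (rule inj_onI)
      fix x x' assume *: "x \<in> A" "x' \<in> A" "\<gamma> x = \<gamma> x'"
      then obtain y y' where "y \<in> {s<..<t}" "x < y" "\<gamma> x = \<gamma> y" "y' \<in> {s<..<t}" "x' < y'" "\<gamma> x' = \<gamma> y'"
        by (auto simp: A_def)
      then show "x = x'" using no_triple_point[of x x' y] no_triple_point[of x x' y'] * st by (force simp: A_def)
    qed
    show "inj_on \<gamma> B"
    proof (rule inj_onI)
      fix x x' assume *: "x \<in> B" "x' \<in> B" "\<gamma> x = \<gamma> x'"
      then obtain y y' where "y \<in> {s<..<t}" "y < x" "\<gamma> x = \<gamma> y" "y' \<in> {s<..<t}" "y' < x'" "\<gamma> x' = \<gamma> y'"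
        by (auto simp: B_def)
      then show "x = x'" using no_triple_point[of x x' y] no_triple_point[of x x' y'] * st by (force simp: B_def)
    qed
  qed
  have cross: "\<exists>y. crossing_pair \<gamma> x y" if "x \<in> X \<union> (A \<union> B)" for x
  proof -
    have "\<exists>y. \<gamma> x = \<gamma> y \<and> x \<noteq> y \<and> \<bar>x - y\<bar> < 1"
      using that st by (fastforce simp: X_def A_def B_def abs_less_iff)
    then show ?thesis using crossing_pairI by blast
  qed
  have fin: "finite X" "finite A" "finite B"
    by (rule finite_crossing_times[OF inj(1)] finite_crossing_times[OF inj(3)]
        finite_crossing_times[OF inj(4)], rule cross, blast)+
  have disj: "X \<inter> (A \<union> B) = {}" "A \<inter> B = {}"
  proof -
    show "X \<inter> (A \<union> B) = {}"
    proof (rule ccontr)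
      assume "X \<inter> (A \<union> B) \<noteq> {}"
      then obtain x where "x \<in> X" and AB: "x \<in> A \<union> B" by blast
      then obtain y where y: "x \<in> {s<..<t}" "y \<in> {t<..<s + 1}" "\<gamma> y = \<gamma> x" by (auto simp: X_def)
      from AB have "\<exists>z. z \<in> {s<..<t} \<and> x \<noteq> z \<and> \<gamma> x = \<gamma> z" unfolding A_def B_def by blast
      then obtain z where "z \<in> {s<..<t}" "x \<noteq> z" "\<gamma> x = \<gamma> z" by blast
      with y show False using no_triple_point[of y x z] st by (auto simp: abs_less_iff)
    qed
    show "A \<inter> B = {}"
    proof (rule ccontr)
      assume "A \<inter> B \<noteq> {}"
      then obtain x where AB: "x \<in> A" "x \<in> B" by blast
      from AB(1) obtain y where y: "x \<in> {s<..<t}" "y \<in> {s<..<t}" "x < y" "\<gamma> y = \<gamma> x"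
        by (auto simp: A_def)
      from AB(2) obtain z where "z \<in> {s<..<t}" "z < x" "\<gamma> x = \<gamma> z" by (auto simp: B_def)
      with y show False using no_triple_point[of y x z] st by (auto simp: abs_less_iff)
    qed
  qed
  have "\<gamma> ` X = \<gamma> ` Y" by (auto simp: X_def Y_def image_iff Bex_def) metis
  then have "card X = card Y" using inj by (metis card_image)
  then have evX: "even (card X)" using even_card_loop_intersections(2)[OF st] by (simp add: Y_def)
  have "\<gamma> x \<in> \<gamma> ` B" if "x \<in> A" for x
  proof -
    from that obtain y where "y \<in> {s<..<t}" "x \<in> {s<..<t}" "x < y" "\<gamma> x = \<gamma> y" by (auto simp: A_def)
    then show ?thesis by (intro image_eqI[of _ _ y]) (auto simp: B_def)
  qed
  moreover have "\<gamma> x \<in> \<gamma> ` A" if "x \<in> B" for x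
  proof -
    from that obtain y where "y \<in> {s<..<t}" "x \<in> {s<..<t}" "y < x" "\<gamma> x = \<gamma> y" by (auto simp: B_def)
    then show ?thesis by (intro image_eqI[of _ _ y]) (auto simp: A_def)
  qed
  ultimately have "\<gamma> ` A = \<gamma> ` B" by blast
  then have AB: "card A = card B" using inj by (metis card_image)
  have "{x. \<exists>y. crossing_pair \<gamma> x y} \<inter> {s<..<t} = X \<union> (A \<union> B)"
  proof
    show "X \<union> (A \<union> B) \<subseteq> {x. \<exists>y. crossing_pair \<gamma> x y} \<inter> {s<..<t}"
    proof
      fix x assume x: "x \<in> X \<union> (A \<union> B)"
      then have "x \<in> {s<..<t}" by (auto simp: X_def A_def B_def)
      then show "x \<in> {x. \<exists>y. crossing_pair \<gamma> x y} \<inter> {s<..<t}" using cross[OF x] by blast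
    qed
    show "{x. \<exists>y. crossing_pair \<gamma> x y} \<inter> {s<..<t} \<subseteq> X \<union> (A \<union> B)"
    proof
      fix x assume "x \<in> {x. \<exists>y. crossing_pair \<gamma> x y} \<inter> {s<..<t}"
      then obtain y where x: "x \<in> {s<..<t}" and y: "crossing_pair \<gamma> x y" by blast
      \<comment> \<open>The partner of \<open>x\<close> moved into the period starting at
        \<open>s\<close>. It is neither \<open>s\<close> nor \<open>t\<close>, since then
        \<open>x\<close> would be a third passage of the base crossing.\<close>
      define r where "r = s + frac (y - s)"
      have ry: "r - y \<in> \<int>" by (simp add: r_def frac_def)
      have r: "s \<le> r" "r < s + 1" by (simp_all add: r_def frac_lt_1)
      have \<gamma>r: "\<gamma> x = \<gamma> r" using y curve_congruent[OF ry] by (simp add: crossing_pair_def)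
      have "r \<noteq> x" using y ry by (auto simp: crossing_pair_def)
      have "r \<noteq> s" "r \<noteq> t" using no_triple_point[of x s t] x st \<gamma>r by (auto simp: abs_less_iff)
      then have "r \<in> {s<..<t} \<or> r \<in> {t<..<s + 1}" using r by auto
      then consider "r \<in> {t<..<s + 1}" | "r \<in> {s<..<t}" "x < r" | "r \<in> {s<..<t}" "r < x"
        using \<open>r \<noteq> x\<close> by fastforce
      then show "x \<in> X \<union> (A \<union> B)"
        by cases (use x \<gamma>r in \<open>unfold X_def A_def B_def, blast+\<close>)
    qed
  qed
  then show ?thesis using fin disj evX AB by (simp add: card_Un_disjoint)
qed

end

text \<open>Without virtual crossings the passages are all the crossing times, so the counts in
  \<open>Odd\<close> are the even ones found for loops.\<close>

lemma Odd_classical_diagram: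
  assumes "classical_diagram K"
  shows "Odd K = {}"
proof -
  interpret knot_diagram K using assms by unfold_locales (simp add: classical_diagram_def)
  have "passages = {x. \<exists>y. crossing_pair \<gamma> x y}"
  proof
    show "passages \<subseteq> {x. \<exists>y. crossing_pair \<gamma> x y}"
      using over_partner under_partner crossing_pair_sym by blast
    show "{x. \<exists>y. crossing_pair \<gamma> x y} \<subseteq> passages"
      using assms by (auto simp: classical_diagram_def)
  qed
  then show ?thesis using even_card_crossing_times unfolding Odd_def by auto
qed

section \<open>From single moves to the generated equivalence\<close>

lemma J_elementary_move:
  assumes "elementary_move K K'"
  shows "J K = J K'"
  using assms J_reparametrization J_planar_isotopy J_reidemeister_1 J_reidemeister_2 J_reidemeister_3
    J_detour_move unfolding elementary_move_def by blast

lemma J_virtually_equivalent: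
  assumes "virtually_equivalent K K'"
  shows "J K = J K'"
  using assms unfolding virtually_equivalent_def
  by (induction rule: equivclp_induct) (auto dest: J_elementary_move)

theorem mainTheorem4:
  shows "(\<forall>K K'. virtual_knot_diagram K \<and> virtual_knot_diagram K' \<and>
              virtually_equivalent K K' \<longrightarrow> J K = J K') \<and>
         (\<forall>K. classical_diagram K \<longrightarrow> Odd K = {}) \<and>
         (\<forall>K C. virtual_knot_diagram K \<and> classical_diagram C \<and>
              virtually_equivalent K C \<longrightarrow> J K = 0)"
proof -
  have "J K = J K'" if "virtually_equivalent K K'" for K K'
    using J_virtually_equivalent[OF that] .
  moreover have "J C = 0" if "classical_diagram C" for C
    using Odd_classical_diagram[OF that] by (simp add: J_def)
  ultimately show ?thesis using Odd_classical_diagram by metis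
qed

end
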